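(* Let $\widetilde G$ be a pseudo-Riemannian (i.e. non-degenerate) $g$-natural metric on the unit tangent sphere bundle $T_1M$ of a Riemannian manifold $(M,\langle\cdot,\cdot\rangle)$, determined by real constants $a,b,c,d$, and put $\alpha=a(a+c)-b^2$, $\phi=a(a+c+d)-b^2$. Let $\rho>0$ be a real constant and let $\widetilde\xi,\widetilde\eta,\widetilde\varphi$ be the vector field, $1$-form and $(1,1)$-tensor field on $T_1M$ given at $(x,u)\in T_1M$ by $$\widetilde\xi=\rho u^h,\qquad \widetilde\eta(X^h)=\frac1\rho\langle X,u\rangle,\qquad \widetilde\eta(Y^{t_G})=b\rho\langle Y,u\rangle,$$ $$\widetilde\varphi(X^h)=\frac{1}{2\rho\alpha}\Big(-bX^h+(a+c)X^{t_G}+\frac{bd}{a+c+d}\langle X,u\rangle u^h\Big),$$ $$\widetilde\varphi(Y^{t_G})=\frac{1}{2\rho\alpha}\Big(-aY^h+bY^{t_G}+\frac{\phi}{a+c+d}\langle Y,u\rangle u^h\Big),$$ for all $X,Y\in M_x$ with $Y$ orthogonal to $u$ (so that the terms containing $\langle Y,u\rangle$ vanish pointwise). Then $\widetilde G$ is an associated metric for $(\widetilde\varphi,\widetilde\xi,\widetilde\eta)$ (that is, $(\widetilde\varphi,\widetilde\xi,\widetilde\eta,\widetilde G)$ is a paracontact metric structure on $T_1M$) if and only if $$a+c+d=-4\alpha=\frac{1}{\rho^2}.$$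
   Context: $(M,\langle\cdot,\cdot\rangle)$ is a Riemannian manifold of dimension $n+1$ with $n\ge1$, with Levi-Civita connection $\nabla$; $M_x$ is its tangent space at $x$. $T_1M=\{(x,u)\in TM:\langle u,u\rangle=1\}$, of dimension $2n+1$. For $X\in M_x$, $X^h$ and $X^v$ denote the horizontal (with respect to $\nabla$) and vertical lifts to $(x,u)$; $u^h$ is the geodesic flow vector field. The tangent space of $T_1M$ at $(x,u)$ is $\{X^h+Y^v: X,Y\in M_x,\ Y\perp u\}$. A $g$-natural metric $\widetilde G$ on $T_1M$ is the symmetric $(0,2)$-tensor determined by four real constants $a,b,c,d$ through $$\widetilde G_{(x,u)}(X_1^h,X_2^h)=(a+c)\langle X_1,X_2\rangle+d\langle X_1,u\rangle\langle X_2,u\rangle,\quad \widetilde G_{(x,u)}(X_1^h,Y_1^v)=b\langle X_1,Y_1\rangle,\quad \widetilde G_{(x,u)}(Y_1^v,Y_2^v)=a\langle Y_1,Y_2\rangle,$$ for $X_i,Y_i\in M_x$ with $Y_i\perp u$; it is non-degenerate iff $\alpha(a+c+d)\neq0$. The tangential lift is $X^{t_G}=X^v-\langle X,u\rangle u^v+\frac{b}{a+c+d}\langle X,u\rangle u^h$; thus $Y^{t_G}=Y^v$ if $Y\perp u$, and $u^{t_G}=\frac{b}{a+c+d}u^h$. An almost paracontact structure $(\varphi,\xi,\eta)$ on a $(2n+1)$-manifold consists of a $(1,1)$-tensor field $\varphi$, a vector field $\xi$ and a $1$-form $\eta$ with $\eta(\xi)=1$, $\varphi^2=I-\eta\otimes\xi$,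 and such that the eigendistributions of $\varphi$ for the eigenvalues $1$ and $-1$ both have dimension $n$. A pseudo-Riemannian metric $g$ is compatible if $g(\varphi X,\varphi Y)=-g(X,Y)+\eta(X)\eta(Y)$. It is an associated metric, and $(\varphi,\xi,\eta,g)$ is a paracontact metric structure, if moreover $d\eta=\Phi$ where $\Phi(X,Y)=g(X,\varphi Y)$. The convention for the exterior derivative is $2\,d\eta(X,Y)=X\eta(Y)-Y\eta(X)-\eta([X,Y])$. *)

theory Defs
  imports "HOL-Analysis.Analysis"
begin

section \<open>Smooth maps between Euclidean spaces\<close>

text \<open>The predicates below are meant for open sets \<open>W\<close>.\<close>

primrec Ck_on :: "nat \<Rightarrow> 'a::euclidean_space set \<Rightarrow> ('a \<Rightarrow> 'b::real_normed_vector) \<Rightarrow> bool" where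
  "Ck_on 0 W f \<longleftrightarrow> continuous_on W f"
| "Ck_on (Suc k) W f \<longleftrightarrow> (\<forall>x\<in>W. f differentiable (at x)) \<and>
     (\<forall>v. Ck_on k W (\<lambda>x. frechet_derivative f (at x) v))"

definition smooth_on :: "'a::euclidean_space set \<Rightarrow> ('a \<Rightarrow> 'b::real_normed_vector) \<Rightarrow> bool" where
  "smooth_on W f \<longleftrightarrow> (\<forall>k. Ck_on k W f)"


section \<open>Manifolds given by an atlas\<close>

text \<open>
  A chart is a pair of a domain and a coordinate map (whose values outside the domain are
  irrelevant). A manifold is represented by its atlas; the atlas need not be maximal.
\<close>

type_synonym ('p, 'e) chart = "'p set \<times> ('p \<Rightarrow> 'e)"

definition carrier :: "('p, 'e) chart set \<Rightarrow> 'p set" where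
  "carrier A = (\<Union>\<kappa>\<in>A. fst \<kappa>)"

definition atlas_topology :: "('p, 'e::euclidean_space) chart set \<Rightarrow> 'p topology" where
  "atlas_topology A =
     topology_generated_by {fst \<kappa> \<inter> snd \<kappa> -` W | \<kappa> W. \<kappa> \<in> A \<and> open W}"

definition transition :: "('p, 'e) chart \<Rightarrow> ('p, 'e) chart \<Rightarrow> 'e \<Rightarrow> 'e" where
  "transition \<kappa> \<kappa>' = snd \<kappa>' \<circ> inv_into (fst \<kappa>) (snd \<kappa>)"

definition smooth_manifold :: "('p, 'e::euclidean_space) chart set \<Rightarrow> bool" where
  "smooth_manifold A \<longleftrightarrow>
     carrier A \<noteq> {} \<and>
     (\<forall>\<kappa>\<in>A. inj_on (snd \<kappa>) (fst \<kappa>) \<and> open (snd \<kappa> ` fst \<kappa>)) \<and>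
     (\<forall>\<kappa>\<in>A. \<forall>\<kappa>'\<in>A. open (snd \<kappa> ` (fst \<kappa> \<inter> fst \<kappa>')) \<and>
        smooth_on (snd \<kappa> ` (fst \<kappa> \<inter> fst \<kappa>')) (transition \<kappa> \<kappa>')) \<and>
     Hausdorff_space (atlas_topology A) \<and> second_countable (atlas_topology A)"


section \<open>Tangent vectors\<close>

text \<open>
  We fix a chart \<open>chart_at A p\<close> around every point \<open>p\<close> and identify the tangent space of the
  manifold at \<open>p\<close> with the model space \<open>'e\<close> through this chart. The coordinates of a tangent
  vector in any other chart are then obtained by applying the differential of the transition
  map; \<open>of_coord\<close> is the inverse of \<open>coord\<close>.
\<close>

definition chart_at :: "('p, 'e) chart set \<Rightarrow> 'p \<Rightarrow> ('p, 'e) chart" where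
  "chart_at A p = (SOME \<kappa>. \<kappa> \<in> A \<and> p \<in> fst \<kappa>)"

definition trans_deriv ::
  "('p, 'e::euclidean_space) chart \<Rightarrow> ('p, 'e) chart \<Rightarrow> 'p \<Rightarrow> 'e \<Rightarrow> 'e" where
  "trans_deriv \<kappa> \<kappa>' p = frechet_derivative (transition \<kappa> \<kappa>') (at (snd \<kappa> p))"

definition coord ::
  "('p, 'e::euclidean_space) chart set \<Rightarrow> ('p, 'e) chart \<Rightarrow> 'p \<Rightarrow> 'e \<Rightarrow> 'e" where
  "coord A \<kappa> p v = trans_deriv (chart_at A p) \<kappa> p v"

definition of_coord ::
  "('p, 'e::euclidean_space) chart set \<Rightarrow> ('p, 'e) chart \<Rightarrow> 'p \<Rightarrow> 'e \<Rightarrow> 'e" where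
  "of_coord A \<kappa> p v = trans_deriv \<kappa> (chart_at A p) p v"

text \<open>The tangent bundle: its points are the pairs \<open>(x, v)\<close> with \<open>v\<close> tangent at \<open>x\<close>.\<close>

definition tangent_chart ::
  "('p, 'e::euclidean_space) chart set \<Rightarrow> ('p, 'e) chart \<Rightarrow> ('p \<times> 'e, 'e \<times> 'e) chart" where
  "tangent_chart A \<kappa> = (fst \<kappa> \<times> UNIV, \<lambda>(x, v). (snd \<kappa> x, coord A \<kappa> x v))"

definition tangent_atlas ::
  "('p, 'e::euclidean_space) chart set \<Rightarrow> ('p \<times> 'e, 'e \<times> 'e) chart set" where
  "tangent_atlas A = tangent_chart A ` A"


section \<open>Riemannian metrics and the Levi-Civita connection\<close>

definition metric_coord ::
  "('p, 'e::euclidean_space) chart set \<Rightarrow> ('p \<Rightarrow> 'e \<Rightarrow> 'e \<Rightarrow> real) \<Rightarrow>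
   ('p, 'e) chart \<Rightarrow> 'e \<Rightarrow> 'e \<Rightarrow> 'e \<Rightarrow> real" where
  "metric_coord A g \<kappa> y v w =
     (let x = inv_into (fst \<kappa>) (snd \<kappa>) y in g x (of_coord A \<kappa> x v) (of_coord A \<kappa> x w))"

definition riemannian_metric ::
  "('p, 'e::euclidean_space) chart set \<Rightarrow> ('p \<Rightarrow> 'e \<Rightarrow> 'e \<Rightarrow> real) \<Rightarrow> bool" where
  "riemannian_metric A g \<longleftrightarrow>
     (\<forall>x\<in>carrier A. bilinear (g x) \<and> (\<forall>v w. g x v w = g x w v) \<and>
        (\<forall>v. v \<noteq> 0 \<longrightarrow> g x v v > 0)) \<and>
     (\<forall>\<kappa>\<in>A. \<forall>v w. smooth_on (snd \<kappa> ` fst \<kappa>) (\<lambda>y. metric_coord A g \<kappa> y v w))"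

text \<open>
  A linear connection is given by its Christoffel symbols: \<open>\<Gamma> \<kappa> x v w\<close> is the vector with
  components \<open>\<Gamma>\<^sup>k\<^sub>i\<^sub>j(x) v\<^sup>i w\<^sup>j\<close> in the chart \<open>\<kappa>\<close>, so that \<open>\<nabla>\<^sub>v W = DW(v) + \<Gamma>(v, W)\<close> in this chart.
\<close>

definition linear_connection ::
  "('p, 'e::euclidean_space) chart set \<Rightarrow> (('p, 'e) chart \<Rightarrow> 'p \<Rightarrow> 'e \<Rightarrow> 'e \<Rightarrow> 'e) \<Rightarrow> bool" where
  "linear_connection A \<Gamma> \<longleftrightarrow>
     (\<forall>\<kappa>\<in>A. \<forall>x\<in>fst \<kappa>. bilinear (\<Gamma> \<kappa> x)) \<and>
     (\<forall>\<kappa>\<in>A. \<forall>v w. smooth_on (snd \<kappa> ` fst \<kappa>)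
        (\<lambda>y. \<Gamma> \<kappa> (inv_into (fst \<kappa>) (snd \<kappa>) y) v w)) \<and>
     (\<forall>\<kappa>\<in>A. \<forall>\<kappa>'\<in>A. \<forall>x\<in>fst \<kappa> \<inter> fst \<kappa>'. \<forall>v w.
        \<Gamma> \<kappa>' x (trans_deriv \<kappa> \<kappa>' x v) (trans_deriv \<kappa> \<kappa>' x w) =
        trans_deriv \<kappa> \<kappa>' x (\<Gamma> \<kappa> x v w) -
        frechet_derivative (\<lambda>y. frechet_derivative (transition \<kappa> \<kappa>') (at y) w)
          (at (snd \<kappa> x)) v)"

definition levi_civita ::
  "('p, 'e::euclidean_space) chart set \<Rightarrow> ('p \<Rightarrow> 'e \<Rightarrow> 'e \<Rightarrow> real) \<Rightarrow>
   (('p, 'e) chart \<Rightarrow> 'p \<Rightarrow> 'e \<Rightarrow> 'e \<Rightarrow> 'e) \<Rightarrow> bool" where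
  "levi_civita A g \<Gamma> \<longleftrightarrow> linear_connection A \<Gamma> \<and>
     (\<forall>\<kappa>\<in>A. \<forall>x\<in>fst \<kappa>. \<forall>v w. \<Gamma> \<kappa> x v w = \<Gamma> \<kappa> x w v) \<and>
     (\<forall>\<kappa>\<in>A. \<forall>x\<in>fst \<kappa>. \<forall>v w z.
        frechet_derivative (\<lambda>y. metric_coord A g \<kappa> y v w) (at (snd \<kappa> x)) z =
        metric_coord A g \<kappa> (snd \<kappa> x) (\<Gamma> \<kappa> x z v) w +
        metric_coord A g \<kappa> (snd \<kappa> x) v (\<Gamma> \<kappa> x z w))"


section \<open>Calculus on embedded submanifolds\<close>

text \<open>
  The following notions refer to an embedded submanifold \<open>S\<close> of the manifold with atlas \<open>A\<close>
  (\<open>S = carrier A\<close> is the manifold itself). An embedded submanifold of dimension \<open>m\<close> is locally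
  the zero set of a smooth map \<open>h\<close> whose differential maps onto a space \<open>L\<close> of dimension
  \<open>DIM('e) - m\<close>.
\<close>

definition embedded_submanifold ::
  "('p, 'e::euclidean_space) chart set \<Rightarrow> 'p set \<Rightarrow> nat \<Rightarrow> bool" where
  "embedded_submanifold A S m \<longleftrightarrow>
     (\<forall>p\<in>S. \<exists>\<kappa>\<in>A. \<exists>W (h :: 'e \<Rightarrow> 'e) L.
        p \<in> fst \<kappa> \<and> open W \<and> snd \<kappa> p \<in> W \<and> W \<subseteq> snd \<kappa> ` fst \<kappa> \<and>
        subspace L \<and> dim L + m = DIM('e) \<and> smooth_on W h \<and> h ` W \<subseteq> L \<and>
        (\<forall>q\<in>fst \<kappa>. snd \<kappa> q \<in> W \<longrightarrow> (q \<in> S \<longleftrightarrow> h (snd \<kappa> q) = 0)) \<and>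
        (\<forall>y\<in>W. h y = 0 \<longrightarrow> range (frechet_derivative h (at y)) = L))"

text \<open>
  \<open>\<gamma>\<close> is a curve in \<open>S\<close>, defined near time \<open>0\<close> and differentiable there, through \<open>p\<close> with
  velocity \<open>v\<close>.
\<close>

definition curve_through ::
  "('p, 'e::euclidean_space) chart set \<Rightarrow> 'p set \<Rightarrow> 'p \<Rightarrow> 'e \<Rightarrow> (real \<Rightarrow> 'p) \<Rightarrow> bool" where
  "curve_through A S p v \<gamma> \<longleftrightarrow>
     \<gamma> 0 = p \<and> (\<forall>\<^sub>F t in nhds 0. \<gamma> t \<in> S \<inter> fst (chart_at A p)) \<and>
     ((\<lambda>t. snd (chart_at A p) (\<gamma> t)) has_vector_derivative v) (at 0)"

definition tangent_space ::
  "('p, 'e::euclidean_space) chart set \<Rightarrow> 'p set \<Rightarrow> 'p \<Rightarrow> 'e set" where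
  "tangent_space A S p = {v. \<exists>\<gamma>. curve_through A S p v \<gamma>}"

text \<open>Derivative of a map \<open>f\<close> defined on \<open>S\<close> in the direction of \<open>v \<in> tangent_space A S p\<close>.\<close>

definition dir_deriv ::
  "('p, 'e::euclidean_space) chart set \<Rightarrow> 'p set \<Rightarrow> ('p \<Rightarrow> 'b::real_normed_vector) \<Rightarrow>
   'p \<Rightarrow> 'e \<Rightarrow> 'b" where
  "dir_deriv A S f p v =
     (THE D. \<forall>\<gamma>. curve_through A S p v \<gamma> \<longrightarrow>
        ((\<lambda>t. f (\<gamma> t)) has_vector_derivative D) (at 0))"

text \<open>A map on \<open>S\<close> is smooth if, in charts of the ambient manifold, it extends locally to a
  smooth map.\<close>

definition smooth_in_chart ::
  "('p, 'e::euclidean_space) chart \<Rightarrow> 'p set \<Rightarrow> ('p \<Rightarrow> 'b::real_normed_vector) \<Rightarrow> bool" where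
  "smooth_in_chart \<kappa> S f \<longleftrightarrow>
     (\<forall>p\<in>S \<inter> fst \<kappa>. \<exists>W h. open W \<and> snd \<kappa> p \<in> W \<and> smooth_on W h \<and>
        (\<forall>q\<in>S \<inter> fst \<kappa>. snd \<kappa> q \<in> W \<longrightarrow> f q = h (snd \<kappa> q)))"

definition smooth_map ::
  "('p, 'e::euclidean_space) chart set \<Rightarrow> 'p set \<Rightarrow> ('p \<Rightarrow> 'b::real_normed_vector) \<Rightarrow> bool" where
  "smooth_map A S f \<longleftrightarrow> (\<forall>\<kappa>\<in>A. smooth_in_chart \<kappa> S f)"

definition vector_field ::
  "('p, 'e::euclidean_space) chart set \<Rightarrow> 'p set \<Rightarrow> ('p \<Rightarrow> 'e) \<Rightarrow> bool" where
  "vector_field A S X \<longleftrightarrow>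
     (\<forall>p\<in>S. X p \<in> tangent_space A S p) \<and>
     (\<forall>\<kappa>\<in>A. smooth_in_chart \<kappa> S (\<lambda>q. coord A \<kappa> q (X q)))"

text \<open>The tensor fields below are only meaningful on tangent vectors of \<open>S\<close>.\<close>

definition lin_on :: "'a::real_vector set \<Rightarrow> ('a \<Rightarrow> 'b::real_vector) \<Rightarrow> bool" where
  "lin_on T f \<longleftrightarrow>
     (\<forall>v\<in>T. \<forall>w\<in>T. f (v + w) = f v + f w) \<and> (\<forall>v\<in>T. \<forall>r. f (r *\<^sub>R v) = r *\<^sub>R f v)"

definition one_form ::
  "('p, 'e::euclidean_space) chart set \<Rightarrow> 'p set \<Rightarrow> ('p \<Rightarrow> 'e \<Rightarrow> real) \<Rightarrow> bool" where
  "one_form A S \<eta> \<longleftrightarrow>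
     (\<forall>p\<in>S. lin_on (tangent_space A S p) (\<eta> p)) \<and>
     (\<forall>X. vector_field A S X \<longrightarrow> smooth_map A S (\<lambda>p. \<eta> p (X p)))"

definition tensor_field_1_1 ::
  "('p, 'e::euclidean_space) chart set \<Rightarrow> 'p set \<Rightarrow> ('p \<Rightarrow> 'e \<Rightarrow> 'e) \<Rightarrow> bool" where
  "tensor_field_1_1 A S \<phi> \<longleftrightarrow>
     (\<forall>p\<in>S. lin_on (tangent_space A S p) (\<phi> p) \<and>
        \<phi> p ` tangent_space A S p \<subseteq> tangent_space A S p) \<and>
     (\<forall>X. vector_field A S X \<longrightarrow> vector_field A S (\<lambda>p. \<phi> p (X p)))"

definition sym_bilin_on :: "'a::real_vector set \<Rightarrow> ('a \<Rightarrow> 'a \<Rightarrow> real) \<Rightarrow> bool" where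
  "sym_bilin_on T B \<longleftrightarrow> (\<forall>v\<in>T. lin_on T (B v)) \<and> (\<forall>v\<in>T. \<forall>w\<in>T. B v w = B w v)"

definition nondegenerate ::
  "('p, 'e::euclidean_space) chart set \<Rightarrow> 'p set \<Rightarrow> ('p \<Rightarrow> 'e \<Rightarrow> 'e \<Rightarrow> real) \<Rightarrow> bool" where
  "nondegenerate A S G \<longleftrightarrow>
     (\<forall>p\<in>S. \<forall>v\<in>tangent_space A S p.
        (\<forall>w\<in>tangent_space A S p. G p v w = 0) \<longrightarrow> v = 0)"

definition pseudo_riemannian_metric ::
  "('p, 'e::euclidean_space) chart set \<Rightarrow> 'p set \<Rightarrow> ('p \<Rightarrow> 'e \<Rightarrow> 'e \<Rightarrow> real) \<Rightarrow> bool" where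
  "pseudo_riemannian_metric A S G \<longleftrightarrow>
     (\<forall>p\<in>S. sym_bilin_on (tangent_space A S p) (G p)) \<and>
     (\<forall>X Y. vector_field A S X \<longrightarrow> vector_field A S Y \<longrightarrow>
        smooth_map A S (\<lambda>p. G p (X p) (Y p))) \<and>
     nondegenerate A S G"

text \<open>
  The Lie bracket at \<open>p\<close> is computed by \<open>[X, Y] = DY(X) - DX(Y)\<close> in the chart \<open>chart_at A p\<close>, in
  which coordinates of vectors tangent at \<open>p\<close> are these vectors themselves.
\<close>

definition lie_bracket ::
  "('p, 'e::euclidean_space) chart set \<Rightarrow> 'p set \<Rightarrow> ('p \<Rightarrow> 'e) \<Rightarrow> ('p \<Rightarrow> 'e) \<Rightarrow> 'p \<Rightarrow> 'e" where
  "lie_bracket A S X Y p =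
     dir_deriv A S (\<lambda>q. coord A (chart_at A p) q (Y q)) p (X p) -
     dir_deriv A S (\<lambda>q. coord A (chart_at A p) q (X q)) p (Y p)"

text \<open>Note the factor in the convention
  \<open>2 d\<eta>(X, Y) = X \<eta>(Y) - Y \<eta>(X) - \<eta>([X, Y])\<close>.\<close>

definition ext_deriv ::
  "('p, 'e::euclidean_space) chart set \<Rightarrow> 'p set \<Rightarrow> ('p \<Rightarrow> 'e \<Rightarrow> real) \<Rightarrow>
   ('p \<Rightarrow> 'e) \<Rightarrow> ('p \<Rightarrow> 'e) \<Rightarrow> 'p \<Rightarrow> real" where
  "ext_deriv A S \<eta> X Y p =
     (dir_deriv A S (\<lambda>q. \<eta> q (Y q)) p (X p) - dir_deriv A S (\<lambda>q. \<eta> q (X q)) p (Y p)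
       - \<eta> p (lie_bracket A S X Y p)) / 2"


section \<open>Paracontact metric structures\<close>

definition almost_paracontact_structure ::
  "nat \<Rightarrow> ('p, 'e::euclidean_space) chart set \<Rightarrow> 'p set \<Rightarrow>
   ('p \<Rightarrow> 'e \<Rightarrow> 'e) \<Rightarrow> ('p \<Rightarrow> 'e) \<Rightarrow> ('p \<Rightarrow> 'e \<Rightarrow> real) \<Rightarrow> bool" where
  "almost_paracontact_structure n A S \<phi> \<xi> \<eta> \<longleftrightarrow>
     embedded_submanifold A S (2 * n + 1) \<and>
     tensor_field_1_1 A S \<phi> \<and> vector_field A S \<xi> \<and> one_form A S \<eta> \<and>
     (\<forall>p\<in>S. \<eta> p (\<xi> p) = 1 \<and>
        (\<forall>v\<in>tangent_space A S p. \<phi> p (\<phi> p v) = v - \<eta> p v *\<^sub>R \<xi> p) \<and>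
        dim {v \<in> tangent_space A S p. \<phi> p v = v} = n \<and>
        dim {v \<in> tangent_space A S p. \<phi> p v = - v} = n)"

definition compatible_metric ::
  "('p, 'e::euclidean_space) chart set \<Rightarrow> 'p set \<Rightarrow>
   ('p \<Rightarrow> 'e \<Rightarrow> 'e) \<Rightarrow> ('p \<Rightarrow> 'e \<Rightarrow> real) \<Rightarrow> ('p \<Rightarrow> 'e \<Rightarrow> 'e \<Rightarrow> real) \<Rightarrow> bool" where
  "compatible_metric A S \<phi> \<eta> G \<longleftrightarrow>
     pseudo_riemannian_metric A S G \<and>
     (\<forall>p\<in>S. \<forall>v\<in>tangent_space A S p. \<forall>w\<in>tangent_space A S p.
        G p (\<phi> p v) (\<phi> p w) = - G p v w + \<eta> p v * \<eta> p w)"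

definition paracontact_metric_structure ::
  "nat \<Rightarrow> ('p, 'e::euclidean_space) chart set \<Rightarrow> 'p set \<Rightarrow>
   ('p \<Rightarrow> 'e \<Rightarrow> 'e) \<Rightarrow> ('p \<Rightarrow> 'e) \<Rightarrow> ('p \<Rightarrow> 'e \<Rightarrow> real) \<Rightarrow> ('p \<Rightarrow> 'e \<Rightarrow> 'e \<Rightarrow> real) \<Rightarrow> bool" where
  "paracontact_metric_structure n A S \<phi> \<xi> \<eta> G \<longleftrightarrow>
     almost_paracontact_structure n A S \<phi> \<xi> \<eta> \<and>
     compatible_metric A S \<phi> \<eta> G \<and>
     (\<forall>X Y. vector_field A S X \<longrightarrow> vector_field A S Y \<longrightarrow>
        (\<forall>p\<in>S. ext_deriv A S \<eta> X Y p = G p (X p) (\<phi> p (Y p))))"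


section \<open>The unit tangent sphere bundle\<close>

definition unit_tangent_bundle ::
  "('p, 'e::euclidean_space) chart set \<Rightarrow> ('p \<Rightarrow> 'e \<Rightarrow> 'e \<Rightarrow> real) \<Rightarrow> ('p \<times> 'e) set" where
  "unit_tangent_bundle A g = {(x, u). x \<in> carrier A \<and> g x u u = 1}"

text \<open>
  Horizontal and vertical lifts to \<open>(x, u)\<close>, characterised by their coordinates in the charts of
  the tangent bundle: \<open>X\<^sup>h = (X, - \<Gamma>(X, u))\<close> and \<open>X\<^sup>v = (0, X)\<close>.
\<close>

definition hlift ::
  "('p, 'e::euclidean_space) chart set \<Rightarrow> (('p, 'e) chart \<Rightarrow> 'p \<Rightarrow> 'e \<Rightarrow> 'e \<Rightarrow> 'e) \<Rightarrow>
   'p \<times> 'e \<Rightarrow> 'e \<Rightarrow> 'e \<times> 'e" where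
  "hlift A \<Gamma> = (\<lambda>(x, u) X. THE w. \<forall>\<kappa>\<in>A. x \<in> fst \<kappa> \<longrightarrow>
     coord (tangent_atlas A) (tangent_chart A \<kappa>) (x, u) w =
       (coord A \<kappa> x X, - \<Gamma> \<kappa> x (coord A \<kappa> x X) (coord A \<kappa> x u)))"

definition vlift ::
  "('p, 'e::euclidean_space) chart set \<Rightarrow> 'p \<times> 'e \<Rightarrow> 'e \<Rightarrow> 'e \<times> 'e" where
  "vlift A = (\<lambda>(x, u) X. THE w. \<forall>\<kappa>\<in>A. x \<in> fst \<kappa> \<longrightarrow>
     coord (tangent_atlas A) (tangent_chart A \<kappa>) (x, u) w = (0, coord A \<kappa> x X))"

definition tlift ::
  "('p, 'e::euclidean_space) chart set \<Rightarrow> ('p \<Rightarrow> 'e \<Rightarrow> 'e \<Rightarrow> real) \<Rightarrow>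
   (('p, 'e) chart \<Rightarrow> 'p \<Rightarrow> 'e \<Rightarrow> 'e \<Rightarrow> 'e) \<Rightarrow> real \<Rightarrow> real \<Rightarrow> real \<Rightarrow> real \<Rightarrow>
   'p \<times> 'e \<Rightarrow> 'e \<Rightarrow> 'e \<times> 'e" where
  "tlift A g \<Gamma> a b c d = (\<lambda>(x, u) X.
     vlift A (x, u) X - g x X u *\<^sub>R vlift A (x, u) u
       + (b / (a + c + d) * g x X u) *\<^sub>R hlift A \<Gamma> (x, u) u)"

definition g_natural_metric ::
  "('p, 'e::euclidean_space) chart set \<Rightarrow> ('p \<Rightarrow> 'e \<Rightarrow> 'e \<Rightarrow> real) \<Rightarrow>
   (('p, 'e) chart \<Rightarrow> 'p \<Rightarrow> 'e \<Rightarrow> 'e \<Rightarrow> 'e) \<Rightarrow> real \<Rightarrow> real \<Rightarrow> real \<Rightarrow> real \<Rightarrow>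
   ('p \<times> 'e \<Rightarrow> 'e \<times> 'e \<Rightarrow> 'e \<times> 'e \<Rightarrow> real) \<Rightarrow> bool" where
  "g_natural_metric A g \<Gamma> a b c d G \<longleftrightarrow>
     (\<forall>(x, u)\<in>unit_tangent_bundle A g.
        sym_bilin_on (tangent_space (tangent_atlas A) (unit_tangent_bundle A g) (x, u))
          (G (x, u)) \<and>
        (\<forall>X\<^sub>1 X\<^sub>2. G (x, u) (hlift A \<Gamma> (x, u) X\<^sub>1) (hlift A \<Gamma> (x, u) X\<^sub>2) =
           (a + c) * g x X\<^sub>1 X\<^sub>2 + d * g x X\<^sub>1 u * g x X\<^sub>2 u) \<and>
        (\<forall>X Y. g x Y u = 0 \<longrightarrow>
           G (x, u) (hlift A \<Gamma> (x, u) X) (vlift A (x, u) Y) = b * g x X Y) \<and>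
        (\<forall>Y\<^sub>1 Y\<^sub>2. g x Y\<^sub>1 u = 0 \<longrightarrow> g x Y\<^sub>2 u = 0 \<longrightarrow>
           G (x, u) (vlift A (x, u) Y\<^sub>1) (vlift A (x, u) Y\<^sub>2) = a * g x Y\<^sub>1 Y\<^sub>2))"

end

theory Submission
  imports Defs
begin

text \<open>
  Decompose a vector tangent to \<open>T\<^sub>1M\<close> at \<open>(x, u)\<close> as \<open>X\<^sup>h + Y\<^sup>v\<close> with \<open>Y\<close> orthogonal to \<open>u\<close>, and split off
  the component of \<open>X\<close> along \<open>u\<close>. On the horizontal and vertical copies of the orthogonal complement of \<open>u\<close>
  the tensor \<open>\<phi>\<close> acts as the trace-free matrix with rows \<open>(-b, -a)\<close> and \<open>(a + c, b)\<close> divided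
  by \<open>2\<rho>\<alpha>\<close>, whose square is \<open>-1 / (4\<rho>\<^sup>2\<alpha>)\<close>; hence \<open>\<phi>\<^sup>2 = I - \<eta> \<otimes> \<xi>\<close> amounts to \<open>-4\<alpha> = 1/\<rho>\<^sup>2\<close>,
  and compatibility evaluated at \<open>\<xi>\<close> amounts to \<open>a + c + d = 1/\<rho>\<^sup>2\<close>. The form \<open>\<eta>\<close> is \<open>1/\<rho>\<close> times
  the canonical one-form \<open>X\<^sup>h + Y\<^sup>v \<mapsto> \<langle>X, u\<rangle>\<close>; since the Levi-Civita connection is
  metric and torsion-free, \<open>2\<rho> d\<eta>(X\<^sub>1\<^sup>h + Y\<^sub>1\<^sup>v, X\<^sub>2\<^sup>h + Y\<^sub>2\<^sup>v) = \<langle>Y\<^sub>1, X\<^sub>2\<rangle> - \<langle>X\<^sub>1, Y\<^sub>2\<rangle>\<close>, so \<open>d\<eta> = \<Phi>\<close> puts no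
  further condition on the constants.
\<close>

section \<open>Calculus of smooth maps\<close>

text \<open>Let M be the matrix with rows (-b, -a) and (a + c, b), S the Gram matrix of
  \<open>G\<close> on the two copies of the complement, with rows (a + c, b) and (b, a), and J the
  matrix with rows (0, -1) and (1, 0). Then S M = \<alpha> J, so dividing M by 2 \<rho> \<alpha>
  gives exactly the form J / (2 \<rho>) that d\<eta> has there. Also M^T S M = \<alpha> S, so
  compatibility on the complement imposes the same equation on \<alpha> as the square of \<phi>. The
  main obstacle is that the fields live on T1M only and \<eta> is prescribed on tangent vectors
  only. Derivatives are taken of local extensions in a chart of TM, and the bracket must be shown
  tangent to T1M before \<eta> can be evaluated on it; this rests on the symmetry of the second
  derivative of the squared length. Quotients by a + c + d are total, with value 0 for a zero
  denominator. In the forward direction that case is carried along until compatibility at the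
  geodesic direction excludes it.\<close>

lemma Ck_on_subset: "Ck_on k W f \<Longrightarrow> W' \<subseteq> W \<Longrightarrow> Ck_on k W' f"
  by (induction k arbitrary: f) (auto intro: continuous_on_subset)

lemma Ck_on_cong:
  assumes "open W" "\<And>x. x \<in> W \<Longrightarrow> f x = g x" "Ck_on k W f"
  shows "Ck_on k W g"
  using assms(2,3)
proof (induction k arbitrary: f g)
  case 0
  then show ?case
    by (auto cong: continuous_on_cong)
next
  case (Suc k)
  have d: "(g has_derivative frechet_derivative f (at x)) (at x)" if "x \<in> W" for x
  proof -
    have "(f has_derivative frechet_derivative f (at x)) (at x)"
      using Suc.prems that by (simp add: frechet_derivative_works)
    then show ?thesis
      by (rule has_derivative_transform_within_open[OF _ assms(1) that]) (use Suc.prems in auto)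
  qed
  have e: "frechet_derivative g (at x) = frechet_derivative f (at x)" if "x \<in> W" for x
    using frechet_derivative_at[OF d[OF that]] by simp
  show ?case
  proof (simp, intro conjI ballI allI)
    show "g differentiable (at x)" if "x \<in> W" for x
      using d[OF that] by (auto simp: differentiable_def)
    show "Ck_on k W (\<lambda>x. frechet_derivative g (at x) v)" for v
      by (rule Suc.IH[of "\<lambda>x. frechet_derivative f (at x) v"]) (use e Suc.prems in auto)
  qed
qed

text \<open>By uniqueness of derivatives an explicit candidate may be checked in place of
  \<open>frechet_derivative\<close>; the closure lemmas below thereby reduce to differentiation
  rules.\<close>

lemma Ck_on_SucI:
  assumes "open W" "\<And>x. x \<in> W \<Longrightarrow> (f has_derivative f' x) (at x)" "\<And>v. Ck_on k W (\<lambda>x. f' x v)"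
  shows "Ck_on (Suc k) W f"
proof (simp, intro conjI ballI allI)
  show "f differentiable (at x)" if "x \<in> W" for x
    using assms(2)[OF that] by (auto simp: differentiable_def)
  show "Ck_on k W (\<lambda>x. frechet_derivative f (at x) v)" for v
    by (rule Ck_on_cong[OF assms(1) _ assms(3)[of v]])
      (simp add: frechet_derivative_at[OF assms(2), symmetric])
qed

lemma Ck_on_Suc_has_derivative:
  "Ck_on (Suc k) W f \<Longrightarrow> x \<in> W \<Longrightarrow> (f has_derivative frechet_derivative f (at x)) (at x)"
  by (simp add: frechet_derivative_works)

lemma Ck_on_SucD: "Ck_on (Suc k) W f \<Longrightarrow> Ck_on k W f"
proof (induction k arbitrary: f)
  case 0
  then show ?case
    by (auto simp: continuous_on_eq_continuous_within differentiable_imp_continuous_within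
        differentiable_at_withinI)
next
  case (Suc k)
  then show ?case
    by (metis Ck_on.simps(2))
qed

lemma Ck_on_const: "Ck_on k W (\<lambda>x. c)"
  by (induction k arbitrary: c) auto

lemma Ck_on_bounded_linear:
  assumes "bounded_linear L"
  shows "Ck_on k W L"
proof (cases k)
  case 0
  then show ?thesis
    using assms by (simp add: linear_continuous_on)
next
  case (Suc m)
  have "(L has_derivative L) (at x)" for x
    using assms by (rule bounded_linear_imp_has_derivative)
  then have "L differentiable (at x)" "frechet_derivative L (at x) = L" for x
    by (auto simp: differentiable_def frechet_derivative_at[symmetric])
  then show ?thesis
    using Suc by (simp add: Ck_on_const)
qed

lemma Ck_on_add:
  assumes "open W"
  shows "Ck_on k W f \<Longrightarrow> Ck_on k W g \<Longrightarrow> Ck_on k W (\<lambda>x. f x + g x)"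
proof (induction k arbitrary: f g)
  case 0
  then show ?case by (simp add: continuous_on_add)
next
  case (Suc k)
  show ?case
    by (rule Ck_on_SucI[OF assms has_derivative_add[OF Suc.prems[THEN Ck_on_Suc_has_derivative]]])
      (use Suc in auto)
qed

lemma Ck_on_bounded_linear_comp:
  assumes "open W" "bounded_linear L"
  shows "Ck_on k W f \<Longrightarrow> Ck_on k W (\<lambda>x. L (f x))"
proof (induction k arbitrary: f)
  case 0
  then show ?case
    using assms bounded_linear.continuous_on by auto
next
  case (Suc k)
  show ?case
    by (rule Ck_on_SucI[OF assms(1)
          bounded_linear.has_derivative[OF assms(2) Suc.prems[THEN Ck_on_Suc_has_derivative]]])
      (use Suc in auto)
qed

lemma Ck_on_comp_bounded_linear:
  fixes L :: "'a::euclidean_space \<Rightarrow> 'b::euclidean_space"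
  assumes "open W'" "bounded_linear L" "L ` W' \<subseteq> W"
  shows "Ck_on k W f \<Longrightarrow> Ck_on k W' (\<lambda>x. f (L x))"
proof (induction k arbitrary: f)
  case 0
  then show ?case
    using continuous_on_compose2[of W f W' L] linear_continuous_on[OF assms(2)] assms(3) by simp
next
  case (Suc k)
  have d: "((\<lambda>x. f (L x)) has_derivative (\<lambda>v. frechet_derivative f (at (L x)) (L v))) (at x)"
    if "x \<in> W'" for x
  proof -
    have "L x \<in> W" using that assms by auto
    from diff_chain_at[OF bounded_linear_imp_has_derivative[OF assms(2)]
        Ck_on_Suc_has_derivative[OF Suc.prems this]]
    show ?thesis by (simp add: o_def)
  qed
  show ?case
  proof (rule Ck_on_SucI[OF assms(1) d])
    show "Ck_on k W' (\<lambda>x. frechet_derivative f (at (L x)) (L v))" for v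
      by (rule Suc.IH[of "\<lambda>y. frechet_derivative f (at y) (L v)"]) (use Suc.prems in simp)
  qed
qed

lemma Ck_on_scaleR:
  fixes f :: "'a::euclidean_space \<Rightarrow> real" and g :: "'a \<Rightarrow> 'b::real_normed_vector"
  assumes "open W"
  shows "Ck_on k W f \<Longrightarrow> Ck_on k W g \<Longrightarrow> Ck_on k W (\<lambda>x. f x *\<^sub>R g x)"
proof (induction k arbitrary: f g)
  case 0
  then show ?case by (simp add: continuous_on_scaleR)
next
  case (Suc k)
  \<comment> \<open>The product rule leaves an undifferentiated factor in each summand, so both
    functions are also needed at the lower order.\<close>
  note fg = Suc.prems[THEN Ck_on_SucD]
  show ?case
  proof (rule Ck_on_SucI[OF assms
        has_derivative_scaleR[OF Suc.prems[THEN Ck_on_Suc_has_derivative]]])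
    show "Ck_on k W (\<lambda>x. f x *\<^sub>R frechet_derivative g (at x) v + frechet_derivative f (at x) v *\<^sub>R g x)" for v
      by (intro Ck_on_add[OF assms] Suc.IH fg) (use Suc.prems in auto)
  qed
qed

lemma smooth_on_subset: "smooth_on W f \<Longrightarrow> W' \<subseteq> W \<Longrightarrow> smooth_on W' f"
  by (auto simp: smooth_on_def intro: Ck_on_subset)

lemma smooth_on_cong:
  "open W \<Longrightarrow> (\<And>x. x \<in> W \<Longrightarrow> f x = g x) \<Longrightarrow> smooth_on W f \<Longrightarrow> smooth_on W g"
  unfolding smooth_on_def using Ck_on_cong[of W f g] by simp

lemma smooth_on_has_derivative:
  "smooth_on W f \<Longrightarrow> x \<in> W \<Longrightarrow> (f has_derivative frechet_derivative f (at x)) (at x)"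
  using Ck_on_Suc_has_derivative[of 0 W f x] unfolding smooth_on_def by simp

lemma smooth_on_linear_derivative:
  "smooth_on W f \<Longrightarrow> x \<in> W \<Longrightarrow> linear (frechet_derivative f (at x))"
  by (rule has_derivative_linear[OF smooth_on_has_derivative])

lemma smooth_on_frechet_derivative:
  "smooth_on W f \<Longrightarrow> smooth_on W (\<lambda>x. frechet_derivative f (at x) v)"
  unfolding smooth_on_def using Ck_on.simps(2)[of _ W f] by blast

lemma smooth_on_const: "smooth_on W (\<lambda>x. c)"
  by (simp add: smooth_on_def Ck_on_const)

lemma smooth_on_bounded_linear: "bounded_linear L \<Longrightarrow> smooth_on W L"
  by (simp add: smooth_on_def Ck_on_bounded_linear)

lemma smooth_on_add:
  "open W \<Longrightarrow> smooth_on W f \<Longrightarrow> smooth_on W g \<Longrightarrow> smooth_on W (\<lambda>x. f x + g x)"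
  by (simp add: smooth_on_def Ck_on_add)

lemma smooth_on_bounded_linear_comp:
  "open W \<Longrightarrow> bounded_linear L \<Longrightarrow> smooth_on W f \<Longrightarrow> smooth_on W (\<lambda>x. L (f x))"
  by (simp add: smooth_on_def Ck_on_bounded_linear_comp)

lemma smooth_on_comp_bounded_linear:
  fixes L :: "'a::euclidean_space \<Rightarrow> 'b::euclidean_space"
  shows "open W' \<Longrightarrow> bounded_linear L \<Longrightarrow> L ` W' \<subseteq> W \<Longrightarrow> smooth_on W f \<Longrightarrow> smooth_on W' (\<lambda>x. f (L x))"
  by (simp add: smooth_on_def Ck_on_comp_bounded_linear)

lemma smooth_on_scaleR:
  fixes f :: "'a::euclidean_space \<Rightarrow> real"
  shows "open W \<Longrightarrow> smooth_on W f \<Longrightarrow> smooth_on W g \<Longrightarrow> smooth_on W (\<lambda>x. f x *\<^sub>R g x)"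
  by (simp add: smooth_on_def Ck_on_scaleR)

lemma smooth_on_minus: "open W \<Longrightarrow> smooth_on W g \<Longrightarrow> smooth_on W (\<lambda>x. - g x)"
  by (rule smooth_on_bounded_linear_comp[OF _ bounded_linear_minus[OF bounded_linear_ident]])

lemma smooth_on_diff:
  "open W \<Longrightarrow> smooth_on W f \<Longrightarrow> smooth_on W g \<Longrightarrow> smooth_on W (\<lambda>x. f x - g x)"
  using smooth_on_add[OF _ _ smooth_on_minus, of W f g] by simp

lemma smooth_on_sum:
  assumes "open W" "\<And>i. i \<in> I \<Longrightarrow> smooth_on W (f i)"
  shows "smooth_on W (\<lambda>x. \<Sum>i\<in>I. f i x)"
  using assms(2)
proof (induction I rule: infinite_finite_induct)
  case (insert i I)
  then show ?case by (simp add: smooth_on_add assms(1))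
qed (simp_all add: smooth_on_const)

lemma smooth_on_Pair:
  assumes "open W" "smooth_on W f" "smooth_on W g"
  shows "smooth_on W (\<lambda>x. (f x, g x))"
proof -
  have l: "bounded_linear (\<lambda>v::'b. (v, 0::'c))" "bounded_linear (\<lambda>v::'c. (0::'b, v))"
    by (rule bounded_linear_Pair[OF bounded_linear_ident bounded_linear_zero]
        bounded_linear_Pair[OF bounded_linear_zero bounded_linear_ident])+
  have "smooth_on W (\<lambda>x. (f x, 0::'c) + (0::'b, g x))"
    by (rule smooth_on_add[OF assms(1) smooth_on_bounded_linear_comp[OF assms(1) l(1) assms(2)]
          smooth_on_bounded_linear_comp[OF assms(1) l(2) assms(3)]])
  then show ?thesis by simp
qed

lemma linear_expand:
  fixes B :: "'e::euclidean_space \<Rightarrow> 'b::real_vector"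
  assumes "linear B"
  shows "B v = (\<Sum>i\<in>Basis. (v \<bullet> i) *\<^sub>R B i)"
  using linear_sum[OF assms, of "\<lambda>i. (v \<bullet> i) *\<^sub>R i" Basis]
  by (simp add: euclidean_representation linear_scale[OF assms])

text \<open>Expanding the argument in \<open>Basis\<close> gives a finite sum of products. This
  upgrades smoothness for constant arguments, the form in which it is given for the metric and the
  Christoffel symbols, to arguments that vary with the point.\<close>

lemma smooth_on_linear_apply:
  fixes B :: "'a::euclidean_space \<Rightarrow> 'e::euclidean_space \<Rightarrow> 'b::real_normed_vector"
  assumes "open W" "\<And>z. z \<in> W \<Longrightarrow> linear (B z)" "\<And>v. smooth_on W (\<lambda>z. B z v)" "smooth_on W h"
  shows "smooth_on W (\<lambda>z. B z (h z))"
proof (rule smooth_on_cong[OF assms(1)])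
  show "smooth_on W (\<lambda>z. \<Sum>i\<in>Basis. (h z \<bullet> i) *\<^sub>R B z i)"
    by (intro smooth_on_sum smooth_on_scaleR assms
        smooth_on_bounded_linear_comp[OF _ bounded_linear_inner_left])
qed (simp add: linear_expand[OF assms(2), symmetric])

text \<open>A product rule that asks only for derivatives at fixed vectors; the expansion in
  \<open>Basis\<close> again turns it into a finite sum.\<close>

lemma has_derivative_linear_apply:
  fixes B :: "'a::real_normed_vector \<Rightarrow> 'e::euclidean_space \<Rightarrow> 'b::real_normed_vector"
  assumes "open W" "z0 \<in> W" "\<And>z. z \<in> W \<Longrightarrow> linear (B z)"
    and B': "\<And>v. ((\<lambda>z. B z v) has_derivative B' v) (at z0)"
    and h: "(h has_derivative h') (at z0)"
  shows "((\<lambda>z. B z (h z)) has_derivative (\<lambda>w. B' (h z0) w + B z0 (h' w))) (at z0)"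
proof -
  have "((\<lambda>z. \<Sum>i\<in>Basis. (v \<bullet> i) *\<^sub>R B z i) has_derivative (\<lambda>w. \<Sum>i\<in>Basis. (v \<bullet> i) *\<^sub>R B' i w)) (at z0)" for v
    by (intro has_derivative_sum has_derivative_scaleR_right B')
  then have "((\<lambda>z. B z v) has_derivative (\<lambda>w. \<Sum>i\<in>Basis. (v \<bullet> i) *\<^sub>R B' i w)) (at z0)" for v
    by (rule has_derivative_transform_within_open[OF _ assms(1,2)])
      (simp add: linear_expand[OF assms(3), symmetric])
  \<comment> \<open>\<open>B'\<close> inherits linearity in its first argument from \<open>B\<close>
    by uniqueness of derivatives.\<close>
  from has_derivative_unique[OF B' this]
  have B'v: "B' v w = (\<Sum>i\<in>Basis. (v \<bullet> i) *\<^sub>R B' i w)" for v w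
    by (rule fun_cong)
  have "((\<lambda>z. \<Sum>i\<in>Basis. (h z \<bullet> i) *\<^sub>R B z i) has_derivative
      (\<lambda>w. \<Sum>i\<in>Basis. (h z0 \<bullet> i) *\<^sub>R B' i w + (h' w \<bullet> i) *\<^sub>R B z0 i)) (at z0)"
    by (intro has_derivative_sum has_derivative_scaleR B' has_derivative_inner_left h)
  then have "((\<lambda>z. B z (h z)) has_derivative
      (\<lambda>w. \<Sum>i\<in>Basis. (h z0 \<bullet> i) *\<^sub>R B' i w + (h' w \<bullet> i) *\<^sub>R B z0 i)) (at z0)"
    by (rule has_derivative_transform_within_open[OF _ assms(1,2)])
      (simp add: linear_expand[OF assms(3), symmetric])
  then show ?thesis
    by (simp only: sum.distrib B'v[symmetric] linear_expand[OF assms(3)[OF assms(2)], symmetric])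
qed

section \<open>Symmetry of second derivatives\<close>

text \<open>The mean value theorem is used twice: for the increment in direction \<open>v\<close> as
  a function of the parameter along \<open>u\<close>, then for the first derivative along
  \<open>v\<close>. The double difference itself is symmetric in \<open>u\<close> and
  \<open>v\<close>.\<close>

lemma double_difference_mean_value:
  fixes f :: "'a::euclidean_space \<Rightarrow> real"
  assumes f: "Ck_on 2 W f" and "0 < r"
    and W: "\<And>s t. 0 \<le> s \<Longrightarrow> s \<le> r \<Longrightarrow> 0 \<le> t \<Longrightarrow> t \<le> r \<Longrightarrow> x + s *\<^sub>R u + t *\<^sub>R v \<in> W"
  obtains s t where "0 < s" "s < r" "0 < t" "t < r"
    "f (x + r *\<^sub>R u + r *\<^sub>R v) - f (x + r *\<^sub>R u) - f (x + r *\<^sub>R v) + f x =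
     r * r * frechet_derivative (\<lambda>y. frechet_derivative f (at y) u) (at (x + s *\<^sub>R u + t *\<^sub>R v)) v"
proof -
  have d1: "(f has_derivative frechet_derivative f (at y)) (at y)" if "y \<in> W" for y
    using f that by (auto simp: numeral_2_eq_2 frechet_derivative_works)
  have d2: "((\<lambda>y. frechet_derivative f (at y) u) has_derivative
      frechet_derivative (\<lambda>y. frechet_derivative f (at y) u) (at y)) (at y)" if "y \<in> W" for y
    using f that by (auto simp: numeral_2_eq_2 frechet_derivative_works)
  have line: "((\<lambda>s. F (y + s *\<^sub>R w)) has_real_derivative F' w) (at s)"
    if "(F has_derivative F') (at (y + s *\<^sub>R w))" for F :: "'a \<Rightarrow> real" and F' y s w
  proof -
    have "((\<lambda>s. F (y + s *\<^sub>R w)) has_derivative (\<lambda>t. F' (t *\<^sub>R w))) (at s)"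
      using that by (auto intro!: derivative_eq_intros has_derivative_compose[where g=F])
    moreover have "F' (t *\<^sub>R w) = F' w * t" for t
      using linear_scale[OF has_derivative_linear[OF that]] by simp
    ultimately show ?thesis
      by (simp add: has_field_derivative_def)
  qed
  define D where "D s = frechet_derivative f (at (x + s *\<^sub>R u + r *\<^sub>R v)) u
      - frechet_derivative f (at (x + s *\<^sub>R u)) u" for s
  have "((\<lambda>s. f (x + s *\<^sub>R u + r *\<^sub>R v) - f (x + s *\<^sub>R u)) has_real_derivative D s) (at s)"
    if "0 \<le> s" "s \<le> r" for s
  proof -
    have "x + s *\<^sub>R u \<in> W" "(x + r *\<^sub>R v) + s *\<^sub>R u \<in> W"
      using W[of s 0] W[of s r] that \<open>0 < r\<close> by (simp_all add: algebra_simps)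
    from DERIV_diff[OF line[OF d1[OF this(2)]] line[OF d1[OF this(1)]]]
    show ?thesis by (simp add: D_def algebra_simps)
  qed
  from MVT2[OF \<open>0 < r\<close> this] obtain s where s: "0 < s" "s < r" and eq:
    "f (x + r *\<^sub>R u + r *\<^sub>R v) - f (x + r *\<^sub>R u) - (f (x + r *\<^sub>R v) - f x) = r * D s"
    by auto
  have "((\<lambda>t. frechet_derivative f (at (x + s *\<^sub>R u + t *\<^sub>R v)) u) has_real_derivative
      frechet_derivative (\<lambda>y. frechet_derivative f (at y) u) (at (x + s *\<^sub>R u + t *\<^sub>R v)) v) (at t)"
    if "0 \<le> t" "t \<le> r" for t
    by (rule line[OF d2]) (use W s that in auto)
  from MVT2[OF \<open>0 < r\<close> this] obtain t where t: "0 < t" "t < r" and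
    "D s = r * frechet_derivative (\<lambda>y. frechet_derivative f (at y) u) (at (x + s *\<^sub>R u + t *\<^sub>R v)) v"
    by (auto simp: D_def)
  with eq show ?thesis
    by (intro that[OF s t]) (simp add: algebra_simps)
qed

text \<open>On shrinking parallelograms the double difference divided by r^2 is a mixed derivative,
  in either order, at some point of the parallelogram; continuity carries the equality over to
  \<open>x\<close>.\<close>

lemma second_derivative_symmetric:
  fixes f :: "'a::euclidean_space \<Rightarrow> real"
  assumes f: "smooth_on W f" and "open W" "x \<in> W"
  shows "frechet_derivative (\<lambda>y. frechet_derivative f (at y) u) (at x) v =
         frechet_derivative (\<lambda>y. frechet_derivative f (at y) v) (at x) u"
proof -
  define D where "D u v y = frechet_derivative (\<lambda>y. frechet_derivative f (at y) u) (at y) v" for u v y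
  have C: "Ck_on 2 W f" using f by (simp add: smooth_on_def)
  have cont: "continuous_on W (D u v)" for u v
    using C by (simp add: numeral_2_eq_2 D_def)
  have lim: "(\<lambda>n. D u v (y n)) \<longlonglongrightarrow> D u v x" if "y \<longlonglongrightarrow> x" for y u v
    using continuous_on_eq_continuous_at[OF \<open>open W\<close>] cont \<open>x \<in> W\<close> that
    by (metis isCont_tendsto_compose)
  obtain e where e: "0 < e" "ball x e \<subseteq> W"
    using assms openE by blast
  \<comment> \<open>The length of s u + t v is at most \<open>r n * c\<close>, and the factor 1/2 in
    \<open>r\<close> keeps this below \<open>e\<close>, so that all parallelograms stay in the ball
    inside \<open>W\<close>.\<close>
  define c where "c = norm u + norm v + 1"
  have "0 < c" by (simp add: c_def add_nonneg_pos)
  define r where "r n = e / (2 * c) * inverse (real (Suc n))" for n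
  have r: "0 < r n" for n using \<open>0 < c\<close> e by (simp add: r_def)
  have "r \<longlonglongrightarrow> 0" unfolding r_def using tendsto_mult_right_zero[OF LIMSEQ_inverse_real_of_nat] .
  have small: "norm (s *\<^sub>R u + t *\<^sub>R v) \<le> r n * c" if "0 \<le> s" "s \<le> r n" "0 \<le> t" "t \<le> r n" for s t n
  proof -
    have "norm (s *\<^sub>R u + t *\<^sub>R v) \<le> s * norm u + t * norm v"
      using norm_triangle_ineq[of "s *\<^sub>R u" "t *\<^sub>R v"] that by simp
    also have "\<dots> \<le> r n * norm u + r n * norm v"
      using that by (intro add_mono mult_right_mono) auto
    also have "\<dots> \<le> r n * c"
      using r[of n] by (simp add: c_def algebra_simps)
    finally show ?thesis .
  qed
  have rc: "r n * c < e" for n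
    using \<open>0 < c\<close> e by (simp add: r_def field_simps add_pos_nonneg)
  have W1: "x + s *\<^sub>R u + t *\<^sub>R v \<in> W" if "0 \<le> s" "s \<le> r n" "0 \<le> t" "t \<le> r n" for s t n
  proof -
    have "norm (s *\<^sub>R u + t *\<^sub>R v) < e"
      using small[OF that] rc[of n] by linarith
    then have "x + (s *\<^sub>R u + t *\<^sub>R v) \<in> ball x e"
      by (simp only: mem_ball dist_norm norm_minus_commute[of x] add_diff_cancel_left')
    then show ?thesis using e by (auto simp: add.assoc)
  qed
  have W2: "x + s *\<^sub>R v + t *\<^sub>R u \<in> W" if "0 \<le> s" "s \<le> r n" "0 \<le> t" "t \<le> r n" for s t n
    using W1[OF that(3,4,1,2)] by (simp add: algebra_simps)
  have "\<exists>s t s' t'. 0 < s \<and> s < r n \<and> 0 < t \<and> t < r n \<and> 0 < s' \<and> s' < r n \<and> 0 < t' \<and> t' < r n \<and>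
      D u v (x + s *\<^sub>R u + t *\<^sub>R v) = D v u (x + s' *\<^sub>R v + t' *\<^sub>R u)" for n
  proof -
    obtain s t where 1: "0 < s" "s < r n" "0 < t" "t < r n" 
      "f (x + r n *\<^sub>R u + r n *\<^sub>R v) - f (x + r n *\<^sub>R u) - f (x + r n *\<^sub>R v) + f x =
       r n * r n * D u v (x + s *\<^sub>R u + t *\<^sub>R v)"
      by (rule double_difference_mean_value[OF C r[of n], of x u v])
        (rule W1, assumption+, simp only: D_def)
    obtain s' t' where 2: "0 < s'" "s' < r n" "0 < t'" "t' < r n" 
      "f (x + r n *\<^sub>R v + r n *\<^sub>R u) - f (x + r n *\<^sub>R v) - f (x + r n *\<^sub>R u) + f x =
       r n * r n * D v u (x + s' *\<^sub>R v + t' *\<^sub>R u)"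
      by (rule double_difference_mean_value[OF C r[of n], of x v u])
        (rule W2, assumption+, simp only: D_def)
    have "f (x + r n *\<^sub>R v + r n *\<^sub>R u) = f (x + r n *\<^sub>R u + r n *\<^sub>R v)"
      by (simp add: add.assoc add.commute[of "r n *\<^sub>R v"])
    then have "r n * r n * D u v (x + s *\<^sub>R u + t *\<^sub>R v) = r n * r n * D v u (x + s' *\<^sub>R v + t' *\<^sub>R u)"
      using 1(5) 2(5) by linarith
    then have "D u v (x + s *\<^sub>R u + t *\<^sub>R v) = D v u (x + s' *\<^sub>R v + t' *\<^sub>R u)"
      using r[of n] by simp
    then show ?thesis using 1 2 by blast
  qed
  then obtain s t s' t' where st: "\<And>n. 0 < s n \<and> s n < r n \<and> 0 < t n \<and> t n < r n \<and>
      0 < s' n \<and> s' n < r n \<and> 0 < t' n \<and> t' n < r n \<and>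
      D u v (x + s n *\<^sub>R u + t n *\<^sub>R v) = D v u (x + s' n *\<^sub>R v + t' n *\<^sub>R u)"
    by metis
  have to0: "q \<longlonglongrightarrow> 0" if "\<And>n. 0 < q n \<and> q n < r n" for q
    by (rule tendsto_sandwich[OF _ _ tendsto_const \<open>r \<longlonglongrightarrow> 0\<close>])
      (use that less_imp_le in \<open>auto intro!: always_eventually\<close>)
  have "s \<longlonglongrightarrow> 0" "t \<longlonglongrightarrow> 0" "s' \<longlonglongrightarrow> 0" "t' \<longlonglongrightarrow> 0"
    using st by (auto intro!: to0)
  then have "(\<lambda>n. x + s n *\<^sub>R u + t n *\<^sub>R v) \<longlonglongrightarrow> x + 0 *\<^sub>R u + 0 *\<^sub>R v"
      "(\<lambda>n. x + s' n *\<^sub>R v + t' n *\<^sub>R u) \<longlonglongrightarrow> x + 0 *\<^sub>R v + 0 *\<^sub>R u"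
    by - (intro tendsto_intros; assumption)+
  then have "(\<lambda>n. D u v (x + s n *\<^sub>R u + t n *\<^sub>R v)) \<longlonglongrightarrow> D u v x"
      "(\<lambda>n. D v u (x + s' n *\<^sub>R v + t' n *\<^sub>R u)) \<longlonglongrightarrow> D v u x"
    by (simp_all add: lim)
  moreover have "(\<lambda>n. D u v (x + s n *\<^sub>R u + t n *\<^sub>R v)) = (\<lambda>n. D v u (x + s' n *\<^sub>R v + t' n *\<^sub>R u))"
    using st by simp
  ultimately have "D u v x = D v u x"
    using LIMSEQ_unique by metis
  then show ?thesis by (simp add: D_def)
qed

section \<open>Charts of a manifold and of its tangent bundle\<close>

lemma transition_apply:
  "inj_on (snd \<kappa>) (fst \<kappa>) \<Longrightarrow> x \<in> fst \<kappa> \<Longrightarrow> transition \<kappa> \<kappa>' (snd \<kappa> x) = snd \<kappa>' x"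
  by (simp add: transition_def)

lemma trans_deriv_self:
  assumes "inj_on (snd \<kappa>) (fst \<kappa>)" "open (snd \<kappa> ` fst \<kappa>)" "x \<in> fst \<kappa>"
  shows "trans_deriv \<kappa> \<kappa> x v = v"
proof -
  have "(transition \<kappa> \<kappa> has_derivative (\<lambda>v. v)) (at (snd \<kappa> x))"
    by (rule has_derivative_transform_within_open[OF has_derivative_ident assms(2)])
      (use assms(1,3) in \<open>auto simp: transition_apply\<close>)
  from frechet_derivative_at[OF this] show ?thesis
    by (simp add: trans_deriv_def fun_eq_iff)
qed

lemma tangent_chart_simps [simp]:
  "fst (tangent_chart A \<kappa>) = fst \<kappa> \<times> UNIV"
  "snd (tangent_chart A \<kappa>) (x, u) = (snd \<kappa> x, coord A \<kappa> x u)"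
  by (simp_all add: tangent_chart_def)

locale manifold =
  fixes A :: "('p, 'e::euclidean_space) chart set"
  assumes smooth_manifold: "smooth_manifold A"
begin

lemma chart_inj: "\<kappa> \<in> A \<Longrightarrow> inj_on (snd \<kappa>) (fst \<kappa>)"
  and chart_open: "\<kappa> \<in> A \<Longrightarrow> open (snd \<kappa> ` fst \<kappa>)"
  and overlap_open: "\<kappa> \<in> A \<Longrightarrow> \<kappa>' \<in> A \<Longrightarrow> open (snd \<kappa> ` (fst \<kappa> \<inter> fst \<kappa>'))"
  and transition_smooth:
    "\<kappa> \<in> A \<Longrightarrow> \<kappa>' \<in> A \<Longrightarrow> smooth_on (snd \<kappa> ` (fst \<kappa> \<inter> fst \<kappa>')) (transition \<kappa> \<kappa>')"
  using smooth_manifold by (auto simp: smooth_manifold_def)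

lemma inv_chart [simp]: "\<kappa> \<in> A \<Longrightarrow> x \<in> fst \<kappa> \<Longrightarrow> inv_into (fst \<kappa>) (snd \<kappa>) (snd \<kappa> x) = x"
  by (simp add: chart_inj)

lemma transition_has_derivative:
  assumes "\<kappa> \<in> A" "\<kappa>' \<in> A" "x \<in> fst \<kappa>" "x \<in> fst \<kappa>'"
  shows "(transition \<kappa> \<kappa>' has_derivative trans_deriv \<kappa> \<kappa>' x) (at (snd \<kappa> x))"
  unfolding trans_deriv_def
  by (rule smooth_on_has_derivative[OF transition_smooth]) (use assms in auto)

lemma linear_trans_deriv:
  "\<kappa> \<in> A \<Longrightarrow> \<kappa>' \<in> A \<Longrightarrow> x \<in> fst \<kappa> \<Longrightarrow> x \<in> fst \<kappa>' \<Longrightarrow> linear (trans_deriv \<kappa> \<kappa>' x)"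
  by (rule has_derivative_linear[OF transition_has_derivative])

text \<open>Chain rule: near \<open>x\<close> the transition from \<kappa> to \<kappa>'' factors
  through \<kappa>'. With equal outer charts this makes \<open>coord\<close> and
  \<open>of_coord\<close> mutually inverse.\<close>

lemma trans_deriv_trans:
  assumes "\<kappa> \<in> A" "\<kappa>' \<in> A" "\<kappa>'' \<in> A" "x \<in> fst \<kappa>" "x \<in> fst \<kappa>'" "x \<in> fst \<kappa>''"
  shows "trans_deriv \<kappa>' \<kappa>'' x (trans_deriv \<kappa> \<kappa>' x v) = trans_deriv \<kappa> \<kappa>'' x v"
proof -
  have "(transition \<kappa>' \<kappa>'' has_derivative trans_deriv \<kappa>' \<kappa>'' x) (at (transition \<kappa> \<kappa>' (snd \<kappa> x)))"
    using transition_has_derivative[of \<kappa>' \<kappa>'' x] assms by (simp add: transition_apply chart_inj)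
  from diff_chain_at[OF transition_has_derivative[of \<kappa> \<kappa>' x] this]
  have "(transition \<kappa>' \<kappa>'' \<circ> transition \<kappa> \<kappa>' has_derivative trans_deriv \<kappa>' \<kappa>'' x \<circ> trans_deriv \<kappa> \<kappa>' x)
      (at (snd \<kappa> x))"
    using assms by simp
  then have "(transition \<kappa> \<kappa>'' has_derivative trans_deriv \<kappa>' \<kappa>'' x \<circ> trans_deriv \<kappa> \<kappa>' x) (at (snd \<kappa> x))"
    by (rule has_derivative_transform_within_open[OF _ overlap_open[of \<kappa> \<kappa>']])
      (use assms in \<open>auto simp: transition_apply chart_inj\<close>)
  from has_derivative_unique[OF transition_has_derivative[of \<kappa> \<kappa>'' x] this] show ?thesis
    using assms by (simp add: fun_eq_iff)
qed

lemma chart_at: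
  assumes "x \<in> carrier A"
  shows "chart_at A x \<in> A" "x \<in> fst (chart_at A x)"
proof -
  have "\<exists>\<kappa>. \<kappa> \<in> A \<and> x \<in> fst \<kappa>" using assms by (auto simp: carrier_def)
  from someI_ex[OF this] show "chart_at A x \<in> A" "x \<in> fst (chart_at A x)"
    by (simp_all add: chart_at_def)
qed

lemma carrierI: "\<kappa> \<in> A \<Longrightarrow> x \<in> fst \<kappa> \<Longrightarrow> x \<in> carrier A"
  by (auto simp: carrier_def)

lemma linear_coord: "\<kappa> \<in> A \<Longrightarrow> x \<in> fst \<kappa> \<Longrightarrow> linear (coord A \<kappa> x)"
  unfolding coord_def[abs_def] using linear_trans_deriv chart_at carrierI by metis

lemma linear_of_coord: "\<kappa> \<in> A \<Longrightarrow> x \<in> fst \<kappa> \<Longrightarrow> linear (of_coord A \<kappa> x)"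
  unfolding of_coord_def[abs_def] using linear_trans_deriv chart_at carrierI by metis

lemma of_coord_coord [simp]:
  assumes "\<kappa> \<in> A" "x \<in> fst \<kappa>"
  shows "of_coord A \<kappa> x (coord A \<kappa> x v) = v"
  using assms chart_at[OF carrierI[OF assms]]
  by (simp add: coord_def of_coord_def trans_deriv_trans trans_deriv_self chart_inj chart_open)

lemma coord_of_coord [simp]:
  assumes "\<kappa> \<in> A" "x \<in> fst \<kappa>"
  shows "coord A \<kappa> x (of_coord A \<kappa> x v) = v"
  using assms chart_at[OF carrierI[OF assms]]
  by (simp add: coord_def of_coord_def trans_deriv_trans trans_deriv_self chart_inj chart_open)

lemma trans_deriv_coord:
  assumes "\<kappa> \<in> A" "\<kappa>' \<in> A" "x \<in> fst \<kappa>" "x \<in> fst \<kappa>'"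
  shows "trans_deriv \<kappa> \<kappa>' x (coord A \<kappa> x v) = coord A \<kappa>' x v"
  using assms chart_at[OF carrierI[OF assms(1,3)]] by (simp add: coord_def trans_deriv_trans)

lemma tangent_chart_inj:
  assumes "\<kappa> \<in> A"
  shows "inj_on (snd (tangent_chart A \<kappa>)) (fst (tangent_chart A \<kappa>))"
proof (rule inj_onI, clarsimp)
  fix x u y v
  assume "x \<in> fst \<kappa>" "y \<in> fst \<kappa>" "snd \<kappa> x = snd \<kappa> y" and uv: "coord A \<kappa> x u = coord A \<kappa> y v"
  then have "x = y" using chart_inj[OF assms] by (auto dest: inj_onD)
  with uv of_coord_coord[OF assms \<open>x \<in> fst \<kappa>\<close>] show "x = y \<and> u = v"
    by metis
qed

lemma tangent_chart_image:
  assumes "\<kappa> \<in> A"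
  shows "snd (tangent_chart A \<kappa>) ` fst (tangent_chart A \<kappa>) = (snd \<kappa> ` fst \<kappa>) \<times> UNIV"
proof
  show "(snd \<kappa> ` fst \<kappa>) \<times> UNIV \<subseteq> snd (tangent_chart A \<kappa>) ` fst (tangent_chart A \<kappa>)"
  proof clarify
    fix x v assume "x \<in> fst \<kappa>"
    then have "snd (tangent_chart A \<kappa>) (x, of_coord A \<kappa> x v) = (snd \<kappa> x, v)"
      using assms by simp
    then show "(snd \<kappa> x, v) \<in> snd (tangent_chart A \<kappa>) ` fst (tangent_chart A \<kappa>)"
      using \<open>x \<in> fst \<kappa>\<close> by (metis SigmaI UNIV_I image_eqI tangent_chart_simps(1))
  qed
qed auto

lemma tangent_chart_open: "\<kappa> \<in> A \<Longrightarrow> open (snd (tangent_chart A \<kappa>) ` fst (tangent_chart A \<kappa>))"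
  by (simp only: tangent_chart_image open_Times chart_open open_UNIV)

text \<open>Tangent vectors at (x, u) are pairs read in
  \<open>chart_at (tangent_atlas A) (x, u)\<close>. That choice stems from some chart of
  \<open>A\<close>, which may differ from \<open>chart_at A x\<close> and may vary with
  \<open>u\<close>; it is recovered here.\<close>

definition base_chart :: "'p \<times> 'e \<Rightarrow> ('p, 'e) chart" where
  "base_chart p = (SOME \<kappa>. \<kappa> \<in> A \<and> fst p \<in> fst \<kappa> \<and> chart_at (tangent_atlas A) p = tangent_chart A \<kappa>)"

lemma base_chart:
  assumes "x \<in> carrier A"
  shows "base_chart (x, u) \<in> A" "x \<in> fst (base_chart (x, u))"
    "chart_at (tangent_atlas A) (x, u) = tangent_chart A (base_chart (x, u))"
proof -
  have "\<exists>\<kappa>'. \<kappa>' \<in> tangent_atlas A \<and> (x, u) \<in> fst \<kappa>'"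
    using assms by (auto simp: carrier_def tangent_atlas_def)
  from someI_ex[OF this] obtain \<kappa> where "\<kappa> \<in> A"
    "chart_at (tangent_atlas A) (x, u) = tangent_chart A \<kappa>" "(x, u) \<in> fst (tangent_chart A \<kappa>)"
    unfolding chart_at_def[symmetric] by (metis tangent_atlas_def imageE)
  then have "\<exists>\<kappa>. \<kappa> \<in> A \<and> fst (x, u) \<in> fst \<kappa> \<and> chart_at (tangent_atlas A) (x, u) = tangent_chart A \<kappa>"
    by (intro exI[of _ \<kappa>]) simp
  from someI_ex[OF this]
  show "base_chart (x, u) \<in> A" "x \<in> fst (base_chart (x, u))"
    "chart_at (tangent_atlas A) (x, u) = tangent_chart A (base_chart (x, u))"
    by (simp_all add: base_chart_def)
qed

text \<open>The second component of the transition maps of \<open>TM\<close> is the differential of the transition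
  map of \<open>M\<close>, so their derivatives contain its second derivative.\<close>

lemma tangent_transition_has_derivative:
  assumes "\<kappa> \<in> A" "\<kappa>' \<in> A" "x \<in> fst \<kappa>" "x \<in> fst \<kappa>'"
  shows "(transition (tangent_chart A \<kappa>) (tangent_chart A \<kappa>') has_derivative
      (\<lambda>w. (trans_deriv \<kappa> \<kappa>' x (fst w),
        frechet_derivative (\<lambda>y. frechet_derivative (transition \<kappa> \<kappa>') (at y) (coord A \<kappa> x u))
          (at (snd \<kappa> x)) (fst w) + trans_deriv \<kappa> \<kappa>' x (snd w))))
    (at (snd (tangent_chart A \<kappa>) (x, u)))"
proof -
  define \<tau> where "\<tau> = transition \<kappa> \<kappa>'"
  define U where "U = snd \<kappa> ` (fst \<kappa> \<inter> fst \<kappa>')"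
  have U: "open U" "smooth_on U \<tau>" and xU: "snd \<kappa> x \<in> U"
    using overlap_open transition_smooth assms by (auto simp: U_def \<tau>_def)
  let ?p = "(snd \<kappa> x, coord A \<kappa> x u)"
  have UU: "open (U \<times> (UNIV :: 'e set))" "?p \<in> U \<times> UNIV"
    using U xU by (auto intro: open_Times)
  have fst: "((\<lambda>z. F (fst z)) has_derivative (\<lambda>w. F' (fst w))) (at ?p)"
    if "(F has_derivative F') (at (snd \<kappa> x))" for F F' :: "'e \<Rightarrow> 'e"
    using has_derivative_compose[OF has_derivative_fst[OF has_derivative_ident, of "at ?p"], of F F'] that by simp
  have lin: "linear (frechet_derivative \<tau> (at (fst z)))" if "z \<in> U \<times> UNIV" for z :: "'e \<times> 'e"
    using that by (intro smooth_on_linear_derivative[OF U(2)]) auto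
  have "((\<lambda>z. frechet_derivative \<tau> (at (fst z)) v) has_derivative
      (\<lambda>w. frechet_derivative (\<lambda>y. frechet_derivative \<tau> (at y) v) (at (snd \<kappa> x)) (fst w))) (at ?p)" for v
    by (rule fst[OF smooth_on_has_derivative[OF smooth_on_frechet_derivative[OF U(2)] xU]])
  from has_derivative_linear_apply[OF UU lin this has_derivative_snd[OF has_derivative_ident]]
  have 1: "((\<lambda>z. frechet_derivative \<tau> (at (fst z)) (snd z)) has_derivative
      (\<lambda>w. frechet_derivative (\<lambda>y. frechet_derivative \<tau> (at y) (coord A \<kappa> x u)) (at (snd \<kappa> x)) (fst w)
        + frechet_derivative \<tau> (at (snd \<kappa> x)) (snd w))) (at ?p)"
    by simp
  have 2: "transition (tangent_chart A \<kappa>) (tangent_chart A \<kappa>') z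
      = (\<tau> (fst z), frechet_derivative \<tau> (at (fst z)) (snd z))" if z: "z \<in> U \<times> UNIV" for z
  proof -
    obtain q v where q: "q \<in> fst \<kappa>" "q \<in> fst \<kappa>'" "z = (snd \<kappa> q, v)"
      using z by (auto simp: U_def)
    then have z': "z = snd (tangent_chart A \<kappa>) (q, of_coord A \<kappa> q v)"
      using assms by simp
    show ?thesis
      unfolding z' using q assms
      by (subst transition_apply[OF tangent_chart_inj])
        (simp_all add: \<tau>_def transition_apply chart_inj trans_deriv_def[symmetric]
          trans_deriv_coord[of \<kappa> \<kappa>', symmetric])
  qed
  show ?thesis
    unfolding tangent_chart_simps
    by (rule has_derivative_transform_within_open[OF has_derivative_Pair[OF
            fst[OF transition_has_derivative[OF assms]] 1[unfolded \<tau>_def, folded trans_deriv_def[of \<kappa> \<kappa>' x]]] UU])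
      (simp_all add: 2 \<tau>_def trans_deriv_def)
qed

lemmas trans_deriv_tangent =
  frechet_derivative_at[OF tangent_transition_has_derivative, symmetric, folded trans_deriv_def]

abbreviation tcoord :: "('p, 'e) chart \<Rightarrow> 'p \<times> 'e \<Rightarrow> 'e \<times> 'e \<Rightarrow> 'e \<times> 'e" where
  "tcoord \<kappa> \<equiv> coord (tangent_atlas A) (tangent_chart A \<kappa>)"

text \<open>The transition of the chosen chart to itself is the identity, so identities between
  vectors tangent to TM can be checked in this chart on the pairs themselves.\<close>

lemma tcoord_base [simp]: "x \<in> carrier A \<Longrightarrow> tcoord (base_chart (x, u)) (x, u) w = w"
  unfolding coord_def base_chart(3)
  by (rule trans_deriv_self) (simp_all add: base_chart tangent_chart_inj tangent_chart_open
      del: tangent_chart_simps, simp add: base_chart)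

lemma tcoord_eq:
  fixes u :: 'e
  assumes "\<kappa> \<in> A" "x \<in> fst \<kappa>"
  defines "\<kappa>\<^sub>0 \<equiv> base_chart (x, u)"
  shows "tcoord \<kappa> (x, u) w = (trans_deriv \<kappa>\<^sub>0 \<kappa> x (fst w),
    frechet_derivative (\<lambda>y. frechet_derivative (transition \<kappa>\<^sub>0 \<kappa>) (at y) (coord A \<kappa>\<^sub>0 x u))
      (at (snd \<kappa>\<^sub>0 x)) (fst w) + trans_deriv \<kappa>\<^sub>0 \<kappa> x (snd w))"
  using base_chart[OF carrierI[OF assms(1,2)], of u] assms
  by (simp add: coord_def trans_deriv_tangent)

lemma linear_tcoord:
  assumes "\<kappa> \<in> A" "x \<in> fst \<kappa>"
  shows "linear (tcoord \<kappa> (x, u))"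
proof -
  note b = base_chart[OF carrierI[OF assms], of u]
  from tangent_transition_has_derivative[OF b(1) assms(1) b(2) assms(2)] show ?thesis
    unfolding tcoord_eq[OF assms, abs_def] by (rule has_derivative_linear)
qed

end

section \<open>Horizontal and vertical lifts\<close>

locale riemannian = manifold A
  for A :: "('p, 'e::euclidean_space) chart set" +
  fixes g :: "'p \<Rightarrow> 'e \<Rightarrow> 'e \<Rightarrow> real"
    and \<Gamma> :: "('p, 'e) chart \<Rightarrow> 'p \<Rightarrow> 'e \<Rightarrow> 'e \<Rightarrow> 'e"
  assumes metric: "riemannian_metric A g" and levi_civita: "levi_civita A g \<Gamma>"
begin

lemma bilinear_metric: "x \<in> carrier A \<Longrightarrow> bilinear (g x)"
  and metric_sym: "x \<in> carrier A \<Longrightarrow> g x v w = g x w v"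
  and metric_pos: "x \<in> carrier A \<Longrightarrow> v \<noteq> 0 \<Longrightarrow> g x v v > 0"
  using metric by (auto simp: riemannian_metric_def)

lemmas metric_linear_simps =
  bilinear_metric[THEN bilinear_ladd] bilinear_metric[THEN bilinear_radd]
  bilinear_metric[THEN bilinear_lmul] bilinear_metric[THEN bilinear_rmul]
  bilinear_metric[THEN bilinear_lsub] bilinear_metric[THEN bilinear_rsub]
  bilinear_metric[THEN bilinear_lneg] bilinear_metric[THEN bilinear_rneg]
  bilinear_metric[THEN bilinear_lzero] bilinear_metric[THEN bilinear_rzero]

lemma bilinear_\<Gamma>: "\<kappa> \<in> A \<Longrightarrow> x \<in> fst \<kappa> \<Longrightarrow> bilinear (\<Gamma> \<kappa> x)"
  and \<Gamma>_sym: "\<kappa> \<in> A \<Longrightarrow> x \<in> fst \<kappa> \<Longrightarrow> \<Gamma> \<kappa> x v w = \<Gamma> \<kappa> x w v"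
  and \<Gamma>_smooth: "\<kappa> \<in> A \<Longrightarrow> smooth_on (snd \<kappa> ` fst \<kappa>) (\<lambda>y. \<Gamma> \<kappa> (inv_into (fst \<kappa>) (snd \<kappa>) y) v w)"
  and \<Gamma>_transform: "\<kappa> \<in> A \<Longrightarrow> \<kappa>' \<in> A \<Longrightarrow> x \<in> fst \<kappa> \<Longrightarrow> x \<in> fst \<kappa>' \<Longrightarrow>
     \<Gamma> \<kappa>' x (trans_deriv \<kappa> \<kappa>' x v) (trans_deriv \<kappa> \<kappa>' x w) =
     trans_deriv \<kappa> \<kappa>' x (\<Gamma> \<kappa> x v w) -
     frechet_derivative (\<lambda>y. frechet_derivative (transition \<kappa> \<kappa>') (at y) w) (at (snd \<kappa> x)) v"
  using levi_civita by (auto simp: levi_civita_def linear_connection_def)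

text \<open>The second derivative of the transition map in \<open>tcoord_eq\<close> cancels against
  the inhomogeneous term in the transformation law of the Christoffel symbols. So the prescribed
  coordinates agree in all charts and the descriptions defining the lifts have a value. For vertical
  lifts that term is applied to 0.\<close>

lemma hlift_vlift_coord:
  assumes "\<kappa> \<in> A" "x \<in> fst \<kappa>"
  shows "tcoord \<kappa> (x, u) (hlift A \<Gamma> (x, u) X) =
      (coord A \<kappa> x X, - \<Gamma> \<kappa> x (coord A \<kappa> x X) (coord A \<kappa> x u))" (is ?H)
    and "tcoord \<kappa> (x, u) (vlift A (x, u) X) = (0, coord A \<kappa> x X)" (is ?V)
proof -
  define \<kappa>\<^sub>0 where "\<kappa>\<^sub>0 = base_chart (x, u)"
  have x: "x \<in> carrier A" using assms by (rule carrierI)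
  note b = base_chart[OF x, of u, folded \<kappa>\<^sub>0_def]
  \<comment> \<open>\<open>tcoord\<close> is the identity in the base chart, so \<open>w\<close> can
    only be \<open>F \<kappa>\<^sub>0\<close>; existence is a consistency check over the other
    charts.\<close>
  have uniq: "\<exists>!w. \<forall>\<kappa>\<in>A. x \<in> fst \<kappa> \<longrightarrow> tcoord \<kappa> (x, u) w = F \<kappa>"
    if "\<And>\<kappa>. \<kappa> \<in> A \<Longrightarrow> x \<in> fst \<kappa> \<Longrightarrow> tcoord \<kappa> (x, u) (F \<kappa>\<^sub>0) = F \<kappa>" for F
    using that b tcoord_base[OF x, of u] unfolding \<kappa>\<^sub>0_def by metis
  have "\<exists>!w. \<forall>\<kappa>\<in>A. x \<in> fst \<kappa> \<longrightarrow> tcoord \<kappa> (x, u) w =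
      (coord A \<kappa> x X, - \<Gamma> \<kappa> x (coord A \<kappa> x X) (coord A \<kappa> x u))"
  proof (rule uniq)
    fix \<kappa> assume k: "\<kappa> \<in> A" "x \<in> fst \<kappa>"
    show "tcoord \<kappa> (x, u) (coord A \<kappa>\<^sub>0 x X, - \<Gamma> \<kappa>\<^sub>0 x (coord A \<kappa>\<^sub>0 x X) (coord A \<kappa>\<^sub>0 x u)) =
        (coord A \<kappa> x X, - \<Gamma> \<kappa> x (coord A \<kappa> x X) (coord A \<kappa> x u))"
      using \<Gamma>_transform[OF b(1) k(1) b(2) k(2), of "coord A \<kappa>\<^sub>0 x X" "coord A \<kappa>\<^sub>0 x u"] b k
      by (simp add: tcoord_eq \<kappa>\<^sub>0_def[symmetric] trans_deriv_coord linear_neg[OF linear_trans_deriv])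
  qed
  from theI'[OF this] assms show ?H
    by (simp add: hlift_def)
  have "\<exists>!w. \<forall>\<kappa>\<in>A. x \<in> fst \<kappa> \<longrightarrow> tcoord \<kappa> (x, u) w = (0, coord A \<kappa> x X)"
  proof (rule uniq)
    fix \<kappa> assume k: "\<kappa> \<in> A" "x \<in> fst \<kappa>"
    show "tcoord \<kappa> (x, u) (0, coord A \<kappa>\<^sub>0 x X) = (0, coord A \<kappa> x X)"
      using linear_0[OF linear_tcoord[OF k, of u]] b k
      by (simp add: tcoord_eq \<kappa>\<^sub>0_def[symmetric] trans_deriv_coord prod_eq_iff linear_0[OF linear_trans_deriv])
  qed
  from theI'[OF this] assms show ?V
    by (simp add: vlift_def)
qed

lemma lift_coord:
  assumes "\<kappa> \<in> A" "x \<in> fst \<kappa>"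
  shows "tcoord \<kappa> (x, u) (hlift A \<Gamma> (x, u) X + vlift A (x, u) Y) =
    (coord A \<kappa> x X, coord A \<kappa> x Y - \<Gamma> \<kappa> x (coord A \<kappa> x X) (coord A \<kappa> x u))"
  using assms by (simp add: linear_add[OF linear_tcoord] hlift_vlift_coord)

text \<open>In invariant terms: the differential of the projection from TM to M.\<close>

definition hpart :: "'p \<times> 'e \<Rightarrow> 'e \<times> 'e \<Rightarrow> 'e" where
  "hpart = (\<lambda>(x, u) w. of_coord A (base_chart (x, u)) x (fst w))"

text \<open>In invariant terms: the connection map of \<Gamma>, which kills horizontal lifts and
  undoes vertical ones.\<close>

definition vpart :: "'p \<times> 'e \<Rightarrow> 'e \<times> 'e \<Rightarrow> 'e" where
  "vpart = (\<lambda>(x, u) w. let \<kappa> = base_chart (x, u) in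
     of_coord A \<kappa> x (snd w + \<Gamma> \<kappa> x (fst w) (coord A \<kappa> x u)))"

lemma lift_base:
  fixes u :: 'e
  assumes "x \<in> carrier A"
  defines "\<kappa> \<equiv> base_chart (x, u)"
  shows "hlift A \<Gamma> (x, u) X = (coord A \<kappa> x X, - \<Gamma> \<kappa> x (coord A \<kappa> x X) (coord A \<kappa> x u))"
    and "vlift A (x, u) X = (0, coord A \<kappa> x X)"
  using hlift_vlift_coord[of \<kappa> x u X] base_chart[OF assms(1), of u] assms(1) by (simp_all add: \<kappa>_def)

lemma linear_hlift:
  assumes "x \<in> carrier A"
  shows "linear (hlift A \<Gamma> (x, u))"
  using base_chart[OF assms, of u]
  by (auto intro!: linearI simp: lift_base[OF assms] linear_add[OF linear_coord] linear_scale[OF linear_coord]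
      bilinear_ladd[OF bilinear_\<Gamma>] bilinear_lmul[OF bilinear_\<Gamma>])

lemma linear_vlift:
  assumes "x \<in> carrier A"
  shows "linear (vlift A (x, u))"
  using base_chart[OF assms, of u]
  by (auto intro!: linearI simp: lift_base[OF assms] linear_add[OF linear_coord] linear_scale[OF linear_coord])

lemma linear_hpart:
  assumes "x \<in> carrier A"
  shows "linear (hpart (x, u))"
  using base_chart[OF assms, of u]
  by (auto intro!: linearI simp: hpart_def linear_add[OF linear_of_coord] linear_scale[OF linear_of_coord])

lemma linear_vpart:
  assumes "x \<in> carrier A"
  shows "linear (vpart (x, u))"
  using base_chart[OF assms, of u]
  by (auto intro!: linearI simp: vpart_def Let_def bilinear_ladd[OF bilinear_\<Gamma>] bilinear_lmul[OF bilinear_\<Gamma>]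
      linear_add[OF linear_of_coord, symmetric] linear_scale[OF linear_of_coord, symmetric] algebra_simps)

lemma parts_lift [simp]:
  assumes "x \<in> carrier A"
  shows "hpart (x, u) (hlift A \<Gamma> (x, u) X + vlift A (x, u) Y) = X"
    "vpart (x, u) (hlift A \<Gamma> (x, u) X + vlift A (x, u) Y) = Y"
  using base_chart[OF assms, of u] by (simp_all add: hpart_def vpart_def Let_def lift_base[OF assms])

lemma lift_parts:
  assumes "x \<in> carrier A"
  shows "hlift A \<Gamma> (x, u) (hpart (x, u) w) + vlift A (x, u) (vpart (x, u) w) = w"
  using base_chart[OF assms, of u]
  by (simp add: hpart_def vpart_def Let_def lift_base[OF assms] prod_eq_iff)

text \<open>Both parts were defined through the base chart; smoothness has to be tested in every
  chart, so they must be readable there too.\<close>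

lemma coord_parts:
  assumes "\<kappa> \<in> A" "x \<in> fst \<kappa>"
  shows "coord A \<kappa> x (hpart (x, u) w) = fst (tcoord \<kappa> (x, u) w)"
    "coord A \<kappa> x (vpart (x, u) w) =
       snd (tcoord \<kappa> (x, u) w) + \<Gamma> \<kappa> x (fst (tcoord \<kappa> (x, u) w)) (coord A \<kappa> x u)"
  using lift_coord[OF assms, of u "hpart (x, u) w" "vpart (x, u) w"]
  by (simp_all add: lift_parts[OF carrierI[OF assms]])

end

section \<open>Derivatives along submanifolds\<close>

lemma isCont_eventually_mem: "isCont f a \<Longrightarrow> open W \<Longrightarrow> f a \<in> W \<Longrightarrow> \<forall>\<^sub>F t in nhds a. f t \<in> W"
  unfolding isCont_def tendsto_at_iff_tendsto_nhds by (rule topological_tendstoD)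

text \<open>Near time 0 the curve stays in \<open>S\<close> and, by continuity, its chart image
  stays in \<open>W\<close>; so \<open>f\<close> along the curve eventually equals \<open>h\<close>
  along a differentiable path.\<close>

lemma curve_through_derivative:
  assumes "curve_through A S p w \<gamma>" and W: "open W" "snd (chart_at A p) p \<in> W"
    and h: "(h has_derivative h') (at (snd (chart_at A p) p))"
    and f: "\<And>q. q \<in> S \<Longrightarrow> q \<in> fst (chart_at A p) \<Longrightarrow> snd (chart_at A p) q \<in> W \<Longrightarrow>
      f q = h (snd (chart_at A p) q)"
  shows "((\<lambda>t. f (\<gamma> t)) has_vector_derivative h' w) (at 0)"
proof -
  let ?z = "\<lambda>t. snd (chart_at A p) (\<gamma> t)"
  have \<gamma>: "\<gamma> 0 = p" "\<forall>\<^sub>F t in nhds 0. \<gamma> t \<in> S \<inter> fst (chart_at A p)"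
    "(?z has_vector_derivative w) (at 0)"
    using assms(1) by (auto simp: curve_through_def)
  have "(h has_derivative h') (at (?z 0) within range ?z)"
    using h \<gamma>(1) by (simp add: has_derivative_at_withinI)
  from vector_derivative_diff_chain_within[OF \<gamma>(3) this]
  have d: "((\<lambda>t. h (?z t)) has_vector_derivative h' w) (at 0)"
    by (simp add: o_def)
  have "isCont ?z 0"
    using \<gamma>(3) by (rule has_vector_derivative_continuous)
  then have "\<forall>\<^sub>F t in nhds 0. ?z t \<in> W"
    by (rule isCont_eventually_mem) (use W \<gamma>(1) in simp_all)
  with \<gamma>(2) have ev: "\<forall>\<^sub>F t in nhds 0. f (\<gamma> t) = h (?z t)"
    by eventually_elim (use f in auto)
  have "f (\<gamma> 0) = h (?z 0)"
    using eventually_nhds_x_imp_x[OF ev] .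
  with ev d show ?thesis
    using has_vector_derivative_cong_ev[of UNIV "\<lambda>t. f (\<gamma> t)" "\<lambda>t. h (?z t)" 0] by simp
qed

text \<open>The description in \<open>dir_deriv\<close> has a value because the chain rule gives the
  same derivative along every curve with velocity \<open>w\<close>, and only one because at least
  one such curve exists.\<close>

lemma dir_deriv_eq:
  assumes "w \<in> tangent_space A S p" and "open W" "snd (chart_at A p) p \<in> W"
    and "(h has_derivative h') (at (snd (chart_at A p) p))"
    and "\<And>q. q \<in> S \<Longrightarrow> q \<in> fst (chart_at A p) \<Longrightarrow> snd (chart_at A p) q \<in> W \<Longrightarrow>
      f q = h (snd (chart_at A p) q)"
  shows "dir_deriv A S f p w = h' w"
  unfolding dir_deriv_def
proof (rule the_equality)
  show D: "\<forall>\<gamma>. curve_through A S p w \<gamma> \<longrightarrow> ((\<lambda>t. f (\<gamma> t)) has_vector_derivative h' w) (at 0)"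
    by (intro allI impI, rule curve_through_derivative[OF _ assms(2-5)])
  obtain \<gamma> where \<gamma>: "curve_through A S p w \<gamma>"
    using assms(1) unfolding tangent_space_def by blast
  show "D = h' w" if "\<forall>\<gamma>. curve_through A S p w \<gamma> \<longrightarrow>
      ((\<lambda>t. f (\<gamma> t)) has_vector_derivative D) (at 0)" for D
    by (rule vector_derivative_unique_at[OF mp[OF spec[OF that] \<gamma>] mp[OF spec[OF D] \<gamma>]])
qed

text \<open>One closure principle for all pointwise constructions: local extensions are combined on
  the intersection of their domains, cut down to \<open>U\<close>, where \<open>H\<close> preserves
  smoothness. \<open>H\<close> may depend on the chart coordinates; operations with fewer arguments
  ignore the others.\<close>

lemma smooth_in_chart_op:
  assumes "open U" "snd \<kappa> ` fst \<kappa> \<subseteq> U" "smooth_in_chart \<kappa> S f" "smooth_in_chart \<kappa> S h"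
    and H: "\<And>W f' h'. open W \<Longrightarrow> W \<subseteq> U \<Longrightarrow> smooth_on W f' \<Longrightarrow> smooth_on W h' \<Longrightarrow>
      smooth_on W (\<lambda>z. H z (f' z) (h' z))"
    and k: "\<And>q. q \<in> S \<Longrightarrow> q \<in> fst \<kappa> \<Longrightarrow> k q = H (snd \<kappa> q) (f q) (h q)"
  shows "smooth_in_chart \<kappa> S k"
  unfolding smooth_in_chart_def
proof
  fix p assume p: "p \<in> S \<inter> fst \<kappa>"
  obtain V f' where f': "open V" "snd \<kappa> p \<in> V" "smooth_on V f'"
    "\<forall>q\<in>S \<inter> fst \<kappa>. snd \<kappa> q \<in> V \<longrightarrow> f q = f' (snd \<kappa> q)"
    using bspec[OF assms(3)[unfolded smooth_in_chart_def] p] by (elim exE conjE)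
  obtain V' h' where h': "open V'" "snd \<kappa> p \<in> V'" "smooth_on V' h'"
    "\<forall>q\<in>S \<inter> fst \<kappa>. snd \<kappa> q \<in> V' \<longrightarrow> h q = h' (snd \<kappa> q)"
    using bspec[OF assms(4)[unfolded smooth_in_chart_def] p] by (elim exE conjE)
  let ?W = "V \<inter> V' \<inter> U"
  show "\<exists>W h. open W \<and> snd \<kappa> p \<in> W \<and> smooth_on W h \<and>
      (\<forall>q\<in>S \<inter> fst \<kappa>. snd \<kappa> q \<in> W \<longrightarrow> k q = h (snd \<kappa> q))"
  proof (intro exI conjI ballI impI)
    show "open ?W" using f' h' assms(1) by auto
    then show "smooth_on ?W (\<lambda>z. H z (f' z) (h' z))"
      using f'(3) h'(3) by (intro H) (auto intro: smooth_on_subset)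
    show "snd \<kappa> p \<in> ?W" using p f' h' assms(2) by auto
    show "k q = H (snd \<kappa> q) (f' (snd \<kappa> q)) (h' (snd \<kappa> q))" if "q \<in> S \<inter> fst \<kappa>" "snd \<kappa> q \<in> ?W" for q
      using k[of q] bspec[OF f'(4) that(1)] bspec[OF h'(4) that(1)] that by simp
  qed
qed

lemma smooth_in_chart_const: "smooth_in_chart \<kappa> S (\<lambda>q. c)"
  unfolding smooth_in_chart_def by (intro ballI exI[of _ UNIV] exI[of _ "\<lambda>z. c"]) (simp add: smooth_on_const)

lemma smooth_in_chart_cong:
  assumes "\<And>q. q \<in> S \<Longrightarrow> f q = f' q" "smooth_in_chart \<kappa> S f"
  shows "smooth_in_chart \<kappa> S f'"
proof -
  have "(\<forall>q\<in>S \<inter> fst \<kappa>. snd \<kappa> q \<in> W \<longrightarrow> f q = h (snd \<kappa> q)) \<longleftrightarrow>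
    (\<forall>q\<in>S \<inter> fst \<kappa>. snd \<kappa> q \<in> W \<longrightarrow> f' q = h (snd \<kappa> q))" for W h
    using assms(1) by auto
  then show ?thesis using assms(2) by (simp add: smooth_in_chart_def)
qed

section \<open>The metric in coordinates\<close>

context riemannian
begin

abbreviation mc :: "('p, 'e) chart \<Rightarrow> 'e \<Rightarrow> 'e \<Rightarrow> 'e \<Rightarrow> real" where
  "mc \<equiv> metric_coord A g"

lemma mc_chart:
  "\<kappa> \<in> A \<Longrightarrow> x \<in> fst \<kappa> \<Longrightarrow> mc \<kappa> (snd \<kappa> x) v w = g x (of_coord A \<kappa> x v) (of_coord A \<kappa> x w)"
  by (simp add: metric_coord_def)

lemma mc_coord:
  "\<kappa> \<in> A \<Longrightarrow> x \<in> fst \<kappa> \<Longrightarrow> mc \<kappa> (snd \<kappa> x) (coord A \<kappa> x v) (coord A \<kappa> x w) = g x v w"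
  by (simp add: mc_chart)

lemma bilinear_mc:
  assumes "\<kappa> \<in> A" "y \<in> snd \<kappa> ` fst \<kappa>"
  shows "bilinear (mc \<kappa> y)"
proof -
  obtain x where x: "x \<in> fst \<kappa>" "y = snd \<kappa> x" using assms by auto
  have "linear (\<lambda>v. g x v w)" "linear (g x v)" for v w
    using bilinear_metric[OF carrierI[OF assms(1) x(1)]] by (auto simp: bilinear_def)
  from this[THEN linear_compose[OF linear_of_coord[OF assms(1) x(1)]]] show ?thesis
    unfolding bilinear_def x(2) mc_chart[OF assms(1) x(1)] o_def by (auto intro!: linearI simp: linear_iff)
qed

lemma mc_sym:
  "\<kappa> \<in> A \<Longrightarrow> y \<in> snd \<kappa> ` fst \<kappa> \<Longrightarrow> mc \<kappa> y v w = mc \<kappa> y w v"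
  by (auto simp: mc_chart metric_sym[OF carrierI])

lemma mc_smooth: "\<kappa> \<in> A \<Longrightarrow> smooth_on (snd \<kappa> ` fst \<kappa>) (\<lambda>y. mc \<kappa> y v w)"
  using metric by (auto simp: riemannian_metric_def)

lemma levi_civita_deriv:
  "\<kappa> \<in> A \<Longrightarrow> x \<in> fst \<kappa> \<Longrightarrow> ((\<lambda>y. mc \<kappa> y v w) has_derivative
    (\<lambda>d. mc \<kappa> (snd \<kappa> x) (\<Gamma> \<kappa> x d v) w + mc \<kappa> (snd \<kappa> x) v (\<Gamma> \<kappa> x d w))) (at (snd \<kappa> x))"
  using levi_civita unfolding levi_civita_def
  by (intro has_derivative_eq_rhs[OF smooth_on_has_derivative[OF mc_smooth]]) auto

text \<open>By \<open>levi_civita_deriv\<close> the metric coefficients contribute only Christoffel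
  terms, and these complete the ordinary derivatives of both arguments to covariant ones.\<close>

lemma mc_has_derivative:
  fixes u :: 'e
  assumes k: "\<kappa> \<in> A" "x \<in> fst \<kappa>"
  defines "z\<^sub>0 \<equiv> (snd \<kappa> x, u)" and "y \<equiv> snd \<kappa> x"
  assumes f: "(f has_derivative f') (at z\<^sub>0)" and h: "(h has_derivative h') (at z\<^sub>0)"
  shows "((\<lambda>z. mc \<kappa> (fst z) (f z) (h z)) has_derivative
    (\<lambda>d. mc \<kappa> y (f' d + \<Gamma> \<kappa> x (fst d) (f z\<^sub>0)) (h z\<^sub>0) +
          mc \<kappa> y (f z\<^sub>0) (h' d + \<Gamma> \<kappa> x (fst d) (h z\<^sub>0)))) (at z\<^sub>0)"
proof -
  let ?U = "(snd \<kappa> ` fst \<kappa>) \<times> (UNIV :: 'e set)"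
  have U: "open ?U" "z\<^sub>0 \<in> ?U"
    using k by (auto simp: z\<^sub>0_def intro: open_Times chart_open)
  have bil: "bilinear (mc \<kappa> (fst z))" if "z \<in> ?U" for z
    using bilinear_mc[OF k(1)] that by auto
  note bil_y = bilinear_mc[OF k(1) imageI[OF k(2)], folded y_def]
  have 1: "((\<lambda>z. mc \<kappa> (fst z) v w) has_derivative
    (\<lambda>d. mc \<kappa> y (\<Gamma> \<kappa> x (fst d) v) w + mc \<kappa> y v (\<Gamma> \<kappa> x (fst d) w))) (at z\<^sub>0)" for v w
    using has_derivative_compose[OF has_derivative_fst[OF has_derivative_ident, of "at z\<^sub>0"]] 
      levi_civita_deriv[OF k, of v w] by (simp add: z\<^sub>0_def y_def)
  \<comment> \<open>The two arguments are made variable one at a time, each time by linearity of the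
    metric in that argument.\<close>
  have 2: "((\<lambda>z. mc \<kappa> (fst z) v (h z)) has_derivative
    (\<lambda>d. (mc \<kappa> y (\<Gamma> \<kappa> x (fst d) v) (h z\<^sub>0) + mc \<kappa> y v (\<Gamma> \<kappa> x (fst d) (h z\<^sub>0)))
      + mc \<kappa> (fst z\<^sub>0) v (h' d))) (at z\<^sub>0)" for v
    by (rule has_derivative_linear_apply[OF U _ 1 h]) (use bil in \<open>auto simp: bilinear_def\<close>)
  have "((\<lambda>z. mc \<kappa> (fst z) (f z) (h z)) has_derivative
    (\<lambda>d. ((mc \<kappa> y (\<Gamma> \<kappa> x (fst d) (f z\<^sub>0)) (h z\<^sub>0) + mc \<kappa> y (f z\<^sub>0) (\<Gamma> \<kappa> x (fst d) (h z\<^sub>0)))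
      + mc \<kappa> (fst z\<^sub>0) (f z\<^sub>0) (h' d)) + mc \<kappa> (fst z\<^sub>0) (f' d) (h z\<^sub>0))) (at z\<^sub>0)"
    by (rule has_derivative_linear_apply[where B = "\<lambda>z v. mc \<kappa> (fst z) v (h z)", OF U _ 2 f])
      (use bil in \<open>auto simp: bilinear_def\<close>)
  then show ?thesis
    by (rule has_derivative_eq_rhs)
      (simp add: fun_eq_iff bilinear_ladd[OF bil_y] bilinear_radd[OF bil_y] z\<^sub>0_def y_def[symmetric])
qed

lemma mc_smooth_apply:
  assumes "\<kappa> \<in> A" "open W" "W \<subseteq> (snd \<kappa> ` fst \<kappa>) \<times> UNIV" "smooth_on W f" "smooth_on W h"
  shows "smooth_on W (\<lambda>z :: 'e \<times> 'e. mc \<kappa> (fst z) (f z) (h z))"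
proof -
  have bil: "bilinear (mc \<kappa> (fst z))" if "z \<in> W" for z
    using bilinear_mc[OF assms(1)] that assms(3) by auto
  have "smooth_on W (\<lambda>z :: 'e \<times> 'e. mc \<kappa> (fst z) v w)" for v w
    by (rule smooth_on_comp_bounded_linear[OF assms(2) bounded_linear_fst _ mc_smooth[OF assms(1)]])
      (use assms(3) in auto)
  then have "smooth_on W (\<lambda>z :: 'e \<times> 'e. mc \<kappa> (fst z) v (h z))" for v
    by (rule smooth_on_linear_apply[where B = "\<lambda>z w. mc \<kappa> (fst z) v w", OF assms(2) _ _ assms(5), rotated])
      (use bil in \<open>auto simp: bilinear_def\<close>)
  then show ?thesis
    by (rule smooth_on_linear_apply[where B = "\<lambda>z v. mc \<kappa> (fst z) v (h z)", OF assms(2) _ _ assms(4), rotated])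
      (use bil in \<open>auto simp: bilinear_def\<close>)
qed

lemma \<Gamma>_smooth_apply:
  assumes "\<kappa> \<in> A" "open W" "W \<subseteq> (snd \<kappa> ` fst \<kappa>) \<times> UNIV" "smooth_on W f" "smooth_on W h"
  shows "smooth_on W (\<lambda>z :: 'e \<times> 'e. \<Gamma> \<kappa> (inv_into (fst \<kappa>) (snd \<kappa>) (fst z)) (f z) (h z))"
proof -
  let ?B = "\<lambda>z :: 'e \<times> 'e. \<Gamma> \<kappa> (inv_into (fst \<kappa>) (snd \<kappa>) (fst z))"
  have bil: "bilinear (?B z)" if "z \<in> W" for z
    using that assms(3) by (intro bilinear_\<Gamma> inv_into_into assms(1)) auto
  have "smooth_on W (\<lambda>z. ?B z v w)" for v w
    by (rule smooth_on_comp_bounded_linear[OF assms(2) bounded_linear_fst _ \<Gamma>_smooth[OF assms(1)]])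
      (use assms(3) in auto)
  then have "smooth_on W (\<lambda>z. ?B z v (h z))" for v
    by (rule smooth_on_linear_apply[where B = "\<lambda>z w. ?B z v w", OF assms(2) _ _ assms(5), rotated])
      (use bil in \<open>auto simp: bilinear_def\<close>)
  then show ?thesis
    by (rule smooth_on_linear_apply[where B = "\<lambda>z v. ?B z v (h z)", OF assms(2) _ _ assms(4), rotated])
      (use bil in \<open>auto simp: bilinear_def\<close>)
qed

section \<open>The unit tangent bundle as a submanifold\<close>

abbreviation T1 :: "('p \<times> 'e) set" where
  "T1 \<equiv> unit_tangent_bundle A g"

abbreviation tspace :: "'p \<times> 'e \<Rightarrow> ('e \<times> 'e) set" where
  "tspace \<equiv> tangent_space (tangent_atlas A) T1"

text \<open>Serves as the local defining function of \<open>T1\<close>: tangent vectors are found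
  from its first derivative, tangency of brackets from its second.\<close>

definition level :: "('p, 'e) chart \<Rightarrow> 'e \<times> 'e \<Rightarrow> real" where
  "level \<kappa> z = mc \<kappa> (fst z) (snd z) (snd z) - 1"

lemma level_chart:
  assumes "\<kappa> \<in> A" "x \<in> fst \<kappa>"
  shows "level \<kappa> (snd \<kappa> x, coord A \<kappa> x u) = 0 \<longleftrightarrow> (x, u) \<in> T1"
  using assms by (simp add: level_def mc_coord unit_tangent_bundle_def carrierI)

lemma level_smooth:
  assumes "\<kappa> \<in> A"
  shows "smooth_on ((snd \<kappa> ` fst \<kappa>) \<times> UNIV) (level \<kappa>)"
  unfolding level_def[abs_def]
  using open_Times[OF chart_open[OF assms] open_UNIV]
  by (intro smooth_on_diff smooth_on_const mc_smooth_apply[OF assms] smooth_on_bounded_linear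
      bounded_linear_snd) auto

lemma level_has_derivative:
  assumes k: "\<kappa> \<in> A" "x \<in> fst \<kappa>"
  shows "(level \<kappa> has_derivative (\<lambda>d. 2 * mc \<kappa> (snd \<kappa> x) (snd d + \<Gamma> \<kappa> x (fst d) v) v)) (at (snd \<kappa> x, v))"
proof -
  have "((\<lambda>z. mc \<kappa> (fst z) (snd z) (snd z) - 1) has_derivative
      (\<lambda>d. mc \<kappa> (snd \<kappa> x) (snd d + \<Gamma> \<kappa> x (fst d) v) v + mc \<kappa> (snd \<kappa> x) v (snd d + \<Gamma> \<kappa> x (fst d) v) - 0))
      (at (snd \<kappa> x, v))"
    using mc_has_derivative[OF k has_derivative_snd[OF has_derivative_ident] has_derivative_snd[OF has_derivative_ident], of v]
    by (intro has_derivative_diff has_derivative_const) simp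
  then show ?thesis
    unfolding level_def[abs_def]
    by (rule has_derivative_eq_rhs) (use k mc_sym[OF k(1)] in \<open>simp add: fun_eq_iff\<close>)
qed

text \<open>Parallel transport preserves length, so \<open>level\<close> does not change in
  horizontal directions; what is left is the derivative of the squared length within the
  fibre.\<close>

lemma level_derivative_tcoord:
  assumes k: "\<kappa> \<in> A" "x \<in> fst \<kappa>"
  shows "frechet_derivative (level \<kappa>) (at (snd \<kappa> x, coord A \<kappa> x u)) (tcoord \<kappa> (x, u) w)
    = 2 * g x (vpart (x, u) w) u"
  using frechet_derivative_at[OF level_has_derivative[OF k, of "coord A \<kappa> x u"], symmetric]
  by (simp add: coord_parts(2)[OF k, symmetric] mc_coord k)

text \<open>\<open>level\<close> vanishes along curves in \<open>T1\<close>, which gives one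
  direction. For the other, a straight line in the chart with velocity \<open>w\<close> is pushed
  onto \<open>T1\<close> by normalising its fibre component.\<close>

lemma tspace_iff:
  assumes p: "(x, u) \<in> T1"
  shows "w \<in> tspace (x, u) \<longleftrightarrow> g x (vpart (x, u) w) u = 0"
proof -
  define \<kappa> where "\<kappa> = base_chart (x, u)"
  have x: "x \<in> carrier A" using p by (simp add: unit_tangent_bundle_def)
  note b = base_chart[OF x, of u, folded \<kappa>_def]
  let ?v = "coord A \<kappa> x u"
  let ?z0 = "(snd \<kappa> x, ?v)"
  have DF: "frechet_derivative (level \<kappa>) (at ?z0) w = 2 * g x (vpart (x, u) w) u"
    using level_derivative_tcoord[OF b(1,2), of u w] tcoord_base[OF x] by (simp add: \<kappa>_def)
  have hd: "(level \<kappa> has_derivative frechet_derivative (level \<kappa>) (at ?z0)) (at ?z0)"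
    unfolding frechet_derivative_at[OF level_has_derivative[OF b(1,2)], symmetric]
    by (rule level_has_derivative[OF b(1,2)])
  have Uo: "open ((snd \<kappa> ` fst \<kappa>) \<times> (UNIV :: 'e set))"
    using b by (intro open_Times chart_open) auto
  have ct: "chart_at (tangent_atlas A) (x, u) = tangent_chart A \<kappa>"
    using b by simp
  show ?thesis
  proof
    assume "w \<in> tspace (x, u)"
    then obtain \<gamma> where c: "curve_through (tangent_atlas A) T1 (x, u) w \<gamma>"
      by (auto simp: tangent_space_def)
    have lev0: "level \<kappa> (snd (tangent_chart A \<kappa>) q) = 0" if "q \<in> T1" "q \<in> fst (tangent_chart A \<kappa>)" for q
      using level_chart[OF b(1)] that by (cases q) auto
    have "((\<lambda>t. 0) has_vector_derivative frechet_derivative (level \<kappa>) (at ?z0) w) (at 0)"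
      by (rule curve_through_derivative[OF c Uo, of "level \<kappa>" _ "\<lambda>_. 0"])
        (use b hd lev0 in \<open>simp_all add: ct del: tangent_chart_simps(1)\<close>)
    then show "g x (vpart (x, u) w) u = 0"
      using vector_derivative_unique_at[OF has_vector_derivative_const] DF by fastforce
  next
    assume w: "g x (vpart (x, u) w) u = 0"
    define l where "l t = (snd \<kappa> x + t *\<^sub>R fst w, ?v + t *\<^sub>R snd w)" for t
    \<comment> \<open>The squared length along the line: it is 1 at time 0 and stationary there,
      because \<open>w\<close> satisfies the linearised condition.\<close>
    define N where "N t = level \<kappa> (l t) + 1" for t
    have N: "N t = mc \<kappa> (fst (l t)) (snd (l t)) (snd (l t))" for t
      by (simp add: N_def level_def)
    have l0: "l 0 = ?z0" by (simp add: l_def)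
    have "((\<lambda>t. snd \<kappa> x + t *\<^sub>R fst w) has_vector_derivative fst w) (at 0)"
      "((\<lambda>t. ?v + t *\<^sub>R snd w) has_vector_derivative snd w) (at 0)"
      by (auto intro!: derivative_eq_intros simp: has_vector_derivative_def)
    note l' = this
    have "(l has_vector_derivative w) (at 0)"
      unfolding l_def[abs_def] using has_vector_derivative_Pair[OF l'] by simp
    have "((level \<kappa> \<circ> l) has_vector_derivative frechet_derivative (level \<kappa>) (at ?z0) w) (at 0)"
      by (rule vector_derivative_diff_chain_within[OF \<open>(l has_vector_derivative w) (at 0)\<close>])
        (use hd l0 in \<open>simp add: has_derivative_at_withinI\<close>)
    then have "((\<lambda>t. level \<kappa> (l t)) has_real_derivative 0) (at 0)"
      using w DF by (simp add: o_def has_real_derivative_iff_has_vector_derivative)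
    then have N': "(N has_real_derivative 0) (at 0)"
      unfolding N_def[abs_def] by (auto intro!: derivative_eq_intros)
    have N0: "N 0 = 1"
      using level_chart[OF b(1,2), of u] p by (simp add: N_def l0)
    \<comment> \<open>As \<open>N\<close> is stationary, so is the normalising factor; rescaling
      therefore leaves the velocity equal to \<open>w\<close>.\<close>
    have s': "((\<lambda>t. 1 / sqrt (N t)) has_real_derivative 0) (at 0)"
      by (rule derivative_eq_intros refl N' | simp add: N0)+
    define z where "z t = (fst (l t), (1 / sqrt (N t)) *\<^sub>R snd (l t))" for t
    have z': "(z has_vector_derivative w) (at 0)"
      using has_vector_derivative_Pair[OF l'(1) has_vector_derivative_scaleR[OF s' l'(2)]]
      unfolding z_def[abs_def] by (simp add: l_def N0)
    define \<gamma> where "\<gamma> t = (inv_into (fst \<kappa>) (snd \<kappa>) (fst (l t)),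
      of_coord A \<kappa> (inv_into (fst \<kappa>) (snd \<kappa>) (fst (l t))) (snd (z t)))" for t
    have ev: "\<forall>\<^sub>F t in nhds 0. fst (l t) \<in> snd \<kappa> ` fst \<kappa> \<and> N t > 0"
    proof (rule eventually_conj)
      have "isCont (\<lambda>t. fst (l t)) 0" by (simp add: l_def)
      then show "\<forall>\<^sub>F t in nhds 0. fst (l t) \<in> snd \<kappa> ` fst \<kappa>"
        by (rule isCont_eventually_mem) (use chart_open[OF b(1)] b(2) l0 in simp_all)
      have "isCont N 0" using N' by (rule DERIV_isCont)
      then show "\<forall>\<^sub>F t in nhds 0. N t > 0"
        using isCont_eventually_mem[of 0 N "{0<..}"] N0 by simp
    qed
    have g: "\<gamma> t \<in> T1 \<inter> fst (tangent_chart A \<kappa>) \<and> snd (tangent_chart A \<kappa>) (\<gamma> t) = z t"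
      if t: "fst (l t) \<in> snd \<kappa> ` fst \<kappa> \<and> N t > 0" for t
    proof -
      from t obtain q where q: "q \<in> fst \<kappa>" "fst (l t) = snd \<kappa> q" by auto
      have e: "\<gamma> t = (q, of_coord A \<kappa> q (snd (z t)))"
        using q b by (simp add: \<gamma>_def)
      have zt: "snd (tangent_chart A \<kappa>) (\<gamma> t) = z t"
        using q b by (simp add: e z_def)
      have "mc \<kappa> (fst (z t)) (snd (z t)) (snd (z t)) = (1 / sqrt (N t)) * ((1 / sqrt (N t)) * N t)"
        using bilinear_mc[OF b(1) imageI[OF q(1)]] q(2)
        by (simp add: z_def N bilinear_lmul bilinear_rmul)
      also have "\<dots> = 1" using t by simp
      finally have "level \<kappa> (z t) = 0" by (simp add: level_def)
      then have "\<gamma> t \<in> T1"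
        using level_chart[OF b(1) q(1), of "of_coord A \<kappa> q (snd (z t))"] q b by (simp add: e z_def)
      then show ?thesis using q zt by (simp add: e)
    qed
    have "((\<lambda>t. snd (tangent_chart A \<kappa>) (\<gamma> t)) has_vector_derivative w) (at 0)"
    proof -
      have ev2: "\<forall>\<^sub>F t in nhds 0. snd (tangent_chart A \<kappa>) (\<gamma> t) = z t"
        using ev by eventually_elim (use g in blast)
      with z' eventually_nhds_x_imp_x[OF ev2] show ?thesis
        using has_vector_derivative_cong_ev[of UNIV "\<lambda>t. snd (tangent_chart A \<kappa>) (\<gamma> t)" z 0] by simp
    qed
    moreover have "\<forall>\<^sub>F t in nhds 0. \<gamma> t \<in> T1 \<inter> fst (tangent_chart A \<kappa>)"
      using ev by eventually_elim (use g in blast)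
    moreover have "\<gamma> 0 = (x, u)"
      using b by (simp add: \<gamma>_def z_def l0 N0)
    ultimately show "w \<in> tspace (x, u)"
      by (auto simp: tangent_space_def curve_through_def ct)
  qed
qed

lemma T1_carrier: "(x, u) \<in> T1 \<Longrightarrow> x \<in> carrier A"
  and T1_unit: "(x, u) \<in> T1 \<Longrightarrow> g x u u = 1"
  by (auto simp: unit_tangent_bundle_def)

text \<open>\<open>embedded_submanifold\<close> asks for a defining map into the model space itself,
  so the real function \<open>level\<close> is multiplied by a basis vector \<open>e\<close>. The
  line spanned by \<open>e\<close> has the required dimension 2(n + 1) - (2n + 1) = 1.\<close>

lemma embedded_T1:
  assumes "DIM('e) = n + 1"
  shows "embedded_submanifold (tangent_atlas A) T1 (2 * n + 1)"
  unfolding embedded_submanifold_def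
proof
  fix p assume p: "p \<in> T1"
  obtain x u where xu: "p = (x, u)" by (cases p)
  obtain \<kappa> where k: "\<kappa> \<in> A" "x \<in> fst \<kappa>"
    using chart_at[OF T1_carrier] p xu by blast
  obtain e :: "'e \<times> 'e" where e: "e \<in> Basis" using nonempty_Basis by blast
  then have e0: "e \<noteq> 0" by (rule nonzero_Basis)
  let ?W = "(snd \<kappa> ` fst \<kappa>) \<times> (UNIV :: 'e set)"
  let ?h = "\<lambda>z. level \<kappa> z *\<^sub>R e"
  have W: "open ?W" using k by (intro open_Times chart_open) auto
  have range: "range (frechet_derivative ?h (at z)) = span {e}" if "z \<in> ?W" "?h z = 0" for z
  proof -
    obtain q v where q: "q \<in> fst \<kappa>" "z = (snd \<kappa> q, v)" using \<open>z \<in> ?W\<close> by auto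
    let ?D = "\<lambda>d. 2 * mc \<kappa> (snd \<kappa> q) (snd d + \<Gamma> \<kappa> q (fst d) v) v"
    have lev: "(level \<kappa> has_derivative ?D) (at z)"
      using level_has_derivative[OF k(1) q(1)] q by simp
    then have "(?h has_derivative (\<lambda>d. ?D d *\<^sub>R e)) (at z)"
      by (auto intro!: derivative_eq_intros)
    from frechet_derivative_at[OF this, symmetric]
    have fd: "frechet_derivative ?h (at z) = (\<lambda>d. ?D d *\<^sub>R e)" .
    \<comment> \<open>Stretching the unit vector \<open>v\<close> within its fibre is a direction in
      which \<open>level\<close> has derivative 2; hence the differential is onto the line.\<close>
    have "mc \<kappa> (snd \<kappa> q) v v = 1" using that(2) q e0 by (simp add: level_def)
    then have D1: "?D (0, v) = 2"
      by (simp add: bilinear_lzero[OF bilinear_\<Gamma>[OF k(1) q(1)]])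
    have lin: "linear ?D" by (rule has_derivative_linear[OF lev])
    have surj: "\<exists>d. r = ?D d" for r
      using linear_scale[OF lin, of "r / 2" "(0, v)"] D1 by (intro exI[of _ "(r / 2) *\<^sub>R (0, v)"]) simp
    show ?thesis
      unfolding fd span_singleton using surj by (auto simp: image_iff)
  qed
  show "\<exists>\<kappa>\<in>tangent_atlas A. \<exists>W (h :: 'e \<times> 'e \<Rightarrow> 'e \<times> 'e) L.
        p \<in> fst \<kappa> \<and> open W \<and> snd \<kappa> p \<in> W \<and> W \<subseteq> snd \<kappa> ` fst \<kappa> \<and>
        subspace L \<and> dim L + (2 * n + 1) = DIM('e \<times> 'e) \<and> smooth_on W h \<and> h ` W \<subseteq> L \<and>
        (\<forall>q\<in>fst \<kappa>. snd \<kappa> q \<in> W \<longrightarrow> (q \<in> T1 \<longleftrightarrow> h (snd \<kappa> q) = 0)) \<and>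
        (\<forall>y\<in>W. h y = 0 \<longrightarrow> range (frechet_derivative h (at y)) = L)"
  proof (rule bexI[of _ "tangent_chart A \<kappa>"], rule exI[of _ ?W], rule exI[of _ ?h],
      rule exI[of _ "span {e}"], intro conjI)
    show "p \<in> fst (tangent_chart A \<kappa>)" "snd (tangent_chart A \<kappa>) p \<in> ?W"
      using k xu by auto
    show "?W \<subseteq> snd (tangent_chart A \<kappa>) ` fst (tangent_chart A \<kappa>)"
      using tangent_chart_image[OF k(1)] by simp
    show "dim (span {e}) + (2 * n + 1) = DIM('e \<times> 'e)"
      using assms e0 by (simp add: dim_singleton)
    show "smooth_on ?W ?h"
      by (rule smooth_on_scaleR[OF W level_smooth[OF k(1)] smooth_on_const])
    show "\<forall>q\<in>fst (tangent_chart A \<kappa>). snd (tangent_chart A \<kappa>) q \<in> ?W \<longrightarrow>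
        (q \<in> T1 \<longleftrightarrow> ?h (snd (tangent_chart A \<kappa>) q) = 0)"
      using level_chart[OF k(1)] e0 by auto
    show "tangent_chart A \<kappa> \<in> tangent_atlas A"
      using k by (simp add: tangent_atlas_def)
    show "\<forall>z\<in>?W. ?h z = 0 \<longrightarrow> range (frechet_derivative ?h (at z)) = span {e}"
      using range by blast
    show "?h ` ?W \<subseteq> span {e}"
      by (rule image_subsetI) (intro span_scale span_base singletonI)
  qed (auto intro: W)
qed

lemma lift_mem_tspace:
  assumes "(x, u) \<in> T1" "g x Y u = 0"
  shows "hlift A \<Gamma> (x, u) X + vlift A (x, u) Y \<in> tspace (x, u)"
  using assms T1_carrier[OF assms(1)] by (simp add: tspace_iff)

lemma hlift_mem_tspace:
  assumes "(x, u) \<in> T1"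
  shows "hlift A \<Gamma> (x, u) X \<in> tspace (x, u)"
  using lift_mem_tspace[OF assms, of 0 X] bilinear_lzero[OF bilinear_metric[OF T1_carrier[OF assms]]]
  by (simp add: linear_0[OF linear_vlift[OF T1_carrier[OF assms]]])

lemma vlift_mem_tspace:
  assumes "(x, u) \<in> T1" "g x Y u = 0"
  shows "vlift A (x, u) Y \<in> tspace (x, u)"
  using lift_mem_tspace[OF assms, of 0]
  by (simp add: linear_0[OF linear_hlift[OF T1_carrier[OF assms(1)]]])

lemma parts_hlift [simp]:
  assumes "x \<in> carrier A"
  shows "hpart (x, u) (hlift A \<Gamma> (x, u) X) = X" "vpart (x, u) (hlift A \<Gamma> (x, u) X) = 0"
  using parts_lift[OF assms, of u X 0] by (simp_all add: linear_0[OF linear_vlift[OF assms]])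

lemma parts_vlift [simp]:
  assumes "x \<in> carrier A"
  shows "hpart (x, u) (vlift A (x, u) X) = 0" "vpart (x, u) (vlift A (x, u) X) = X"
  using parts_lift[OF assms, of u 0 X] by (simp_all add: linear_0[OF linear_hlift[OF assms]])

lemma parts_eqI:
  "x \<in> carrier A \<Longrightarrow> hpart (x, u) w = hpart (x, u) w' \<Longrightarrow> vpart (x, u) w = vpart (x, u) w' \<Longrightarrow> w = w'"
  by (metis lift_parts)

definition perp :: "'p \<times> 'e \<Rightarrow> 'e \<Rightarrow> 'e" where
  "perp = (\<lambda>(x, u) X. X - g x X u *\<^sub>R u)"

lemma metric_perp: "(x, u) \<in> T1 \<Longrightarrow> g x (perp (x, u) X) u = 0"
  using T1_carrier[of x u] by (simp add: perp_def metric_linear_simps T1_unit)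

lemma perp_id: "g x X u = 0 \<Longrightarrow> perp (x, u) X = X"
  by (simp add: perp_def)

lemma ex_T1: "\<exists>x u. (x, u) \<in> T1"
proof -
  obtain x where x: "x \<in> carrier A"
    using smooth_manifold by (auto simp: smooth_manifold_def)
  obtain e :: 'e where "e \<in> Basis" using nonempty_Basis by blast
  then have e: "g x e e > 0" using metric_pos[OF x] nonzero_Basis by blast
  have "(x, (1 / sqrt (g x e e)) *\<^sub>R e) \<in> T1"
    using x e by (simp add: unit_tangent_bundle_def metric_linear_simps)
  then show ?thesis by blast
qed

lemma dim_perp:
  assumes p: "(x, u) \<in> T1"
  shows "dim {Y. g x Y u = 0} = DIM('e) - 1"
proof -
  note x = T1_carrier[OF p]
  have lin: "linear (\<lambda>Y. g x Y u)" using bilinear_metric[OF x] by (simp add: bilinear_def)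
  \<comment> \<open>\<open>r\<close> represents the pairing with \<open>u\<close> in the Euclidean
    inner product of the model space, so the complement of \<open>u\<close> is an ordinary
    hyperplane.\<close>
  define r where "r = (\<Sum>i\<in>Basis. g x i u *\<^sub>R i)"
  have r: "g x Y u = r \<bullet> Y" for Y
    using linear_expand[OF lin, of Y] unfolding r_def inner_sum_left
    by (simp add: inner_commute mult.commute)
  have "r \<noteq> 0" using r[of u] T1_unit[OF p] by auto
  then show ?thesis
    using dim_hyperplane by (simp add: r)
qed

section \<open>Smooth vector fields on the unit tangent bundle\<close>

abbreviation smooth_fun :: "('p \<times> 'e \<Rightarrow> real) \<Rightarrow> bool" where
  "smooth_fun \<equiv> smooth_map (tangent_atlas A) T1"

text \<open>Sections of the pullback of TM to \<open>T1\<close>: to each unit vector a vector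
  tangent to M at its foot point. The two parts of a field on \<open>T1\<close> are of this
  kind.\<close>

definition smooth_section :: "('p \<times> 'e \<Rightarrow> 'e) \<Rightarrow> bool" where
  "smooth_section Z \<longleftrightarrow>
     (\<forall>\<kappa>\<in>A. smooth_in_chart (tangent_chart A \<kappa>) T1 (\<lambda>q. coord A \<kappa> (fst q) (Z q)))"

lemmas tangent_chart_op =
  smooth_in_chart_op[OF open_Times[OF chart_open open_UNIV] equalityD1[OF tangent_chart_image]]

lemma smooth_sectionD:
  "smooth_section Z \<Longrightarrow> \<kappa> \<in> A \<Longrightarrow>
    smooth_in_chart (tangent_chart A \<kappa>) T1 (\<lambda>q. coord A \<kappa> (fst q) (Z q))"
  by (simp add: smooth_section_def)

lemma smooth_funD: "smooth_fun r \<Longrightarrow> \<kappa> \<in> A \<Longrightarrow> smooth_in_chart (tangent_chart A \<kappa>) T1 r"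
  by (simp add: smooth_map_def tangent_atlas_def)

lemma smooth_funI: "(\<And>\<kappa>. \<kappa> \<in> A \<Longrightarrow> smooth_in_chart (tangent_chart A \<kappa>) T1 r) \<Longrightarrow> smooth_fun r"
  by (simp add: smooth_map_def tangent_atlas_def)

lemma smooth_section_add:
  assumes "smooth_section Z" "smooth_section Z'"
  shows "smooth_section (\<lambda>q. Z q + Z' q)"
  unfolding smooth_section_def
proof
  fix \<kappa> assume k: "\<kappa> \<in> A"
  show "smooth_in_chart (tangent_chart A \<kappa>) T1 (\<lambda>q. coord A \<kappa> (fst q) (Z q + Z' q))"
    by (rule tangent_chart_op[OF k k assms[THEN smooth_sectionD, OF k], where H = "\<lambda>z a b. a + b"])
      (use k in \<open>auto simp: smooth_on_add linear_add[OF linear_coord]\<close>)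
qed

lemma smooth_section_scale:
  assumes "smooth_fun r" "smooth_section Z"
  shows "smooth_section (\<lambda>q. r q *\<^sub>R Z q)"
  unfolding smooth_section_def
proof
  fix \<kappa> assume k: "\<kappa> \<in> A"
  show "smooth_in_chart (tangent_chart A \<kappa>) T1 (\<lambda>q. coord A \<kappa> (fst q) (r q *\<^sub>R Z q))"
    by (rule tangent_chart_op[OF k k smooth_funD[OF assms(1) k] smooth_sectionD[OF assms(2) k],
          where H = "\<lambda>z a b. a *\<^sub>R b"])
      (use k in \<open>auto simp: smooth_on_scaleR linear_scale[OF linear_coord]\<close>)
qed

lemma smooth_section_snd: "smooth_section snd"
  unfolding smooth_section_def
proof
  fix \<kappa> assume k: "\<kappa> \<in> A"
  show "smooth_in_chart (tangent_chart A \<kappa>) T1 (\<lambda>q. coord A \<kappa> (fst q) (snd q))"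
    by (rule tangent_chart_op[OF k k smooth_in_chart_const[where c = "0::real"]
          smooth_in_chart_const[where c = "0::real"], where H = "\<lambda>z a b. snd z"])
      (auto intro: smooth_on_bounded_linear bounded_linear_snd)
qed

lemma smooth_fun_metric:
  assumes "smooth_section Z" "smooth_section Z'"
  shows "smooth_fun (\<lambda>q. g (fst q) (Z q) (Z' q))"
proof (rule smooth_funI)
  fix \<kappa> assume k: "\<kappa> \<in> A"
  show "smooth_in_chart (tangent_chart A \<kappa>) T1 (\<lambda>q. g (fst q) (Z q) (Z' q))"
    by (rule tangent_chart_op[OF k k assms[THEN smooth_sectionD, OF k], where H = "\<lambda>z. mc \<kappa> (fst z)"])
      (use k in \<open>auto simp: mc_coord intro: mc_smooth_apply\<close>)
qed

lemma smooth_fun_const: "smooth_fun (\<lambda>q. c)"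
  by (simp add: smooth_map_def smooth_in_chart_const)

lemma smooth_fun_add:
  assumes "smooth_fun r" "smooth_fun s"
  shows "smooth_fun (\<lambda>q. r q + s q)"
proof (rule smooth_funI)
  fix \<kappa> assume k: "\<kappa> \<in> A"
  show "smooth_in_chart (tangent_chart A \<kappa>) T1 (\<lambda>q. r q + s q)"
    by (rule tangent_chart_op[OF k k assms[THEN smooth_funD, OF k], where H = "\<lambda>z a b. a + b"])
      (auto simp: smooth_on_add)
qed

lemma smooth_fun_mult:
  assumes "smooth_fun r" "smooth_fun s"
  shows "smooth_fun (\<lambda>q. r q * s q)"
proof (rule smooth_funI)
  fix \<kappa> assume k: "\<kappa> \<in> A"
  show "smooth_in_chart (tangent_chart A \<kappa>) T1 (\<lambda>q. r q * s q)"
    by (rule tangent_chart_op[OF k k assms[THEN smooth_funD, OF k], where H = "\<lambda>z a b. a *\<^sub>R b"])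
      (simp_all add: smooth_on_scaleR[where 'b = real, unfolded real_scaleR_def])
qed

text \<open>In each chart the passage between the coordinates of a vector and its two parts is a
  shear by the Christoffel symbols, smooth in both directions. Smoothness of the structure tensors
  can then be checked on sections.\<close>

lemma vector_field_iff:
  "vector_field (tangent_atlas A) T1 X \<longleftrightarrow>
     (\<forall>(x, u)\<in>T1. g x (vpart (x, u) (X (x, u))) u = 0) \<and>
     smooth_section (\<lambda>q. hpart q (X q)) \<and> smooth_section (\<lambda>q. vpart q (X q))"
proof -
  have "(\<forall>p\<in>T1. X p \<in> tspace p) \<longleftrightarrow> (\<forall>(x, u)\<in>T1. g x (vpart (x, u) (X (x, u))) u = 0)"
    by (auto simp: tspace_iff)
  moreover have "(\<forall>\<kappa>\<in>tangent_atlas A. smooth_in_chart \<kappa> T1 (\<lambda>q. coord (tangent_atlas A) \<kappa> q (X q))) \<longleftrightarrow>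
     smooth_section (\<lambda>q. hpart q (X q)) \<and> smooth_section (\<lambda>q. vpart q (X q))" (is "?L \<longleftrightarrow> ?R")
  proof
    assume L: ?L
    have L: "smooth_in_chart (tangent_chart A \<kappa>) T1 (\<lambda>q. tcoord \<kappa> q (X q))" if "\<kappa> \<in> A" for \<kappa>
      using L that by (simp add: tangent_atlas_def)
    show ?R
      unfolding smooth_section_def
    proof (intro conjI ballI)
      fix \<kappa> assume k: "\<kappa> \<in> A"
      show "smooth_in_chart (tangent_chart A \<kappa>) T1 (\<lambda>q. coord A \<kappa> (fst q) (hpart q (X q)))"
        by (rule tangent_chart_op[OF k k L[OF k] L[OF k], where H = "\<lambda>z a b. fst a"])
          (use k in \<open>auto simp: coord_parts intro: smooth_on_bounded_linear_comp bounded_linear_fst\<close>)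
      have sm: "smooth_on W (\<lambda>z. snd (f z) +
          \<Gamma> \<kappa> (inv_into (fst \<kappa>) (snd \<kappa>) (fst z)) (fst (f z)) (snd z))"
        if W: "open W" "W \<subseteq> (snd \<kappa> ` fst \<kappa>) \<times> UNIV" and f: "smooth_on W f" for W f
        by (rule smooth_on_add[OF W(1) smooth_on_bounded_linear_comp[OF W(1) bounded_linear_snd f]
              \<Gamma>_smooth_apply[OF k W smooth_on_bounded_linear_comp[OF W(1) bounded_linear_fst f]
                smooth_on_bounded_linear[OF bounded_linear_snd]]])
      show "smooth_in_chart (tangent_chart A \<kappa>) T1 (\<lambda>q. coord A \<kappa> (fst q) (vpart q (X q)))"
        by (rule tangent_chart_op[OF k k L[OF k] L[OF k], where H =
              "\<lambda>z a b. snd a + \<Gamma> \<kappa> (inv_into (fst \<kappa>) (snd \<kappa>) (fst z)) (fst a) (snd z)"])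
          (use k sm in \<open>auto simp: coord_parts\<close>)
    qed
  next
    assume R: ?R
    show ?L
      unfolding tangent_atlas_def ball_simps
      unfolding tangent_atlas_def[symmetric]
    proof
      fix \<kappa> assume k: "\<kappa> \<in> A"
      have R: "smooth_in_chart (tangent_chart A \<kappa>) T1 (\<lambda>q. coord A \<kappa> (fst q) (hpart q (X q)))"
         "smooth_in_chart (tangent_chart A \<kappa>) T1 (\<lambda>q. coord A \<kappa> (fst q) (vpart q (X q)))"
        using R k by (auto simp: smooth_section_def)
      have sm: "smooth_on W (\<lambda>z. (f z, h z - \<Gamma> \<kappa> (inv_into (fst \<kappa>) (snd \<kappa>) (fst z)) (f z) (snd z)))"
        if W: "open W" "W \<subseteq> (snd \<kappa> ` fst \<kappa>) \<times> UNIV" and f: "smooth_on W f" and h: "smooth_on W h" for W f h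
        by (rule smooth_on_Pair[OF W(1) f smooth_on_diff[OF W(1) h
              \<Gamma>_smooth_apply[OF k W f smooth_on_bounded_linear[OF bounded_linear_snd]]]])
      show "smooth_in_chart (tangent_chart A \<kappa>) T1 (\<lambda>q. tcoord \<kappa> q (X q))"
        by (rule tangent_chart_op[OF k k R, where H =
              "\<lambda>z a b. (a, b - \<Gamma> \<kappa> (inv_into (fst \<kappa>) (snd \<kappa>) (fst z)) a (snd z))"])
          (use k sm in \<open>auto simp: coord_parts\<close>)
    qed
  qed
  ultimately show ?thesis
    unfolding vector_field_def by blast
qed

lemma smooth_section_cong: "smooth_section Z \<Longrightarrow> (\<And>q. q \<in> T1 \<Longrightarrow> Z q = Z' q) \<Longrightarrow> smooth_section Z'"
  unfolding smooth_section_def by (auto intro: smooth_in_chart_cong[rotated])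

lemma smooth_fun_cong: "smooth_fun r \<Longrightarrow> (\<And>q. q \<in> T1 \<Longrightarrow> r q = s q) \<Longrightarrow> smooth_fun s"
  unfolding smooth_map_def by (auto intro: smooth_in_chart_cong[rotated])

lemma vector_field_smooth:
  assumes "vector_field (tangent_atlas A) T1 X"
  shows "smooth_section (\<lambda>q. hpart q (X q))" "smooth_section (\<lambda>q. vpart q (X q))"
    "q \<in> T1 \<Longrightarrow> X q \<in> tspace q"
  using assms unfolding vector_field_iff[of X] by (auto simp: vector_field_def vector_field_iff tspace_iff)

lemma smooth_perp:
  assumes "smooth_section Z"
  shows "smooth_section (\<lambda>q. perp q (Z q))"
  by (rule smooth_section_cong[OF smooth_section_add[OF assms smooth_section_scale[OF
          smooth_fun_mult[OF smooth_fun_const[of "-1"] smooth_fun_metric[OF assms smooth_section_snd]]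
          smooth_section_snd]]])
    (auto simp: perp_def)

lemma smooth_section_combination:
  "smooth_section Z \<Longrightarrow> smooth_section Z' \<Longrightarrow> smooth_section (\<lambda>q. r *\<^sub>R Z q + s *\<^sub>R Z' q)"
  by (intro smooth_section_add smooth_section_scale smooth_fun_const)

section \<open>The exterior derivative of the canonical one-form\<close>

text \<open>The fields are given on \<open>T1\<close> only, whereas derivatives in a chart need an
  open domain. Keeping \<open>W\<close> inside the chart image makes \<open>level\<close> smooth on
  it too.\<close>

definition extends_field :: "('p \<times> 'e \<Rightarrow> 'e \<times> 'e) \<Rightarrow> 'p \<times> 'e \<Rightarrow> ('e \<times> 'e) set \<Rightarrow>
    ('e \<times> 'e \<Rightarrow> 'e \<times> 'e) \<Rightarrow> bool" where
  "extends_field X p W h \<longleftrightarrow> (let \<kappa> = base_chart p in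
     open W \<and> snd (tangent_chart A \<kappa>) p \<in> W \<and> W \<subseteq> (snd \<kappa> ` fst \<kappa>) \<times> UNIV \<and> smooth_on W h \<and>
     (\<forall>q\<in>T1. fst q \<in> fst \<kappa> \<longrightarrow> snd (tangent_chart A \<kappa>) q \<in> W \<longrightarrow>
        tcoord \<kappa> q (X q) = h (snd (tangent_chart A \<kappa>) q)))"

lemma ex_extends_field:
  assumes X: "vector_field (tangent_atlas A) T1 X" and p: "(x, u) \<in> T1"
  shows "\<exists>W h. extends_field X (x, u) W h"
proof -
  define \<kappa> where "\<kappa> = base_chart (x, u)"
  note b = base_chart[OF T1_carrier[OF p], of u, folded \<kappa>_def]
  have "smooth_in_chart (tangent_chart A \<kappa>) T1 (\<lambda>q. tcoord \<kappa> q (X q))"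
    using X b(1) by (simp add: vector_field_def tangent_atlas_def)
  then obtain W h where W: "open W" "snd (tangent_chart A \<kappa>) (x, u) \<in> W" "smooth_on W h"
    and h: "\<forall>q\<in>T1 \<inter> fst (tangent_chart A \<kappa>). snd (tangent_chart A \<kappa>) q \<in> W \<longrightarrow>
      tcoord \<kappa> q (X q) = h (snd (tangent_chart A \<kappa>) q)"
    using p b(2) unfolding smooth_in_chart_def by (elim ballE[of _ _ "(x, u)"]) auto
  have "extends_field X (x, u) (W \<inter> (snd \<kappa> ` fst \<kappa>) \<times> UNIV) h"
    unfolding extends_field_def Let_def \<kappa>_def[symmetric]
  proof (intro conjI ballI impI)
    show "open (W \<inter> (snd \<kappa> ` fst \<kappa>) \<times> UNIV)"
      using W(1) b(1) by (intro open_Int open_Times chart_open) auto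
    show "smooth_on (W \<inter> (snd \<kappa> ` fst \<kappa>) \<times> UNIV) h"
      using W(3) by (rule smooth_on_subset) simp
    show "tcoord \<kappa> q (X q) = h (snd (tangent_chart A \<kappa>) q)"
      if "q \<in> T1" "fst q \<in> fst \<kappa>" "snd (tangent_chart A \<kappa>) q \<in> W \<inter> (snd \<kappa> ` fst \<kappa>) \<times> UNIV" for q
      using h that by (cases q) auto
  qed (use W b in auto)
  then show ?thesis by blast
qed

lemma extends_fieldD:
  assumes "extends_field X p W h"
  defines "\<kappa> \<equiv> base_chart p"
  shows "open W" "snd (tangent_chart A \<kappa>) p \<in> W" "W \<subseteq> (snd \<kappa> ` fst \<kappa>) \<times> UNIV" "smooth_on W h"
    "\<And>q. q \<in> T1 \<Longrightarrow> fst q \<in> fst \<kappa> \<Longrightarrow> snd (tangent_chart A \<kappa>) q \<in> W \<Longrightarrow>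
      tcoord \<kappa> q (X q) = h (snd (tangent_chart A \<kappa>) q)"
  using assms(1) unfolding extends_field_def Let_def \<kappa>_def by blast+

lemma extends_field_at:
  assumes "extends_field X (x, u) W h" "(x, u) \<in> T1"
  shows "h (snd (tangent_chart A (base_chart (x, u))) (x, u)) = X (x, u)"
  using extends_fieldD(5)[OF assms(1,2) _ extends_fieldD(2)[OF assms(1)]]
    base_chart(2)[OF T1_carrier[OF assms(2)]] tcoord_base[OF T1_carrier[OF assms(2)], of u "X (x, u)"]
  by simp

lemma dir_deriv_local:
  fixes F :: "'e \<times> 'e \<Rightarrow> 'b::real_normed_vector"
  assumes p: "(x, u) \<in> T1" and w: "w \<in> tspace (x, u)"
  defines "\<kappa> \<equiv> base_chart (x, u)"
  assumes W: "open W" "snd (tangent_chart A \<kappa>) (x, u) \<in> W"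
    and F: "(F has_derivative F') (at (snd (tangent_chart A \<kappa>) (x, u)))"
    and f: "\<And>q. q \<in> T1 \<Longrightarrow> fst q \<in> fst \<kappa> \<Longrightarrow> snd (tangent_chart A \<kappa>) q \<in> W \<Longrightarrow>
      f q = F (snd (tangent_chart A \<kappa>) q)"
  shows "dir_deriv (tangent_atlas A) T1 f (x, u) w = F' w"
proof -
  have ct: "chart_at (tangent_atlas A) (x, u) = tangent_chart A \<kappa>"
    using base_chart(3)[OF T1_carrier[OF p]] by (simp add: \<kappa>_def)
  show ?thesis
    by (rule dir_deriv_eq[OF w W(1), of F]) (use W F f in \<open>auto simp: ct\<close>)
qed

text \<open>The chart in \<open>lie_bracket\<close> is the tangent chart of the base chart, where
  the extensions supply the directional derivatives; along tangent directions the values do not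
  depend on the extension.\<close>

lemma lie_bracket_local:
  assumes p: "(x, u) \<in> T1" and X: "extends_field X (x, u) V h" and Y: "extends_field Y (x, u) W k"
    and t: "X (x, u) \<in> tspace (x, u)" "Y (x, u) \<in> tspace (x, u)"
  defines "z \<equiv> snd (tangent_chart A (base_chart (x, u))) (x, u)"
  shows "lie_bracket (tangent_atlas A) T1 X Y (x, u) =
    frechet_derivative k (at z) (X (x, u)) - frechet_derivative h (at z) (Y (x, u))"
proof -
  have ct: "chart_at (tangent_atlas A) (x, u) = tangent_chart A (base_chart (x, u))"
    using base_chart(3)[OF T1_carrier[OF p]] .
  show ?thesis
    unfolding lie_bracket_def ct z_def
    by (intro arg_cong2[where f = minus]
        dir_deriv_local[OF p t(1) extends_fieldD(1,2)[OF Y]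
          smooth_on_has_derivative[OF extends_fieldD(4,2)[OF Y]] extends_fieldD(5)[OF Y]]
        dir_deriv_local[OF p t(2) extends_fieldD(1,2)[OF X]
          smooth_on_has_derivative[OF extends_fieldD(4,2)[OF X]] extends_fieldD(5)[OF X]])
qed

text \<open>Differentiating the tangency condition of a field \<open>X\<close> along \<open>T1\<close>.\<close>

lemma level_second_derivative:
  assumes X: "vector_field (tangent_atlas A) T1 X" and p: "(x, u) \<in> T1"
    and h: "extends_field X (x, u) W h" and w: "w \<in> tspace (x, u)"
  defines "\<kappa> \<equiv> base_chart (x, u)"
  defines "z \<equiv> snd (tangent_chart A \<kappa>) (x, u)"
  shows "frechet_derivative (\<lambda>z. frechet_derivative (level \<kappa>) (at z) (X (x, u))) (at z) w =
    - frechet_derivative (level \<kappa>) (at z) (frechet_derivative h (at z) w)"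
proof -
  note b = base_chart[OF T1_carrier[OF p], of u, folded \<kappa>_def]
  note h' = extends_fieldD[OF h, folded \<kappa>_def, folded z_def]
  have lev: "smooth_on W (level \<kappa>)"
    by (rule smooth_on_subset[OF level_smooth[OF b(1)] h'(3)])
  have hz: "h z = X (x, u)"
    using extends_field_at[OF h p] by (simp add: z_def \<kappa>_def)
  have D: "((\<lambda>z. frechet_derivative (level \<kappa>) (at z) (h z)) has_derivative
      (\<lambda>w. frechet_derivative (\<lambda>z. frechet_derivative (level \<kappa>) (at z) (X (x, u))) (at z) w
         + frechet_derivative (level \<kappa>) (at z) (frechet_derivative h (at z) w))) (at z)"
    by (rule has_derivative_linear_apply[OF h'(1,2) smooth_on_linear_derivative[OF lev]
          smooth_on_has_derivative[OF smooth_on_frechet_derivative[OF lev] h'(2)]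
          smooth_on_has_derivative[OF h'(4,2)], unfolded hz])
  have zero: "0 = frechet_derivative (level \<kappa>) (at (snd (tangent_chart A \<kappa>) q)) (h (snd (tangent_chart A \<kappa>) q))"
    if q: "q \<in> T1" "fst q \<in> fst \<kappa>" "snd (tangent_chart A \<kappa>) q \<in> W" for q
  proof -
    obtain y v where yv: "q = (y, v)" by (cases q)
    have "tcoord \<kappa> q (X q) = h (snd (tangent_chart A \<kappa>) q)" using q by (rule h'(5))
    then have "frechet_derivative (level \<kappa>) (at (snd (tangent_chart A \<kappa>) q)) (h (snd (tangent_chart A \<kappa>) q))
      = 2 * g y (vpart (y, v) (X (y, v))) v"
      using level_derivative_tcoord[OF b(1), of y v "X (y, v)"] q yv by simp
    moreover have "g y (vpart (y, v) (X (y, v))) v = 0"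
      using X q yv by (auto simp: vector_field_iff)
    ultimately show ?thesis by simp
  qed
  \<comment> \<open>The zero function on \<open>T1\<close> has two extensions, the tangency
    expression above and the constant 0; its derivative along the tangent vector \<open>w\<close> is
    computed from both.\<close>
  have "dir_deriv (tangent_atlas A) T1 (\<lambda>_. 0 :: real) (x, u) w
    = frechet_derivative (\<lambda>z. frechet_derivative (level \<kappa>) (at z) (X (x, u))) (at z) w
         + frechet_derivative (level \<kappa>) (at z) (frechet_derivative h (at z) w)"
    by (rule dir_deriv_local[OF p w, folded \<kappa>_def, folded z_def, OF h'(1,2) D zero])
  moreover have "dir_deriv (tangent_atlas A) T1 (\<lambda>_. 0 :: real) (x, u) w = 0"
    by (rule dir_deriv_local[OF p w open_UNIV UNIV_I has_derivative_const]) simp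
  ultimately show ?thesis by linarith
qed

text \<open>With \<open>level_second_derivative\<close> applied to each field along the other, the
  differential of \<open>level\<close> on the bracket is a difference of mixed second derivatives,
  hence 0. This is what permits evaluating \<eta> on the bracket.\<close>

lemma lie_bracket_tangent:
  assumes X: "vector_field (tangent_atlas A) T1 X" and Y: "vector_field (tangent_atlas A) T1 Y"
    and p: "(x, u) \<in> T1"
  shows "lie_bracket (tangent_atlas A) T1 X Y (x, u) \<in> tspace (x, u)"
proof -
  define \<kappa> where "\<kappa> = base_chart (x, u)"
  define z where "z = snd (tangent_chart A \<kappa>) (x, u)"
  note b = base_chart[OF T1_carrier[OF p], of u, folded \<kappa>_def]
  obtain V h W k where h: "extends_field X (x, u) V h" and k: "extends_field Y (x, u) W k"
    using ex_extends_field X Y p by blast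
  have t: "X (x, u) \<in> tspace (x, u)" "Y (x, u) \<in> tspace (x, u)"
    using X Y p by (auto simp: vector_field_def)
  have z: "z = (snd \<kappa> x, coord A \<kappa> x u)" by (simp add: z_def)
  note lb = lie_bracket_local[OF p h k t, folded \<kappa>_def, folded z_def]
  have lin: "linear (frechet_derivative (level \<kappa>) (at z))"
    unfolding z by (rule smooth_on_linear_derivative[OF level_smooth[OF b(1)]]) (use b in auto)
  have "frechet_derivative (level \<kappa>) (at z) (lie_bracket (tangent_atlas A) T1 X Y (x, u)) =
     frechet_derivative (\<lambda>z. frechet_derivative (level \<kappa>) (at z) (X (x, u))) (at z) (Y (x, u)) -
     frechet_derivative (\<lambda>z. frechet_derivative (level \<kappa>) (at z) (Y (x, u))) (at z) (X (x, u))"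
    unfolding lb linear_diff[OF lin]
    using level_second_derivative[OF X p h t(2)] level_second_derivative[OF Y p k t(1)]
    by (simp add: \<kappa>_def z_def)
  also have "\<dots> = 0"
    using second_derivative_symmetric[OF level_smooth[OF b(1)], of z "X (x, u)" "Y (x, u)"] b
      open_Times[OF chart_open[OF b(1)] open_UNIV] by (simp add: z)
  finally have "g x (vpart (x, u) (lie_bracket (tangent_atlas A) T1 X Y (x, u))) u = 0"
    using level_derivative_tcoord[OF b(1,2), of u "lie_bracket (tangent_atlas A) T1 X Y (x, u)"]
      tcoord_base[OF T1_carrier[OF p], of u] by (simp add: z \<kappa>_def)
  then show ?thesis using tspace_iff[OF p] by simp
qed

text \<open>The form pairs the horizontal part with the tautological vector \<open>u\<close>, whose
  covariant derivative along \<open>w\<close> is the vertical part of \<open>w\<close>. The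
  Christoffel term completes the derivative of the horizontal component to a covariant one.\<close>

lemma dir_deriv_one_form:
  assumes \<eta>: "\<And>x u w. (x, u) \<in> T1 \<Longrightarrow> w \<in> tspace (x, u) \<Longrightarrow> \<eta> (x, u) w = r * g x (hpart (x, u) w) u"
    and Y: "vector_field (tangent_atlas A) T1 Y" and p: "(x, u) \<in> T1" and w: "w \<in> tspace (x, u)"
    and k: "extends_field Y (x, u) W k"
  defines "\<kappa> \<equiv> base_chart (x, u)"
  defines "z \<equiv> snd (tangent_chart A \<kappa>) (x, u)"
  shows "dir_deriv (tangent_atlas A) T1 (\<lambda>q. \<eta> q (Y q)) (x, u) w = r *
    (g x (hpart (x, u) (frechet_derivative k (at z) w)) u
      + mc \<kappa> (snd \<kappa> x) (\<Gamma> \<kappa> x (fst w) (fst (Y (x, u)))) (coord A \<kappa> x u)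
      + g x (hpart (x, u) (Y (x, u))) (vpart (x, u) w))"
proof -
  note b = base_chart[OF T1_carrier[OF p], of u, folded \<kappa>_def]
  note k' = extends_fieldD[OF k, folded \<kappa>_def, folded z_def]
  have z: "z = (snd \<kappa> x, coord A \<kappa> x u)" by (simp add: z_def)
  have kz: "k z = Y (x, u)" using extends_field_at[OF k p] by (simp add: z_def \<kappa>_def)
  have tb: "tcoord \<kappa> (x, u) v = v" for v using tcoord_base[OF T1_carrier[OF p]] by (simp add: \<kappa>_def)
  note parts = coord_parts[OF b(1,2), of u, unfolded tb]
  have "(k has_derivative frechet_derivative k (at z)) (at z)"
    by (rule smooth_on_has_derivative[OF k'(4,2)])
  from has_derivative_fst[OF this]
  have fk: "((\<lambda>z. fst (k z)) has_derivative (\<lambda>d. fst (frechet_derivative k (at z) d))) (at z)" .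
  have D: "((\<lambda>z. r * mc \<kappa> (fst z) (fst (k z)) (snd z)) has_derivative (\<lambda>d. r *
      (mc \<kappa> (snd \<kappa> x) (fst (frechet_derivative k (at z) d) + \<Gamma> \<kappa> x (fst d) (fst (k z))) (snd z)
     + mc \<kappa> (snd \<kappa> x) (fst (k z)) (snd d + \<Gamma> \<kappa> x (fst d) (snd z))))) (at z)"
    unfolding z
    by (rule has_derivative_mult_right[OF mc_has_derivative[OF b(1,2) fk[unfolded z]
            has_derivative_snd[OF has_derivative_ident]]])
  have "\<eta> q (Y q) = r * mc \<kappa> (fst (snd (tangent_chart A \<kappa>) q))
      (fst (k (snd (tangent_chart A \<kappa>) q))) (snd (snd (tangent_chart A \<kappa>) q))"
    if q: "q \<in> T1" "fst q \<in> fst \<kappa>" "snd (tangent_chart A \<kappa>) q \<in> W" for q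
  proof -
    obtain y v where yv: "q = (y, v)" by (cases q)
    have "tcoord \<kappa> q (Y q) = k (snd (tangent_chart A \<kappa>) q)" using q by (rule k'(5))
    moreover have "Y q \<in> tspace q" using Y q by (simp add: vector_field_def)
    ultimately show ?thesis
      using \<eta>[of y v "Y q"] q coord_parts(1)[OF b(1), of y v "Y q"] mc_coord[OF b(1), of y] yv by simp metis
  qed
  note dir_deriv_local[OF p w, folded \<kappa>_def, folded z_def, OF k'(1,2) D this]
  then have "dir_deriv (tangent_atlas A) T1 (\<lambda>q. \<eta> q (Y q)) (x, u) w = r *
      (mc \<kappa> (snd \<kappa> x) (fst (frechet_derivative k (at z) w) + \<Gamma> \<kappa> x (fst w) (fst (k z))) (snd z)
     + mc \<kappa> (snd \<kappa> x) (fst (k z)) (snd w + \<Gamma> \<kappa> x (fst w) (snd z)))"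
    by simp
  also have "\<dots> = r *
    (mc \<kappa> (snd \<kappa> x) (fst (frechet_derivative k (at z) w)) (coord A \<kappa> x u)
      + mc \<kappa> (snd \<kappa> x) (\<Gamma> \<kappa> x (fst w) (fst (Y (x, u)))) (coord A \<kappa> x u)
      + mc \<kappa> (snd \<kappa> x) (fst (Y (x, u))) (snd w + \<Gamma> \<kappa> x (fst w) (coord A \<kappa> x u)))"
    using bilinear_ladd[OF bilinear_mc[OF b(1) imageI[OF b(2)]]] by (simp add: kz) (simp add: z)
  finally show ?thesis
    by (simp only: mc_coord[OF b(1,2), symmetric] parts)
qed

text \<open>The derivatives of the horizontal components form the bracket and cancel against its
  \<eta> term; the Christoffel terms cancel because the connection is torsion-free. The factor 1/2
  is that of \<open>ext_deriv\<close>.\<close>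

lemma ext_deriv_one_form:
  assumes \<eta>: "\<And>x u w. (x, u) \<in> T1 \<Longrightarrow> w \<in> tspace (x, u) \<Longrightarrow> \<eta> (x, u) w = r * g x (hpart (x, u) w) u"
    and X: "vector_field (tangent_atlas A) T1 X" and Y: "vector_field (tangent_atlas A) T1 Y"
    and p: "(x, u) \<in> T1"
  shows "ext_deriv (tangent_atlas A) T1 \<eta> X Y (x, u) = r / 2 *
    (g x (hpart (x, u) (Y (x, u))) (vpart (x, u) (X (x, u))) -
     g x (hpart (x, u) (X (x, u))) (vpart (x, u) (Y (x, u))))"
proof -
  define \<kappa> where "\<kappa> = base_chart (x, u)"
  note b = base_chart[OF T1_carrier[OF p], of u, folded \<kappa>_def]
  obtain V h W k where h: "extends_field X (x, u) V h" and k: "extends_field Y (x, u) W k"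
    using ex_extends_field X Y p by blast
  have t: "X (x, u) \<in> tspace (x, u)" "Y (x, u) \<in> tspace (x, u)"
    using X Y p by (auto simp: vector_field_def)
  note [simp] = linear_diff[OF linear_hpart[OF T1_carrier[OF p]]]
    bilinear_lsub[OF bilinear_metric[OF T1_carrier[OF p]]]
  have sym: "\<Gamma> \<kappa> x (fst (X (x, u))) (fst (Y (x, u))) = \<Gamma> \<kappa> x (fst (Y (x, u))) (fst (X (x, u)))"
    using b by (simp add: \<Gamma>_sym)
  note Y' = dir_deriv_one_form[where \<eta> = \<eta> and r = r, OF \<eta> Y p t(1) k, folded \<kappa>_def]
  note X' = dir_deriv_one_form[where \<eta> = \<eta> and r = r, OF \<eta> X p t(2) h, folded \<kappa>_def]
  have br: "\<eta> (x, u) (lie_bracket (tangent_atlas A) T1 X Y (x, u)) =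
      r * g x (hpart (x, u) (lie_bracket (tangent_atlas A) T1 X Y (x, u))) u"
    by (rule \<eta>[OF p lie_bracket_tangent[OF X Y p]])
  show ?thesis
    unfolding ext_deriv_def br
    unfolding lie_bracket_local[OF p h k t, folded \<kappa>_def]
    by (subst Y', assumption, assumption, subst X', assumption, assumption)
      (simp add: sym field_simps)
qed

end

section \<open>The structure tensors in terms of horizontal and vertical parts\<close>

text \<open>The formulas on tangential lifts are recorded with \<open>g x Y u = 0\<close> already
  inserted. Lemmas that rely on \<open>a + c + d \<noteq> 0\<close> state it explicitly, since it
  has to be derived in one of the two directions.\<close>

locale g_natural_structure = riemannian A g \<Gamma>
  for A :: "('p, 'e::euclidean_space) chart set"
    and g :: "'p \<Rightarrow> 'e \<Rightarrow> 'e \<Rightarrow> real"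
    and \<Gamma> :: "('p, 'e) chart \<Rightarrow> 'p \<Rightarrow> 'e \<Rightarrow> 'e \<Rightarrow> 'e" +
  fixes a b c d \<alpha> \<rho> :: real
    and G :: "'p \<times> 'e \<Rightarrow> 'e \<times> 'e \<Rightarrow> 'e \<times> 'e \<Rightarrow> real"
    and \<xi> :: "'p \<times> 'e \<Rightarrow> 'e \<times> 'e"
    and \<eta> :: "'p \<times> 'e \<Rightarrow> 'e \<times> 'e \<Rightarrow> real"
    and \<phi> :: "'p \<times> 'e \<Rightarrow> 'e \<times> 'e \<Rightarrow> 'e \<times> 'e"
  assumes g_natural: "g_natural_metric A g \<Gamma> a b c d G"
    and \<alpha>_def: "\<alpha> = a * (a + c) - b\<^sup>2" and \<rho>_pos: "\<rho> > 0"
    and \<xi>_eq: "(x, u) \<in> T1 \<Longrightarrow> \<xi> (x, u) = \<rho> *\<^sub>R hlift A \<Gamma> (x, u) u"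
    and \<eta>_lin: "p \<in> T1 \<Longrightarrow> lin_on (tspace p) (\<eta> p)"
    and \<eta>_hlift: "(x, u) \<in> T1 \<Longrightarrow> \<eta> (x, u) (hlift A \<Gamma> (x, u) X) = 1 / \<rho> * g x X u"
    and \<eta>_tlift: "(x, u) \<in> T1 \<Longrightarrow> g x Y u = 0 \<Longrightarrow> \<eta> (x, u) (tlift A g \<Gamma> a b c d (x, u) Y) = 0"
    and \<phi>_lin: "p \<in> T1 \<Longrightarrow> lin_on (tspace p) (\<phi> p)"
    and \<phi>_hlift: "(x, u) \<in> T1 \<Longrightarrow> \<phi> (x, u) (hlift A \<Gamma> (x, u) X) =
             (1 / (2 * \<rho> * \<alpha>)) *\<^sub>R
               (- b *\<^sub>R hlift A \<Gamma> (x, u) X + (a + c) *\<^sub>R tlift A g \<Gamma> a b c d (x, u) X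
                + (b * d / (a + c + d) * g x X u) *\<^sub>R hlift A \<Gamma> (x, u) u)"
    and \<phi>_tlift: "(x, u) \<in> T1 \<Longrightarrow> g x Y u = 0 \<Longrightarrow> \<phi> (x, u) (tlift A g \<Gamma> a b c d (x, u) Y) =
             (1 / (2 * \<rho> * \<alpha>)) *\<^sub>R
               (- a *\<^sub>R hlift A \<Gamma> (x, u) Y + b *\<^sub>R tlift A g \<Gamma> a b c d (x, u) Y)"
begin

lemma tlift_eq:
  assumes "x \<in> carrier A"
  shows "tlift A g \<Gamma> a b c d (x, u) X =
    vlift A (x, u) (perp (x, u) X) + (b / (a + c + d) * g x X u) *\<^sub>R hlift A \<Gamma> (x, u) u"
  by (simp add: tlift_def perp_def linear_diff[OF linear_vlift[OF assms]] linear_scale[OF linear_vlift[OF assms]])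

text \<open>Tangential and vertical lifts agree on vectors orthogonal to \<open>u\<close>, so \<eta>
  vanishes on the vertical part of a tangent vector.\<close>

lemma \<eta>_eq:
  assumes p: "(x, u) \<in> T1" and w: "w \<in> tspace (x, u)"
  shows "\<eta> (x, u) w = 1 / \<rho> * g x (hpart (x, u) w) u"
proof -
  have Y: "g x (vpart (x, u) w) u = 0" using w p by (simp add: tspace_iff)
  have "\<eta> (x, u) (hlift A \<Gamma> (x, u) (hpart (x, u) w) + vlift A (x, u) (vpart (x, u) w))
    = 1 / \<rho> * g x (hpart (x, u) w) u + \<eta> (x, u) (vlift A (x, u) (vpart (x, u) w))"
    using \<eta>_lin[OF p] hlift_mem_tspace[OF p] vlift_mem_tspace[OF p Y] \<eta>_hlift[OF p]
    by (simp add: lin_on_def)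
  moreover have "\<eta> (x, u) (vlift A (x, u) (vpart (x, u) w)) = 0"
    using \<eta>_tlift[OF p Y] tlift_eq[OF T1_carrier[OF p]] Y by (simp add: perp_id)
  ultimately show ?thesis
    by (simp add: lift_parts[OF T1_carrier[OF p]])
qed

text \<open>The vertical part of a tangent vector is orthogonal to \<open>u\<close>, so the three
  prescribed blocks and bilinearity determine \<open>G\<close> on all tangent vectors.\<close>

lemma G_eq:
  assumes p: "(x, u) \<in> T1" and w: "w \<in> tspace (x, u)" and w': "w' \<in> tspace (x, u)"
  defines "X \<equiv> hpart (x, u) w" and "Y \<equiv> vpart (x, u) w"
    and "X' \<equiv> hpart (x, u) w'" and "Y' \<equiv> vpart (x, u) w'"
  shows "G (x, u) w w' = (a + c) * g x X X' + d * g x X u * g x X' u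
    + b * (g x X Y' + g x Y X') + a * g x Y Y'"
proof -
  let ?H = "hlift A \<Gamma> (x, u)" and ?V = "vlift A (x, u)"
  have Y: "g x Y u = 0" "g x Y' u = 0" using w w' p by (simp_all add: tspace_iff Y_def Y'_def)
  have G: "sym_bilin_on (tspace (x, u)) (G (x, u))"
    and HH: "\<And>X X'. G (x, u) (?H X) (?H X') = (a + c) * g x X X' + d * g x X u * g x X' u"
    and HV: "\<And>X Y. g x Y u = 0 \<Longrightarrow> G (x, u) (?H X) (?V Y) = b * g x X Y"
    and VV: "\<And>Y Y'. g x Y u = 0 \<Longrightarrow> g x Y' u = 0 \<Longrightarrow> G (x, u) (?V Y) (?V Y') = a * g x Y Y'"
    using g_natural p by (auto simp: g_natural_metric_def)
  have add: "G (x, u) v (s + t) = G (x, u) v s + G (x, u) v t"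
    and sym: "G (x, u) v s = G (x, u) s v"
    if "v \<in> tspace (x, u)" "s \<in> tspace (x, u)" "t \<in> tspace (x, u)" for v s t
    using G that unfolding sym_bilin_on_def lin_on_def by blast+
  note mem = hlift_mem_tspace[OF p] vlift_mem_tspace[OF p Y(1)] vlift_mem_tspace[OF p Y(2)]
    lift_mem_tspace[OF p Y(1)] lift_mem_tspace[OF p Y(2)]
  have *: "w = ?H X + ?V Y" "w' = ?H X' + ?V Y'"
    by (simp_all add: X_def Y_def X'_def Y'_def lift_parts[OF T1_carrier[OF p]])
  have "G (x, u) w w' = G (x, u) w (?H X') + G (x, u) w (?V Y')"
    unfolding *(2) using w mem by (intro add) auto
  also have "\<dots> = G (x, u) (?H X') (?H X + ?V Y) + G (x, u) (?V Y') (?H X + ?V Y)"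
    unfolding *(1) using mem by (intro arg_cong2[where f = plus] sym) auto
  also have "\<dots> = (G (x, u) (?H X') (?H X) + G (x, u) (?H X') (?V Y))
      + (G (x, u) (?V Y') (?H X) + G (x, u) (?V Y') (?V Y))"
    using mem by (intro arg_cong2[where f = plus] add) auto
  also have "G (x, u) (?V Y') (?H X) = G (x, u) (?H X) (?V Y')"
    using mem by (intro sym) auto
  finally show ?thesis
    using Y metric_sym[OF T1_carrier[OF p], of X' X] metric_sym[OF T1_carrier[OF p], of X' Y]
      metric_sym[OF T1_carrier[OF p], of Y' Y]
    by (simp add: HH HV VV algebra_simps)
qed

definition k :: real where "k = 1 / (2 * \<rho> * \<alpha>)"

text \<open>For nonzero a + c + d the three contributions along the lift of \<open>u\<close> cancel.
  In the other case the quotients are 0 and one contribution survives; it is kept because a + c + d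
  is shown to be nonzero only later, with the help of this lemma.\<close>

lemma \<phi>_u:
  assumes p: "(x, u) \<in> T1"
  shows "\<phi> (x, u) (hlift A \<Gamma> (x, u) u) = (if a + c + d = 0 then - k * b else 0) *\<^sub>R hlift A \<Gamma> (x, u) u"
proof -
  \<comment> \<open>\<open>N\<close> stands for a + c + d, so \<open>N - d\<close> is a + c.\<close>
  have coeff: "k * (- b + (N - d) * (b / N) + b * d / N) = (if N = 0 then - k * b else 0)" for N
    by (cases "N = 0") (simp_all add: field_simps)
  have "perp (x, u) u = 0" using T1_unit[OF p] by (simp add: perp_def)
  then have "\<phi> (x, u) (hlift A \<Gamma> (x, u) u) = (k * (- b + (a + c) * (b / (a + c + d)) + b * d / (a + c + d)))
      *\<^sub>R hlift A \<Gamma> (x, u) u"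
    using T1_unit[OF p] unfolding \<phi>_hlift[OF p] tlift_eq[OF T1_carrier[OF p]] k_def[symmetric]
    by (simp add: linear_0[OF linear_vlift[OF T1_carrier[OF p]]] algebra_simps)
  also have "k * (- b + (a + c) * (b / (a + c + d)) + b * d / (a + c + d)) =
      (if a + c + d = 0 then - k * b else 0)"
    using coeff[of "a + c + d"] by simp
  finally show ?thesis .
qed

text \<open>By \<open>\<phi>_u\<close> the component along \<open>u\<close> is annihilated; on the
  complement tangential lifts are vertical lifts, so the prescribed values become a matrix acting on
  the pair (X, Y).\<close>

lemma \<phi>_parts:
  assumes p: "(x, u) \<in> T1" and w: "w \<in> tspace (x, u)" and N: "a + c + d \<noteq> 0"
  defines "X \<equiv> perp (x, u) (hpart (x, u) w)" and "Y \<equiv> vpart (x, u) w"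
  shows "hpart (x, u) (\<phi> (x, u) w) = k *\<^sub>R (- b *\<^sub>R X - a *\<^sub>R Y)"
    and "vpart (x, u) (\<phi> (x, u) w) = k *\<^sub>R ((a + c) *\<^sub>R X + b *\<^sub>R Y)"
proof -
  let ?H = "hlift A \<Gamma> (x, u)" and ?V = "vlift A (x, u)"
  define s where "s = g x (hpart (x, u) w) u"
  note x = T1_carrier[OF p]
  note lin = linear_add[OF linear_hlift[OF x]] linear_scale[OF linear_hlift[OF x]]
    linear_add[OF linear_vlift[OF x]] linear_scale[OF linear_vlift[OF x]]
  have Y: "g x Y u = 0" using w p by (simp add: tspace_iff Y_def)
  have X: "g x X u = 0" by (simp add: X_def metric_perp[OF p])
  have w_eq: "w = (?H X + s *\<^sub>R ?H u) + ?V Y"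
    using lift_parts[OF x, of u w]
    by (simp add: lin[symmetric] X_def Y_def perp_def s_def)
  note mem = hlift_mem_tspace[OF p] vlift_mem_tspace[OF p Y]
  have add: "\<phi> (x, u) (v + t) = \<phi> (x, u) v + \<phi> (x, u) t"
    and scale: "\<phi> (x, u) (r *\<^sub>R v) = r *\<^sub>R \<phi> (x, u) v"
    if "v \<in> tspace (x, u)" "t \<in> tspace (x, u)" for v t r
    using \<phi>_lin[OF p] that unfolding lin_on_def by blast+
  have "?H X + s *\<^sub>R ?H u = ?H (X + s *\<^sub>R u)" by (simp add: lin)
  then have "\<phi> (x, u) w = \<phi> (x, u) (?H X + s *\<^sub>R ?H u) + \<phi> (x, u) (?V Y)"
    unfolding w_eq using mem by (intro add) auto
  also have "\<phi> (x, u) (?H X + s *\<^sub>R ?H u) = \<phi> (x, u) (?H X) + \<phi> (x, u) (?H (s *\<^sub>R u))"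
    unfolding lin(2)[symmetric] using mem by (intro add) auto
  also have "\<phi> (x, u) (?H (s *\<^sub>R u)) = s *\<^sub>R \<phi> (x, u) (?H u)"
    unfolding lin(2) using mem by (intro scale) auto
  also have "\<dots> = 0" using N by (simp add: \<phi>_u[OF p])
  finally have "\<phi> (x, u) w = \<phi> (x, u) (?H X) + \<phi> (x, u) (?V Y)" by simp
  moreover have "\<phi> (x, u) (?H X) = k *\<^sub>R (- b *\<^sub>R ?H X + (a + c) *\<^sub>R ?V X)"
    unfolding \<phi>_hlift[OF p] tlift_eq[OF x] k_def X perp_id[OF X] by simp
  moreover have "\<phi> (x, u) (?V Y) = k *\<^sub>R (- a *\<^sub>R ?H Y + b *\<^sub>R ?V Y)"
    using \<phi>_tlift[OF p Y] unfolding tlift_eq[OF x] k_def Y perp_id[OF Y] by simp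
  ultimately have e: "\<phi> (x, u) w = k *\<^sub>R (- b *\<^sub>R ?H X + (a + c) *\<^sub>R ?V X)
      + k *\<^sub>R (- a *\<^sub>R ?H Y + b *\<^sub>R ?V Y)" by simp
  note lp = linear_add[OF linear_hpart[OF x]] linear_scale[OF linear_hpart[OF x]]
    linear_add[OF linear_vpart[OF x]] linear_scale[OF linear_vpart[OF x]]
    linear_neg[OF linear_hpart[OF x]] linear_neg[OF linear_vpart[OF x]]
    linear_diff[OF linear_hpart[OF x]] linear_diff[OF linear_vpart[OF x]]
  show "hpart (x, u) (\<phi> (x, u) w) = k *\<^sub>R (- b *\<^sub>R X - a *\<^sub>R Y)"
    "vpart (x, u) (\<phi> (x, u) w) = k *\<^sub>R ((a + c) *\<^sub>R X + b *\<^sub>R Y)"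
    unfolding e using x by (simp_all add: lp algebra_simps)
qed

lemma \<phi>_tspace:
  assumes p: "(x, u) \<in> T1" and w: "w \<in> tspace (x, u)" and N: "a + c + d \<noteq> 0"
  shows "\<phi> (x, u) w \<in> tspace (x, u)" "g x (hpart (x, u) (\<phi> (x, u) w)) u = 0"
  using w T1_carrier[OF p] metric_perp[OF p]
  by (simp_all add: tspace_iff p \<phi>_parts[OF p w N] metric_linear_simps)

lemma \<xi>_tspace:
  assumes p: "(x, u) \<in> T1"
  shows "\<xi> (x, u) \<in> tspace (x, u)" "hpart (x, u) (\<xi> (x, u)) = \<rho> *\<^sub>R u" "vpart (x, u) (\<xi> (x, u)) = 0"
  using T1_carrier[OF p] hlift_mem_tspace[OF p, of "\<rho> *\<^sub>R u"]
  by (simp_all add: \<xi>_eq[OF p] linear_scale[OF linear_hlift[OF T1_carrier[OF p]], symmetric])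

lemma \<eta>_\<xi>: "(x, u) \<in> T1 \<Longrightarrow> \<eta> (x, u) (\<xi> (x, u)) = 1"
  using \<rho>_pos T1_carrier[of x u] by (simp add: \<eta>_eq \<xi>_tspace metric_linear_simps T1_unit)

text \<open>A trace-free matrix of order 2 squares to minus its determinant, here \<alpha> before
  scaling by \<open>k\<close>. Images under \<phi> have horizontal part orthogonal to
  \<open>u\<close>, so the second application involves no projection.\<close>

lemma \<phi>_\<phi>:
  assumes p: "(x, u) \<in> T1" and w: "w \<in> tspace (x, u)" and N: "a + c + d \<noteq> 0"
  shows "hpart (x, u) (\<phi> (x, u) (\<phi> (x, u) w)) = - (k\<^sup>2 * \<alpha>) *\<^sub>R perp (x, u) (hpart (x, u) w)"
    and "vpart (x, u) (\<phi> (x, u) (\<phi> (x, u) w)) = - (k\<^sup>2 * \<alpha>) *\<^sub>R vpart (x, u) w"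
proof -
  \<comment> \<open>\<open>k\<close> depends on \<alpha>; the name \<open>r\<close> shields that
    occurrence while \<alpha> is expanded everywhere else.\<close>
  define r where "r = k"
  show "hpart (x, u) (\<phi> (x, u) (\<phi> (x, u) w)) = - (k\<^sup>2 * \<alpha>) *\<^sub>R perp (x, u) (hpart (x, u) w)"
    "vpart (x, u) (\<phi> (x, u) (\<phi> (x, u) w)) = - (k\<^sup>2 * \<alpha>) *\<^sub>R vpart (x, u) w"
    unfolding \<phi>_parts[OF p \<phi>_tspace(1)[OF assms] N] perp_id[OF \<phi>_tspace(2)[OF assms]]
    unfolding \<phi>_parts[OF assms] r_def[symmetric]
    unfolding \<alpha>_def
    by (simp_all add: algebra_simps power2_eq_square)
qed

section \<open>Necessity of the two equations\<close>

text \<open>Both equations follow from the pointwise identities for \<phi> and \<open>G\<close>, so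
  a single unit vector is enough.\<close>

lemma structure_imp_constants:
  assumes "DIM('e) \<ge> 2"
    and "paracontact_metric_structure n (tangent_atlas A) T1 \<phi> \<xi> \<eta> G"
  shows "a + c + d = - 4 * \<alpha> \<and> - 4 * \<alpha> = 1 / \<rho>\<^sup>2"
proof -
  obtain x u where p: "(x, u) \<in> T1" using ex_T1 by blast
  note x = T1_carrier[OF p]
  have \<phi>2: "\<phi> (x, u) (\<phi> (x, u) w) = w - \<eta> (x, u) w *\<^sub>R \<xi> (x, u)" if "w \<in> tspace (x, u)" for w
    using assms(2) p that
    by (auto simp: paracontact_metric_structure_def almost_paracontact_structure_def)
  have cm: "G (x, u) (\<phi> (x, u) v) (\<phi> (x, u) w) = - G (x, u) v w + \<eta> (x, u) v * \<eta> (x, u) w"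
    if "v \<in> tspace (x, u)" "w \<in> tspace (x, u)" for v w
    using assms(2) p that by (auto simp: paracontact_metric_structure_def compatible_metric_def)
  let ?Hu = "hlift A \<Gamma> (x, u) u"
  have GH: "G (x, u) (hlift A \<Gamma> (x, u) (r *\<^sub>R u)) (hlift A \<Gamma> (x, u) (r *\<^sub>R u)) = r\<^sup>2 * (a + c + d)" for r
    using x T1_unit[OF p]
    by (simp add: G_eq p hlift_mem_tspace metric_linear_simps algebra_simps power2_eq_square)
  \<comment> \<open>Compatibility with both arguments the lift of \<open>u\<close>, the images taken
    from \<open>\<phi>_u\<close>. If a + c + d were 0, it would say that 1/\<rho>^2 is 0.\<close>
  have eq: "(if a + c + d = 0 then - k * b else 0)\<^sup>2 * (a + c + d) = - (a + c + d) + (1 / \<rho>)\<^sup>2"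
    using cm[OF hlift_mem_tspace[OF p, of u] hlift_mem_tspace[OF p, of u]] GH[of 1]
      GH[of "if a + c + d = 0 then - k * b else 0"] \<eta>_hlift[OF p, of u] T1_unit[OF p]
    by (simp only: \<phi>_u[OF p] linear_scale[OF linear_hlift[OF x]] scaleR_one mult_1_right power2_eq_square) simp
  have N: "a + c + d \<noteq> 0"
  proof
    assume "a + c + d = 0"
    with eq \<rho>_pos show False by simp
  qed
  with eq have N': "a + c + d = 1 / \<rho>\<^sup>2"
    by (simp add: power_divide)
  \<comment> \<open>Here the dimension of M, at least 2, provides a nonzero vector orthogonal to
    \<open>u\<close> on which to evaluate the square of \<phi>.\<close>
  have "dim {Y. g x Y u = 0} \<noteq> 0"
    using dim_perp[OF p] assms(1) by simp
  then obtain Y where Y: "g x Y u = 0" "Y \<noteq> 0"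
    by (auto simp: dim_eq_0)
  have "hpart (x, u) (\<phi> (x, u) (\<phi> (x, u) (hlift A \<Gamma> (x, u) Y))) = Y"
    using \<phi>2[OF hlift_mem_tspace[OF p, of Y]] \<eta>_hlift[OF p, of Y] Y x by simp
  then have "- (k\<^sup>2 * \<alpha>) *\<^sub>R Y = 1 *\<^sub>R Y"
    using \<phi>_\<phi>(1)[OF p hlift_mem_tspace[OF p, of Y] N] Y x by (simp add: perp_id)
  then have "- (k\<^sup>2 * \<alpha>) = 1"
    using Y(2) by (metis scaleR_cancel_right)
  \<comment> \<open>With \<alpha> nonzero the denominator of \<open>k\<close> can be
    cleared.\<close>
  then have "\<alpha> \<noteq> 0" by auto
  with \<open>- (k\<^sup>2 * \<alpha>) = 1\<close> have "- 4 * \<alpha> = 1 / \<rho>\<^sup>2"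
    using \<rho>_pos by (simp add: k_def field_simps power2_eq_square)
  with N' show ?thesis by simp
qed

end

section \<open>Eigenvectors of the structure matrix\<close>

text \<open>The matrix with rows (-k b, -k a) and (k c, k b) has trace 0 and determinant -1, hence
  simple eigenvalues 1 and -1. The last conclusion says that eigenvectors with entries in a vector
  space are proportional to the scalar one. In the application \<open>c\<close> is a + c.\<close>

lemma trace_free_eigenvector:
  fixes a b c k \<epsilon> :: real
  assumes k: "k\<^sup>2 * (b\<^sup>2 - a * c) = 1" and \<epsilon>: "\<epsilon>\<^sup>2 = 1"
  obtains p q where "p \<noteq> 0 \<or> q \<noteq> 0" "k * (- b * p - a * q) = \<epsilon> * p" "k * (c * p + b * q) = \<epsilon> * q"
    "\<And>X Y :: 'v::real_vector. k *\<^sub>R (- b *\<^sub>R X - a *\<^sub>R Y) = \<epsilon> *\<^sub>R X \<Longrightarrow>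
       k *\<^sub>R (c *\<^sub>R X + b *\<^sub>R Y) = \<epsilon> *\<^sub>R Y \<Longrightarrow> q *\<^sub>R X = p *\<^sub>R Y"
proof (cases "k * b + \<epsilon> = 0 \<and> k * a = 0")
  \<comment> \<open>The pair (-k a, k b + \<epsilon>) solves the first row identically; the second
    row follows from the value of the determinant.\<close>
  case False
  have "k\<^sup>2 * b\<^sup>2 - k\<^sup>2 * (a * c) = \<epsilon>\<^sup>2" using k \<epsilon> by (simp add: algebra_simps)
  then have "k * (c * (- (k * a)) + b * (k * b + \<epsilon>)) = \<epsilon> * (k * b + \<epsilon>)"
    by (simp add: algebra_simps power2_eq_square)
  moreover have "(k * b + \<epsilon>) *\<^sub>R X = - (k * a) *\<^sub>R Y"
    if "k *\<^sub>R (- b *\<^sub>R X - a *\<^sub>R Y) = \<epsilon> *\<^sub>R X" for X Y :: 'v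
  proof -
    have "\<epsilon> *\<^sub>R X + (k * b) *\<^sub>R X = - (k * a) *\<^sub>R Y"
      unfolding that[symmetric] by (simp add: algebra_simps)
    then show ?thesis by (simp add: scaleR_add_left add.commute)
  qed
  ultimately show ?thesis
    using False by (intro that[of "- (k * a)" "k * b + \<epsilon>"]) (auto simp: algebra_simps)
next
  \<comment> \<open>The first row has become trivial, so the eigenvector is read off the second,
    which now says k c p = 2 \<epsilon> q.\<close>
  case True
  then have b: "k * b = - \<epsilon>" and a: "k * a = 0" by auto
  have "\<epsilon> \<noteq> 0" using \<epsilon> by auto
  have "(k * c) *\<^sub>R X = (2 * \<epsilon>) *\<^sub>R Y" if "k *\<^sub>R (c *\<^sub>R X + b *\<^sub>R Y) = \<epsilon> *\<^sub>R Y" for X Y :: 'v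
  proof -
    have "(k * c) *\<^sub>R X + (k * b) *\<^sub>R Y = \<epsilon> *\<^sub>R Y"
      using that by (simp add: scaleR_add_right)
    then show ?thesis unfolding b by (simp add: algebra_simps scaleR_2[symmetric])
  qed
  moreover have "k * (- b * (2 * \<epsilon>) - a * (k * c)) = - (k * b) * (2 * \<epsilon>) - (k * a) * (k * c)"
    by (simp add: algebra_simps)
  then have "k * (- b * (2 * \<epsilon>) - a * (k * c)) = \<epsilon> * (2 * \<epsilon>)"
    unfolding a b by simp
  moreover have "k * (c * (2 * \<epsilon>) + b * (k * c)) = k * c * (2 * \<epsilon>) + (k * b) * (k * c)"
    by (simp add: algebra_simps)
  then have "k * (c * (2 * \<epsilon>) + b * (k * c)) = \<epsilon> * (k * c)"
    unfolding b by simp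
  ultimately show ?thesis
    using \<open>\<epsilon> \<noteq> 0\<close> by (intro that[of "2 * \<epsilon>" "k * c"]) auto
qed

section \<open>Sufficiency: smoothness, eigenspaces, compatibility and d\<eta>\<close>

context g_natural_structure
begin

text \<open>Both parts of the image are combinations, with constant coefficients, of the vertical
  part and the projected horizontal part, so \<open>vector_field_iff\<close> applies.\<close>

lemma \<phi>_vector_field:
  assumes X: "vector_field (tangent_atlas A) T1 X" and N: "a + c + d \<noteq> 0"
  shows "vector_field (tangent_atlas A) T1 (\<lambda>q. \<phi> q (X q))"
  unfolding vector_field_iff
proof (intro conjI ballI, clarify)
  note X' = vector_field_smooth[OF X]
  show "g x (vpart (x, u) (\<phi> (x, u) (X (x, u)))) u = 0" if "(x, u) \<in> T1" for x u
    using \<phi>_tspace(1)[OF that X'(3)[OF that] N] that by (simp add: tspace_iff)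
  show "smooth_section (\<lambda>q. hpart q (\<phi> q (X q)))"
    by (rule smooth_section_cong[OF smooth_section_combination[OF smooth_perp[OF X'(1)] X'(2),
            of "- (k * b)" "- (k * a)"]])
      (use X'(3) N in \<open>auto simp: \<phi>_parts algebra_simps\<close>)
  show "smooth_section (\<lambda>q. vpart q (\<phi> q (X q)))"
    by (rule smooth_section_cong[OF smooth_section_combination[OF smooth_perp[OF X'(1)] X'(2),
            of "k * (a + c)" "k * b"]])
      (use X'(3) N in \<open>auto simp: \<phi>_parts algebra_simps\<close>)
qed

lemma \<xi>_vector_field: "vector_field (tangent_atlas A) T1 \<xi>"
  unfolding vector_field_iff
proof (intro conjI ballI, clarify)
  show "g x (vpart (x, u) (\<xi> (x, u))) u = 0" if "(x, u) \<in> T1" for x u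
    using \<xi>_tspace[OF that] that by (simp add: tspace_iff)
  show "smooth_section (\<lambda>q. hpart q (\<xi> q))"
    by (rule smooth_section_cong[OF smooth_section_scale[OF smooth_fun_const[of \<rho>] smooth_section_snd]])
      (auto simp: \<xi>_tspace)
  show "smooth_section (\<lambda>q. vpart q (\<xi> q))"
    by (rule smooth_section_cong[OF smooth_section_scale[OF smooth_fun_const[of 0] smooth_section_snd]])
      (auto simp: \<xi>_tspace)
qed

lemma \<eta>_one_form: "one_form (tangent_atlas A) T1 \<eta>"
  unfolding one_form_def
proof (intro conjI ballI allI impI)
  show "smooth_fun (\<lambda>p. \<eta> p (X p))" if "vector_field (tangent_atlas A) T1 X" for X
    by (rule smooth_fun_cong[OF smooth_fun_mult[OF smooth_fun_const[of "1 / \<rho>"]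
            smooth_fun_metric[OF vector_field_smooth(1)[OF that] smooth_section_snd]]])
      (use vector_field_smooth(3)[OF that] in \<open>auto simp: \<eta>_eq\<close>)
qed (simp add: \<eta>_lin)

lemma G_smooth:
  assumes "vector_field (tangent_atlas A) T1 X" "vector_field (tangent_atlas A) T1 Y"
  shows "smooth_fun (\<lambda>p. G p (X p) (Y p))"
proof -
  note X = vector_field_smooth[OF assms(1)] and Y = vector_field_smooth[OF assms(2)]
  have "smooth_fun (\<lambda>q. ((a + c) * g (fst q) (hpart q (X q)) (hpart q (Y q))
      + d * (g (fst q) (hpart q (X q)) (snd q) * g (fst q) (hpart q (Y q)) (snd q)))
      + (b * (g (fst q) (hpart q (X q)) (vpart q (Y q)) + g (fst q) (vpart q (X q)) (hpart q (Y q)))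
      + a * g (fst q) (vpart q (X q)) (vpart q (Y q))))"
    by (intro smooth_fun_add smooth_fun_mult smooth_fun_const smooth_fun_metric X Y smooth_section_snd)
  then show ?thesis
    by (rule smooth_fun_cong) (use X(3) Y(3) in \<open>auto simp: G_eq algebra_simps\<close>)
qed

text \<open>Images under \<phi> have horizontal part orthogonal to \<open>u\<close>, hence so do
  eigenvectors, as \<epsilon> is nonzero. The eigenspace is then a copy of the complement of
  \<open>u\<close> embedded by \<open>j\<close>, built from the scalar eigenvector (r, s).\<close>

lemma dim_eigenspace:
  assumes p: "(x, u) \<in> T1" and N: "a + c + d \<noteq> 0" and k: "k\<^sup>2 * \<alpha> = - 1" and \<epsilon>: "\<epsilon>\<^sup>2 = 1"
  shows "dim {w \<in> tspace (x, u). \<phi> (x, u) w = \<epsilon> *\<^sub>R w} = DIM('e) - 1"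
proof -
  note x = T1_carrier[OF p]
  let ?H = "hlift A \<Gamma> (x, u)" and ?V = "vlift A (x, u)"
  have k': "k\<^sup>2 * (b\<^sup>2 - a * (a + c)) = 1" using k by (simp add: \<alpha>_def algebra_simps)
  obtain r s where rs: "r \<noteq> 0 \<or> s \<noteq> 0" "k * (- b * r - a * s) = \<epsilon> * r" "k * ((a + c) * r + b * s) = \<epsilon> * s"
    "\<And>X Y :: 'e. k *\<^sub>R (- b *\<^sub>R X - a *\<^sub>R Y) = \<epsilon> *\<^sub>R X \<Longrightarrow>
       k *\<^sub>R ((a + c) *\<^sub>R X + b *\<^sub>R Y) = \<epsilon> *\<^sub>R Y \<Longrightarrow> s *\<^sub>R X = r *\<^sub>R Y"
    by (rule trace_free_eigenvector[OF k' \<epsilon>, where 'v = 'e]) (rule that)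
  define j where "j Z = ?H (r *\<^sub>R Z) + ?V (s *\<^sub>R Z)" for Z
  have j: "hpart (x, u) (j Z) = r *\<^sub>R Z" "vpart (x, u) (j Z) = s *\<^sub>R Z" for Z
    using x by (simp_all add: j_def)
  have "linear j"
    unfolding j_def by (intro linear_compose_add linear_compose[OF _ linear_hlift[OF x], unfolded o_def]
        linear_compose[OF _ linear_vlift[OF x], unfolded o_def] linear_scaleR)
  moreover have "inj j"
  proof (rule injI)
    fix Z Z' assume "j Z = j Z'"
    then have "r *\<^sub>R Z = r *\<^sub>R Z'" "s *\<^sub>R Z = s *\<^sub>R Z'" using j by metis+
    then show "Z = Z'" using rs(1) by auto
  qed
  moreover have "{w \<in> tspace (x, u). \<phi> (x, u) w = \<epsilon> *\<^sub>R w} = j ` {Z. g x Z u = 0}"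
  proof (intro equalityI subsetI)
    fix w assume w: "w \<in> {w \<in> tspace (x, u). \<phi> (x, u) w = \<epsilon> *\<^sub>R w}"
    then have wt: "w \<in> tspace (x, u)" and e: "\<phi> (x, u) w = \<epsilon> *\<^sub>R w" by auto
    define X Y where "X = hpart (x, u) w" and "Y = vpart (x, u) w"
    have Yu: "g x Y u = 0" using wt p by (simp add: tspace_iff Y_def)
    have eX: "hpart (x, u) (\<phi> (x, u) w) = \<epsilon> *\<^sub>R X" and eY: "vpart (x, u) (\<phi> (x, u) w) = \<epsilon> *\<^sub>R Y"
      by (simp_all add: e linear_scale[OF linear_hpart[OF x]] linear_scale[OF linear_vpart[OF x]] X_def Y_def)
    have "\<epsilon> \<noteq> 0" using \<epsilon> by auto
    then have Xu: "g x X u = 0"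
      using \<phi>_tspace(2)[OF p wt N] x by (simp add: eX metric_linear_simps)
    have "s *\<^sub>R X = r *\<^sub>R Y"
      using eX eY unfolding \<phi>_parts[OF p wt N] X_def[symmetric] Y_def[symmetric] perp_id[OF Xu] by (rule rs(4))
    \<comment> \<open>The preimage is found by dividing by an entry of (r, s) that is nonzero;
      proportionality of \<open>X\<close> and \<open>Y\<close> makes the other entry fit.\<close>
    define Z where "Z = (if r \<noteq> 0 then (1 / r) *\<^sub>R X else (1 / s) *\<^sub>R Y)"
    have "r *\<^sub>R Z = X"
      using rs(1) \<open>s *\<^sub>R X = r *\<^sub>R Y\<close> by (auto simp: Z_def)
    moreover have "s *\<^sub>R Z = Y"
    proof (cases "r = 0")
      case False
      have "s *\<^sub>R Z = (1 / r) *\<^sub>R (s *\<^sub>R X)" using False by (simp add: Z_def)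
      also have "\<dots> = Y" using False by (simp add: \<open>s *\<^sub>R X = r *\<^sub>R Y\<close>)
      finally show ?thesis .
    qed (use rs(1) in \<open>simp add: Z_def\<close>)
    ultimately have "w = j Z"
      by (intro parts_eqI[OF x, where u = u]) (simp_all add: j X_def Y_def)
    moreover have "g x Z u = 0" using Xu Yu x by (simp add: Z_def metric_linear_simps)
    ultimately show "w \<in> j ` {Z. g x Z u = 0}" by blast
  next
    fix w assume "w \<in> j ` {Z. g x Z u = 0}"
    then obtain Z where Z: "g x Z u = 0" "w = j Z" by auto
    have wt: "w \<in> tspace (x, u)" using Z p x by (simp add: tspace_iff j metric_linear_simps)
    have pr: "perp (x, u) (r *\<^sub>R Z) = r *\<^sub>R Z" using Z x by (intro perp_id) (simp add: metric_linear_simps)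
    have w: "hpart (x, u) w = r *\<^sub>R Z" "vpart (x, u) w = s *\<^sub>R Z"
      by (simp_all add: Z(2) j)
    have e: "k *\<^sub>R (- b *\<^sub>R r *\<^sub>R Z - a *\<^sub>R s *\<^sub>R Z) = (k * (- b * r - a * s)) *\<^sub>R Z"
      "k *\<^sub>R ((a + c) *\<^sub>R r *\<^sub>R Z + b *\<^sub>R s *\<^sub>R Z) = (k * ((a + c) * r + b * s)) *\<^sub>R Z"
      by (simp_all add: algebra_simps)
    have "\<phi> (x, u) w = \<epsilon> *\<^sub>R w"
    proof (rule parts_eqI[OF x])
      show "hpart (x, u) (\<phi> (x, u) w) = hpart (x, u) (\<epsilon> *\<^sub>R w)"
        unfolding \<phi>_parts[OF p wt N] linear_scale[OF linear_hpart[OF x]] w pr e rs by simp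
      show "vpart (x, u) (\<phi> (x, u) w) = vpart (x, u) (\<epsilon> *\<^sub>R w)"
        unfolding \<phi>_parts[OF p wt N] linear_scale[OF linear_vpart[OF x]] w pr e rs by simp
    qed
    then show "w \<in> {w \<in> tspace (x, u). \<phi> (x, u) w = \<epsilon> *\<^sub>R w}" using wt by simp
  qed
  ultimately show ?thesis
    using dim_perp[OF p] dim_image_eq[of j "{Z. g x Z u = 0}"] by (simp add: inj_on_subset)
qed

lemma constants_imp_structure:
  assumes DIM: "DIM('e) = n + 1" and nondeg: "nondegenerate (tangent_atlas A) T1 G"
    and N: "a + c + d = - 4 * \<alpha>" and \<alpha>: "- 4 * \<alpha> = 1 / \<rho>\<^sup>2"
  shows "paracontact_metric_structure n (tangent_atlas A) T1 \<phi> \<xi> \<eta> G"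
proof -
  have "\<alpha> \<noteq> 0" using \<alpha> \<rho>_pos by auto
  then have N0: "a + c + d \<noteq> 0" using N by simp
  \<comment> \<open>The equation for \<alpha> yields k^2 \<alpha> = -1, used for the square of
    \<phi> and for compatibility; k \<alpha> = 1/(2 \<rho>) is the normalisation of
    \<open>k\<close>, used for d\<eta>.\<close>
  have "\<alpha> * (4 * \<rho>\<^sup>2) = - 1" using \<alpha> \<rho>_pos by (simp add: field_simps)
  then have k2: "k\<^sup>2 * \<alpha> = - 1" and k1: "k * \<alpha> = 1 / (2 * \<rho>)"
    using \<open>\<alpha> \<noteq> 0\<close> \<rho>_pos by (simp_all add: k_def field_simps power2_eq_square)
  define r where "r = k"
  have Nr: "1 / \<rho> * (1 / \<rho>) = a + c + d" using N \<alpha> by (simp add: power2_eq_square)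
  have "almost_paracontact_structure n (tangent_atlas A) T1 \<phi> \<xi> \<eta>"
    unfolding almost_paracontact_structure_def
  proof (intro conjI)
    show "embedded_submanifold (tangent_atlas A) T1 (2 * n + 1)"
      by (rule embedded_T1[OF DIM])
    show "tensor_field_1_1 (tangent_atlas A) T1 \<phi>"
      unfolding tensor_field_1_1_def using \<phi>_lin \<phi>_vector_field[OF _ N0] \<phi>_tspace(1)[OF _ _ N0] by auto
    show "\<forall>p\<in>T1. \<eta> p (\<xi> p) = 1 \<and> (\<forall>v\<in>tspace p. \<phi> p (\<phi> p v) = v - \<eta> p v *\<^sub>R \<xi> p) \<and>
        dim {v \<in> tspace p. \<phi> p v = v} = n \<and> dim {v \<in> tspace p. \<phi> p v = - v} = n"
    proof clarify
      fix x u assume p: "(x, u) \<in> T1"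
      note x = T1_carrier[OF p]
      have "\<phi> (x, u) (\<phi> (x, u) v) = v - \<eta> (x, u) v *\<^sub>R \<xi> (x, u)" if v: "v \<in> tspace (x, u)" for v
      proof (rule parts_eqI[OF x])
        show "hpart (x, u) (\<phi> (x, u) (\<phi> (x, u) v)) = hpart (x, u) (v - \<eta> (x, u) v *\<^sub>R \<xi> (x, u))"
          using \<rho>_pos unfolding \<phi>_\<phi>[OF p v N0] k2
          by (simp add: perp_def \<eta>_eq[OF p v] linear_diff[OF linear_hpart[OF x]] linear_scale[OF linear_hpart[OF x]] \<xi>_tspace[OF p])
        show "vpart (x, u) (\<phi> (x, u) (\<phi> (x, u) v)) = vpart (x, u) (v - \<eta> (x, u) v *\<^sub>R \<xi> (x, u))"
          unfolding \<phi>_\<phi>[OF p v N0] k2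
          by (simp add: linear_diff[OF linear_vpart[OF x]] linear_scale[OF linear_vpart[OF x]] \<xi>_tspace[OF p])
      qed
      then show "\<eta> (x, u) (\<xi> (x, u)) = 1 \<and>
          (\<forall>v\<in>tspace (x, u). \<phi> (x, u) (\<phi> (x, u) v) = v - \<eta> (x, u) v *\<^sub>R \<xi> (x, u)) \<and>
          dim {v \<in> tspace (x, u). \<phi> (x, u) v = v} = n \<and> dim {v \<in> tspace (x, u). \<phi> (x, u) v = - v} = n"
        using \<eta>_\<xi>[OF p] dim_eigenspace[OF p N0 k2, of 1] dim_eigenspace[OF p N0 k2, of "-1"] DIM by simp
    qed
  qed (rule \<xi>_vector_field \<eta>_one_form)+
  moreover have "compatible_metric (tangent_atlas A) T1 \<phi> \<eta> G"
    unfolding compatible_metric_def pseudo_riemannian_metric_def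
  proof (intro conjI nondeg)
    show "\<forall>p\<in>T1. sym_bilin_on (tspace p) (G p)"
      using g_natural by (auto simp: g_natural_metric_def)
    show "\<forall>X Y. vector_field (tangent_atlas A) T1 X \<longrightarrow> vector_field (tangent_atlas A) T1 Y \<longrightarrow>
        smooth_fun (\<lambda>p. G p (X p) (Y p))"
      using G_smooth by blast
    show "\<forall>p\<in>T1. \<forall>v\<in>tspace p. \<forall>w\<in>tspace p. G p (\<phi> p v) (\<phi> p w) = - G p v w + \<eta> p v * \<eta> p w"
    proof clarify
      fix x u v w assume p: "(x, u) \<in> T1" and v: "v \<in> tspace (x, u)" and w: "w \<in> tspace (x, u)"
      note x = T1_carrier[OF p]
      define X Y X' Y' where "X = perp (x, u) (hpart (x, u) v)" and "Y = vpart (x, u) v"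
        and "X' = perp (x, u) (hpart (x, u) w)" and "Y' = vpart (x, u) w"
      define s s' where "s = g x (hpart (x, u) v) u" and "s' = g x (hpart (x, u) w) u"
      have h: "hpart (x, u) v = X + s *\<^sub>R u" "hpart (x, u) w = X' + s' *\<^sub>R u"
        by (simp_all add: X_def X'_def s_def s'_def perp_def)
      have 0: "g x X u = 0" "g x X' u = 0" "g x Y u = 0" "g x Y' u = 0"
        using v w p by (simp_all add: X_def X'_def Y_def Y'_def metric_perp tspace_iff)
      note 0 = 0 0[unfolded metric_sym[OF x, of _ u]]
      have L: "G (x, u) v w = (a + c) * (g x X X' + s * s') + d * (s * s')
          + b * (g x X Y' + g x Y X') + a * g x Y Y'"
        unfolding G_eq[OF p v w] h Y_def[symmetric] Y'_def[symmetric]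
        by (simp add: metric_linear_simps x 0 T1_unit[OF p])
      \<comment> \<open>The structure matrix pulls the Gram matrix of \<open>G\<close> on the
        complement back to \<alpha> times itself before scaling; components along \<open>u\<close>
        are annihilated by \<phi>.\<close>
      have R: "G (x, u) (\<phi> (x, u) v) (\<phi> (x, u) w) = k\<^sup>2 * \<alpha> * ((a + c) * g x X X'
          + b * (g x X Y' + g x Y X') + a * g x Y Y')"
        unfolding G_eq[OF p \<phi>_tspace(1)[OF p v N0] \<phi>_tspace(1)[OF p w N0]]
          \<phi>_parts[OF p v N0] \<phi>_parts[OF p w N0]
        unfolding X_def[symmetric] Y_def[symmetric] X'_def[symmetric] Y'_def[symmetric] r_def[symmetric]
        unfolding \<alpha>_def by (simp add: metric_linear_simps x 0) (simp add: algebra_simps power2_eq_square)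
      \<comment> \<open>Since 1/\<rho>^2 = a + c + d, this product cancels the contribution of the
        components along \<open>u\<close> to \<open>G\<close>.\<close>
      have "\<eta> (x, u) v * \<eta> (x, u) w = (1 / \<rho> * (1 / \<rho>)) * (s * s')"
        by (simp add: \<eta>_eq[OF p] v w s_def s'_def)
      then show "G (x, u) (\<phi> (x, u) v) (\<phi> (x, u) w) = - G (x, u) v w + \<eta> (x, u) v * \<eta> (x, u) w"
        unfolding L R Nr k2 by (simp add: algebra_simps)
    qed
  qed
  moreover have "ext_deriv (tangent_atlas A) T1 \<eta> X Y p = G p (X p) (\<phi> p (Y p))"
    if XY: "vector_field (tangent_atlas A) T1 X" "vector_field (tangent_atlas A) T1 Y" and "p \<in> T1" for X Y p
  proof -
    obtain x u where xu: "p = (x, u)" by (cases p)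
    with \<open>p \<in> T1\<close> have p: "(x, u) \<in> T1" by simp
    note x = T1_carrier[OF p]
    note t = vector_field_smooth(3)[OF XY(1) p] vector_field_smooth(3)[OF XY(2) p]
    define X\<^sub>1 X\<^sub>2 Y\<^sub>1 Y\<^sub>2 where "X\<^sub>1 = hpart (x, u) (X (x, u))" and "X\<^sub>2 = vpart (x, u) (X (x, u))"
      and "Y\<^sub>1 = perp (x, u) (hpart (x, u) (Y (x, u)))" and "Y\<^sub>2 = vpart (x, u) (Y (x, u))"
    define s where "s = g x (hpart (x, u) (Y (x, u))) u"
    have h: "hpart (x, u) (Y (x, u)) = Y\<^sub>1 + s *\<^sub>R u"
      by (simp add: Y\<^sub>1_def s_def perp_def)
    have 0: "g x X\<^sub>2 u = 0" "g x Y\<^sub>1 u = 0" "g x Y\<^sub>2 u = 0"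
      using t p by (simp_all add: X\<^sub>2_def Y\<^sub>1_def Y\<^sub>2_def metric_perp tspace_iff)
    have "ext_deriv (tangent_atlas A) T1 \<eta> X Y (x, u) = 1 / (2 * \<rho>) * (g x X\<^sub>2 Y\<^sub>1 - g x X\<^sub>1 Y\<^sub>2)"
      by (subst ext_deriv_one_form[where r = "1 / \<rho>", OF _ XY p], rule \<eta>_eq, assumption, assumption)
        (simp add: h X\<^sub>1_def[symmetric] X\<^sub>2_def[symmetric] Y\<^sub>2_def[symmetric] metric_linear_simps x 0
          metric_sym[OF x, of u X\<^sub>2] metric_sym[OF x, of Y\<^sub>1 X\<^sub>2])
    \<comment> \<open>The coefficient of d\<eta> is the normalisation of \<open>k\<close>. The Gram
      matrix times the structure matrix is \<alpha> times an antisymmetric matrix, so the two sides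
      match without a new equation for the constants.\<close>
    also have "\<dots> = k * \<alpha> * (g x X\<^sub>2 Y\<^sub>1 - g x X\<^sub>1 Y\<^sub>2)" by (simp add: k1)
    also have "\<dots> = G (x, u) (X (x, u)) (\<phi> (x, u) (Y (x, u)))"
      unfolding G_eq[OF p t(1) \<phi>_tspace(1)[OF p t(2) N0]] \<phi>_parts[OF p t(2) N0]
      unfolding X\<^sub>1_def[symmetric] X\<^sub>2_def[symmetric] Y\<^sub>1_def[symmetric] Y\<^sub>2_def[symmetric] r_def[symmetric]
      unfolding \<alpha>_def by (simp add: metric_linear_simps x 0) (simp add: algebra_simps power2_eq_square)
    finally show ?thesis by (simp add: xu)
  qed
  ultimately show ?thesis
    unfolding paracontact_metric_structure_def by blast
qed

end

theorem theorem1: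
  fixes n :: nat
    and A :: "('p, 'e::euclidean_space) chart set"
    and g :: "'p \<Rightarrow> 'e \<Rightarrow> 'e \<Rightarrow> real"
    and \<Gamma> :: "('p, 'e) chart \<Rightarrow> 'p \<Rightarrow> 'e \<Rightarrow> 'e \<Rightarrow> 'e"
    and a b c d \<alpha> \<phi>\<^sub>0 \<rho> :: real
    and G :: "'p \<times> 'e \<Rightarrow> 'e \<times> 'e \<Rightarrow> 'e \<times> 'e \<Rightarrow> real"
    and \<xi> :: "'p \<times> 'e \<Rightarrow> 'e \<times> 'e"
    and \<eta> :: "'p \<times> 'e \<Rightarrow> 'e \<times> 'e \<Rightarrow> real"
    and \<phi> :: "'p \<times> 'e \<Rightarrow> 'e \<times> 'e \<Rightarrow> 'e \<times> 'e"
    and T\<^sub>1M :: "('p \<times> 'e) set"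
  assumes "n \<ge> 1" and "DIM('e) = n + 1"
    and "smooth_manifold A" and "riemannian_metric A g" and "levi_civita A g \<Gamma>"
    and "T\<^sub>1M = unit_tangent_bundle A g"
    and "g_natural_metric A g \<Gamma> a b c d G"
    and "nondegenerate (tangent_atlas A) T\<^sub>1M G"
    and "\<alpha> = a * (a + c) - b\<^sup>2" and "\<phi>\<^sub>0 = a * (a + c + d) - b\<^sup>2" and "\<rho> > 0"
    and "\<And>x u. (x, u) \<in> T\<^sub>1M \<Longrightarrow> \<xi> (x, u) = \<rho> *\<^sub>R hlift A \<Gamma> (x, u) u"
    and "\<And>p. p \<in> T\<^sub>1M \<Longrightarrow> lin_on (tangent_space (tangent_atlas A) T\<^sub>1M p) (\<eta> p)"
    and "\<And>x u X. (x, u) \<in> T\<^sub>1M \<Longrightarrow> \<eta> (x, u) (hlift A \<Gamma> (x, u) X) = 1 / \<rho> * g x X u"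
    and "\<And>x u Y. (x, u) \<in> T\<^sub>1M \<Longrightarrow> g x Y u = 0 \<Longrightarrow>
           \<eta> (x, u) (tlift A g \<Gamma> a b c d (x, u) Y) = b * \<rho> * g x Y u"
    and "\<And>p. p \<in> T\<^sub>1M \<Longrightarrow> lin_on (tangent_space (tangent_atlas A) T\<^sub>1M p) (\<phi> p)"
    and "\<And>x u X. (x, u) \<in> T\<^sub>1M \<Longrightarrow>
           \<phi> (x, u) (hlift A \<Gamma> (x, u) X) =
             (1 / (2 * \<rho> * \<alpha>)) *\<^sub>R
               (- b *\<^sub>R hlift A \<Gamma> (x, u) X + (a + c) *\<^sub>R tlift A g \<Gamma> a b c d (x, u) X
                + (b * d / (a + c + d) * g x X u) *\<^sub>R hlift A \<Gamma> (x, u) u)"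
    and "\<And>x u Y. (x, u) \<in> T\<^sub>1M \<Longrightarrow> g x Y u = 0 \<Longrightarrow>
           \<phi> (x, u) (tlift A g \<Gamma> a b c d (x, u) Y) =
             (1 / (2 * \<rho> * \<alpha>)) *\<^sub>R
               (- a *\<^sub>R hlift A \<Gamma> (x, u) Y + b *\<^sub>R tlift A g \<Gamma> a b c d (x, u) Y
                + (\<phi>\<^sub>0 / (a + c + d) * g x Y u) *\<^sub>R hlift A \<Gamma> (x, u) u)"
  shows "paracontact_metric_structure n (tangent_atlas A) T\<^sub>1M \<phi> \<xi> \<eta> G \<longleftrightarrow>
    a + c + d = - 4 * \<alpha> \<and> - 4 * \<alpha> = 1 / \<rho>\<^sup>2"
proof -
  interpret g_natural_structure A g \<Gamma> a b c d \<alpha> \<rho> G \<xi> \<eta> \<phi>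
    by unfold_locales (use assms in \<open>simp_all\<close>)
  show ?thesis
    using structure_imp_constants[of n] constants_imp_structure[of n] assms(1,2,6,8) by auto
qed

end
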